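(* Let $n>k>0$. There exist real numbers $t_1,t_2,\ldots,t_{k(n-k)}$ such that there are exactly $d(k,n)$ complex $k$-dimensional subspaces $K\subset\mathbb{C}^n$ satisfying $K\cap F_{n-k}(t_i)\ne\{0\}$ for all $i=1,\ldots,k(n-k)$, and all of them are real. Equivalently, with $\alpha=(1,2,\ldots,k-1,k+1)$, the intersection $X_\alpha F_\bullet(t_1)\cap\cdots\cap X_\alpha F_\bullet(t_{k(n-k)})$ in $\mathrm{Gr}(k,n)$ is transverse with all points real.
   Context: For $t\in\mathbb{C}$, $F_i(t)$ is the row space of the $i\times n$ matrix whose $(a,b)$ entry is $\binom{b-1}{a-1}t^{b-a}$ (zero when $b<a$); equivalently $F_i(t)$ is the $i$-plane osculating the rational normal curve $\gamma(t)=(1,t,t^2,\ldots,t^{n-1})$ at $\gamma(t)$, spanned by $\gamma(t),\gamma'(t),\ldots,\gamma^{(i-1)}(t)$, and $F_\bullet(t)$ is the flag $F_1(t)\subset\cdots\subset F_n(t)$. For a flag $F_\bullet$ and $\alpha\in\binom{[n]}{k}$, $X_\alpha F_\bullet=\{K\in\mathrm{Gr}(k,n): \dim(K\cap F_{n+1-\alpha_j})\ge k+1-j,\ j=1,\ldots,k\}$; for $\alpha=(1,\ldots,k-1,k+1)$ this is $\{K: K\cap F_{n-k}\ne\{0\}\}$. $d(k,n)=\dfrac{1!\,2!\cdots(k-1)!\,[k(n-k)]!}{(n-k)!\,(n-k+1)!\cdots(n-1)!}$ is the degree of $\mathrm{Gr}(k,n)$ in its Plücker embedding. *)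

theory Defs
  imports "HOL-Analysis.Analysis"
begin

text \<open>Coordinates of C^n are indexed by a finite, well-ordered type 'n with n = CARD('n);
  the 0-based position of an index b is the number of indices strictly below it.\<close>
definition pos :: "'n::{finite,wellorder} \<Rightarrow> nat" where
  "pos b = card {j. j < b}"

text \<open>Row a (0-based, a = 0..i-1) of the osculating matrix: entry in column b is
  binom(pos b, a) * t^(pos b - a), zero when pos b < a (1-based: binom(b-1,a-1) t^(b-a)).\<close>
definition osc_row :: "nat \<Rightarrow> complex \<Rightarrow> complex ^ 'n::{finite,wellorder}" where
  "osc_row a t = (\<chi> b. if a \<le> pos b then of_nat (pos b choose a) * t ^ (pos b - a) else 0)"

definition osc_flag :: "nat \<Rightarrow> complex \<Rightarrow> (complex ^ 'n::{finite,wellorder}) set" where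
  "osc_flag i t = vec.span {osc_row a t | a. a < i}"

definition real_subspace :: "(complex ^ 'n) set \<Rightarrow> bool" where
  "real_subspace K \<longleftrightarrow> vec.span {v \<in> K. \<forall>i. v $ i \<in> \<real>} = K"

text \<open>Degree of Gr(k,n): 1!2!...(k-1)! (k(n-k))! / ((n-k)!(n-k+1)!...(n-1)!) (an integer).\<close>
definition grass_degree :: "nat \<Rightarrow> nat \<Rightarrow> nat" where
  "grass_degree k n =
     ((\<Prod>i\<in>{1..<k}. fact i) * fact (k * (n - k))) div (\<Prod>i\<in>{n-k..<n}. fact i)"

definition schubert_solutions :: "nat \<Rightarrow> (nat \<Rightarrow> real) \<Rightarrow> (complex ^ 'n::{finite,wellorder}) set set" where
  "schubert_solutions k t =
     {K. vec.subspace K \<and> vec.dim K = k \<and>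
         (\<forall>i\<in>{1..k * (CARD('n) - k)}. K \<inter> osc_flag (CARD('n) - k) (complex_of_real (t i)) \<noteq> {0})}"

end

theory Submission
  imports Defs
begin

text \<open>
  Identify the condition "K meets the osculating flag at t" with the vanishing at t of a
  determinant, the Wronskian of K, which is a polynomial in t.  One constructs the t's one at a time.
  A k-plane in a Schubert cell of dimension m + 1, given by pivot degrees d, whose Wronskian
  vanishes at the m points found so far and at one further point s, has for s tending to infinity
  a limit whose Wronskian has degree m; the limit therefore lies in a cell of dimension m obtained
  by lowering one pivot degree by 1.  Conversely, the inverse function theorem, applied in a chart
  around the smaller cell, shows that every (nondegenerate, real) solution in the smaller cell is the
  limit of exactly one solution in the larger cell; uniqueness forces it to be invariant under
  complex conjugation, i.e. real.  So the numbers of solutions obey the branching rule of standard Young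
  tableaux, and Frobenius' product formula gives the degree of the Grassmannian.
\<close>

section \<open>The branching rule for the product formula\<close>

text \<open>The point to control is that no solution is lost or created when a root is added. The
  Wronskian always has a zero of order at least \<open>q\<close> = 0 + ... + (k - 1) at 0, and its
  degree is at most the sum of the pivot degrees. So \<open>m\<close> further nonzero roots exclude
  all cells of dimension below \<open>m\<close>: this keeps limits out of cells that are too small,
  and at the end puts every solution into the open cell. The points are chosen positive because 0 is
  already a root whenever k > 1. The far root is written \<open>1 / \<tau>\<close>, and its equation
  is replaced by one for the reciprocal polynomial, which stays smooth at \<tau> = 0. Coordinates of
  a solution in its own cell blow up there, so the comparison is made in a chart whose unit block
  sits at the lowered pivots, and is moved back afterwards. Two demands shape the induction:
  nondegeneracy must be carried along with the count, being the hypothesis of the inverse function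
  theorem, and one set of points must serve all cells of a given dimension, since the count for a
  cell draws on all the cells just below it.\<close>

definition shift_weight :: "real set \<Rightarrow> real \<Rightarrow> real" where
  "shift_weight S a = (\<Prod>b\<in>S - {a}. 1 - 1 / (a - b))"

lemma shift_weight_insert:
  assumes "finite S" "z \<notin> S" "a \<in> S"
  shows "shift_weight (insert z S) a = shift_weight S a * (1 - 1 / (a - z))"
proof -
  have "insert z S - {a} = insert z (S - {a})" using assms by auto
  then show ?thesis using assms by (simp add: shift_weight_def)
qed

lemma shift_weight_insert_new:
  assumes "z \<notin> S"
  shows "shift_weight (insert z S) z = (\<Prod>b\<in>S. 1 - 1 / (z - b))"
proof -
  have "insert z S - {z} = S" using assms by auto
  then show ?thesis by (simp add: shift_weight_def)
qed

text \<open>As a function of \<open>y\<close> the product tends to 1 at infinity and has simple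
  poles at the elements of \<open>S\<close>, with residue \<open>- shift_weight S a\<close> at
  \<open>a\<close>.\<close>

lemma shift_weight_partial_fractions:
  assumes "finite S" "y \<notin> S"
  shows "(\<Prod>b\<in>S. 1 - 1 / (y - b)) = 1 - (\<Sum>a\<in>S. shift_weight S a / (y - a))"
  using assms
proof (induction S arbitrary: y rule: finite_induct)
  case empty
  then show ?case by simp
next
  case (insert z S)
  have yz: "y \<noteq> z" "y \<notin> S" using insert by auto
  have "(\<Sum>a\<in>S. shift_weight (insert z S) a / (y - a))
     = (\<Sum>a\<in>S. shift_weight S a / (y - a) * (1 - 1 / (y - z)) + shift_weight S a / (z - a) / (y - z))"
  proof (intro sum.cong refl)
    fix a assume a: "a \<in> S"
    have ne: "y - a \<noteq> 0" "y - z \<noteq> 0" "a - z \<noteq> 0" "z - a \<noteq> 0" using a yz insert.hyps by auto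
    \<comment> \<open>The factor of the new element is replaced by its value at \<open>y\<close>,
      plus a correction with a pole at \<open>y = z\<close>. The corrections sum to the same
      identity evaluated at \<open>z\<close>, which is why the induction hypothesis is used both at
      \<open>y\<close> and at \<open>z\<close>.\<close>
    have "(1 - 1 / (a - z)) / (y - a) = (1 - 1 / (y - z)) / (y - a) + 1 / (z - a) / (y - z)"
      using ne by (simp add: divide_simps) (simp add: algebra_simps)
    from arg_cong[OF this, of "\<lambda>u. shift_weight S a * u"]
    show "shift_weight (insert z S) a / (y - a)
       = shift_weight S a / (y - a) * (1 - 1 / (y - z)) + shift_weight S a / (z - a) / (y - z)"
      using a insert.hyps by (simp add: shift_weight_insert algebra_simps)
  qed
  also have "\<dots> = (\<Sum>a\<in>S. shift_weight S a / (y - a)) * (1 - 1 / (y - z))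
      + (\<Sum>a\<in>S. shift_weight S a / (z - a)) / (y - z)"
    by (simp only: sum.distrib sum_distrib_right sum_divide_distrib)
  finally have s: "(\<Sum>a\<in>S. shift_weight (insert z S) a / (y - a))
     = (\<Sum>a\<in>S. shift_weight S a / (y - a)) * (1 - 1 / (y - z)) + (\<Sum>a\<in>S. shift_weight S a / (z - a)) / (y - z)" .
  have alg: "(1 - A) * (1 - 1 / w) = 1 - ((1 - B) / w + (A * (1 - 1 / w) + B / w))" for A B w :: real
    by (simp add: algebra_simps diff_divide_distrib)
  show ?case
    using insert.hyps s alg
    by (simp only: prod.insert sum.insert shift_weight_insert_new not_False_eq_True
        insert.IH[OF yz(2)] insert.IH[OF insert.hyps(2)]) (simp add: mult.commute)
qed

text \<open>These are the coefficients of 1/y and 1/y^2 when the partial fraction identity is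
  expanded at infinity. In the induction, the identity evaluated at the new element \<open>z\<close>
  supplies the weight of \<open>z\<close>.\<close>

lemma sum_shift_weight:
  assumes "finite S"
  shows "(\<Sum>a\<in>S. shift_weight S a) = card S"
    and "(\<Sum>a\<in>S. a * shift_weight S a) = \<Sum>S - card S * (card S - 1) / 2"
proof -
  have "(\<Sum>a\<in>S. shift_weight S a) = card S \<and>
    (\<Sum>a\<in>S. a * shift_weight S a) = \<Sum>S - card S * (real (card S) - 1) / 2"
    using assms
  proof (induction S rule: finite_induct)
    case empty
    then show ?case by simp
  next
    case (insert z S)
    have pf: "(\<Prod>b\<in>S. 1 - 1 / (z - b)) = 1 - (\<Sum>a\<in>S. shift_weight S a / (z - a))"
      using insert shift_weight_partial_fractions by simp
    have e1: "(\<Sum>a\<in>S. shift_weight (insert z S) a) = (\<Sum>a\<in>S. shift_weight S a + shift_weight S a / (z - a))"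
    proof (intro sum.cong refl)
      fix a assume a: "a \<in> S"
      then have "a - z \<noteq> 0" "z - a \<noteq> 0" using insert by auto
      then have "1 - 1 / (a - z) = 1 + 1 / (z - a)" using minus_divide_right[of 1 "z - a"] by simp
      then show "shift_weight (insert z S) a = shift_weight S a + shift_weight S a / (z - a)"
        by (simp only: shift_weight_insert[OF insert.hyps a] distrib_left mult_1_right times_divide_eq_right)
    qed
    have e2: "(\<Sum>a\<in>S. a * shift_weight (insert z S) a)
       = (\<Sum>a\<in>S. a * shift_weight S a - shift_weight S a + z * (shift_weight S a / (z - a)))"
    proof (intro sum.cong refl)
      fix a assume a: "a \<in> S"
      then have ne: "a - z \<noteq> 0" "z - a \<noteq> 0" using insert by auto
      then have "a * (1 - 1 / (a - z)) = a - 1 + z / (z - a)"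
        by (simp add: divide_simps) (simp add: algebra_simps)
      from arg_cong[OF this, of "\<lambda>u. shift_weight S a * u"]
      show "a * shift_weight (insert z S) a
          = a * shift_weight S a - shift_weight S a + z * (shift_weight S a / (z - a))"
        using a insert.hyps by (simp add: shift_weight_insert algebra_simps)
    qed
    have s1: "(\<Sum>a\<in>S. shift_weight S a) = card S"
      and s2: "(\<Sum>a\<in>S. a * shift_weight S a) = \<Sum>S - card S * (real (card S) - 1) / 2"
      using insert.IH by auto
    have i1: "(\<Sum>a\<in>insert z S. shift_weight (insert z S) a) = card (insert z S)"
      using insert.hyps by (simp add: e1 shift_weight_insert_new pf sum.distrib s1)
    have "(\<Sum>a\<in>insert z S. a * shift_weight (insert z S) a)
       = z * (1 - (\<Sum>a\<in>S. shift_weight S a / (z - a))) + ((\<Sum>S - card S * (real (card S) - 1) / 2) - card S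
          + z * (\<Sum>a\<in>S. shift_weight S a / (z - a)))"
      using insert.hyps
      by (simp only: sum.insert e2 shift_weight_insert_new pf sum.distrib sum_subtractf s1 s2
            sum_distrib_left[symmetric] not_False_eq_True)
    also have "\<dots> = \<Sum>(insert z S) - card (insert z S) * (real (card (insert z S)) - 1) / 2"
      using insert.hyps by (simp add: algebra_simps diff_divide_distrib add_divide_distrib)
    finally show ?case using i1 by simp
  qed
  then show "(\<Sum>a\<in>S. shift_weight S a) = card S"
    and "(\<Sum>a\<in>S. a * shift_weight S a) = \<Sum>S - card S * (card S - 1) / 2"
    by (cases "S = {}"; auto simp: of_nat_diff Suc_leI card_gt_0_iff assms)+
qed

section \<open>Vandermonde products with one entry lowered\<close>

definition diff_prod :: "'a::linorder set \<Rightarrow> ('a \<Rightarrow> real) \<Rightarrow> real" where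
  "diff_prod R d = (\<Prod>p\<in>{p \<in> R \<times> R. fst p < snd p}. d (snd p) - d (fst p))"

lemma diff_prod_split:
  fixes R :: "'a::linorder set"
  assumes fin: "finite R" and i: "i \<in> R"
  shows "diff_prod R d = (\<Prod>p\<in>{p \<in> (R - {i}) \<times> (R - {i}). fst p < snd p}. d (snd p) - d (fst p))
     * (\<Prod>j\<in>R - {i}. if j < i then d i - d j else d j - d i)"
proof -
  let ?f = "\<lambda>p. d (snd p) - d (fst p)"
  let ?A = "{p \<in> (R - {i}) \<times> (R - {i}). fst p < snd p}"
  let ?g = "\<lambda>j. if j < i then (j, i) else (i, j)"
  have inj: "inj_on ?g (R - {i})" by (auto simp: inj_on_def split: if_splits)
  have eq: "{p \<in> R \<times> R. fst p < snd p} = ?A \<union> ?g ` (R - {i})"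
    using i by (auto simp: image_iff split: if_splits)
  have fins: "finite ?A" "finite (?g ` (R - {i}))" using fin by auto
  have dis: "?A \<inter> ?g ` (R - {i}) = {}" by auto
  have "diff_prod R d = prod ?f ?A * prod ?f (?g ` (R - {i}))"
    unfolding diff_prod_def eq by (rule prod.union_disjoint[OF fins dis])
  also have "prod ?f (?g ` (R - {i})) = (\<Prod>j\<in>R - {i}. if j < i then d i - d j else d j - d i)"
    unfolding prod.reindex[OF inj] by (intro prod.cong) auto
  finally show ?thesis .
qed

text \<open>Only factors containing \<open>i\<close> change, and each is multiplied by
  \<open>1 - 1 / (d i - d j)\<close> whether \<open>j\<close> comes before or after
  \<open>i\<close>: the sign of the difference and the sign of its change reverse together.\<close>

lemma diff_prod_shift:
  fixes R :: "'a::linorder set"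
  assumes fin: "finite R" and i: "i \<in> R" and inj: "inj_on d R"
  shows "diff_prod R (d(i := d i - 1)) = diff_prod R d * shift_weight (d ` R) (d i)"
proof -
  have "shift_weight (d ` R) (d i) = (\<Prod>j\<in>R - {i}. 1 - 1 / (d i - d j))"
  proof -
    have "d ` R - {d i} = d ` (R - {i})" using inj i by (auto simp: inj_on_def)
    moreover have "inj_on d (R - {i})" using inj by (rule inj_on_subset) auto
    ultimately show ?thesis by (simp add: shift_weight_def prod.reindex)
  qed
  moreover have "(\<Prod>j\<in>R - {i}. if j < i then (d(i := d i - 1)) i - (d(i := d i - 1)) j else (d(i := d i - 1)) j - (d(i := d i - 1)) i)
     = (\<Prod>j\<in>R - {i}. (if j < i then d i - d j else d j - d i) * (1 - 1 / (d i - d j)))"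
  proof (intro prod.cong refl)
    fix j assume j: "j \<in> R - {i}"
    then have "d i - d j \<noteq> 0" using inj i by (auto simp: inj_on_def)
    then show "(if j < i then (d(i := d i - 1)) i - (d(i := d i - 1)) j else (d(i := d i - 1)) j - (d(i := d i - 1)) i)
      = (if j < i then d i - d j else d j - d i) * (1 - 1 / (d i - d j))"
      using j by (auto simp: field_simps)
  qed
  moreover have "(\<Prod>p\<in>{p \<in> (R - {i}) \<times> (R - {i}). fst p < snd p}. (d(i := d i - 1)) (snd p) - (d(i := d i - 1)) (fst p))
     = (\<Prod>p\<in>{p \<in> (R - {i}) \<times> (R - {i}). fst p < snd p}. d (snd p) - d (fst p))"
    by (intro prod.cong) auto
  ultimately show ?thesis
    unfolding diff_prod_split[OF fin i, of d] diff_prod_split[OF fin i, of "d(i := d i - 1)"]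
    by (simp add: prod.distrib)
qed

text \<open>Divided by the product of the factorials of the \<open>d i\<close> and multiplied by a factorial, \<open>diff_prod\<close> is
  Frobenius' number of standard tableaux; this is its branching rule.\<close>
lemma diff_prod_branching:
  fixes R :: "'a::linorder set"
  assumes fin: "finite R" and inj: "inj_on d R"
  shows "(\<Sum>i\<in>R. d i * diff_prod R (d(i := d i - 1)))
     = diff_prod R d * (sum d R - card R * (card R - 1) / 2)"
proof -
  have "(\<Sum>i\<in>R. d i * diff_prod R (d(i := d i - 1)))
      = (\<Sum>i\<in>R. diff_prod R d * (d i * shift_weight (d ` R) (d i)))"
    using diff_prod_shift[OF fin _ inj] by (intro sum.cong) auto
  also have "\<dots> = diff_prod R d * (\<Sum>a\<in>d ` R. a * shift_weight (d ` R) a)"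
    by (simp add: sum_distrib_left sum.reindex[OF inj])
  finally show ?thesis
    using sum_shift_weight(2)[of "d ` R"] fin by (simp add: card_image[OF inj] sum.reindex[OF inj])
qed

section \<open>The Wronskian of a tuple of rows\<close>

lemma pos_strict_mono: "i < j \<Longrightarrow> pos i < pos j"
  unfolding pos_def by (intro psubset_card_mono) auto

lemma pos_less_iff: "pos i < pos j \<longleftrightarrow> i < j"
  by (metis pos_strict_mono less_asym linorder_neqE)

lemma inj_pos: "inj pos"
  by (metis injI pos_strict_mono less_irrefl linorder_neqE)

lemma pos_less_card: "pos (b::'n::{finite,wellorder}) < CARD('n)"
  unfolding pos_def by (intro psubset_card_mono) auto

lemma range_pos: "range (pos :: 'n::{finite,wellorder} \<Rightarrow> nat) = {..<CARD('n)}"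
  by (intro card_subset_eq) (auto simp: pos_less_card card_image inj_pos)

text \<open>Reversed positions serve as degrees: scaling column \<open>b\<close> by \<open>t ^ dg b\<close> turns the osculating
  rows at \<open>t\<close> into multiples of those at \<open>1\<close>.\<close>
definition dg :: "'n::{finite,wellorder} \<Rightarrow> nat" where
  "dg b = CARD('n) - 1 - pos b"

definition col :: "nat \<Rightarrow> 'n::{finite,wellorder}" where
  "col e = inv dg e"

lemma pos_add_dg: "pos (b::'n::{finite,wellorder}) + dg b = CARD('n) - 1"
  using pos_less_card[of b] by (simp add: dg_def)

lemma dg_less_card: "dg (b::'n::{finite,wellorder}) < CARD('n)"
  using pos_add_dg[of b] pos_less_card[of b] by linarith

lemma inj_dg: "inj (dg :: 'n::{finite,wellorder} \<Rightarrow> nat)"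
  by (metis injI inj_pos injD pos_add_dg add_right_cancel)

lemma range_dg: "range (dg :: 'n::{finite,wellorder} \<Rightarrow> nat) = {..<CARD('n)}"
  by (intro card_subset_eq) (auto simp: dg_less_card card_image inj_dg)

lemma dg_col [simp]: "e < CARD('n) \<Longrightarrow> dg (col e :: 'n::{finite,wellorder}) = e"
  unfolding col_def by (intro f_inv_into_f) (simp add: range_dg)

lemma col_dg [simp]: "col (dg b) = b"
  by (simp add: col_def inv_f_f inj_dg)

lemma col_eq_iff: "e < CARD('n) \<Longrightarrow> col e = (b :: 'n::{finite,wellorder}) \<longleftrightarrow> e = dg b"
  by (metis dg_col col_dg)

text \<open>Distinct natural numbers in increasing order dominate 0, 1, 2, ...; this bounds the
  order of vanishing of the Wronskian at 0 from below.\<close>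

lemma sum_lessThan_card_le:
  fixes A :: "nat set"
  assumes "finite A"
  shows "\<Sum>{..<card A} \<le> \<Sum>A"
  using assms
proof (induction A rule: finite_linorder_max_induct)
  case empty
  then show ?case by simp
next
  case (insert b A)
  have "card A \<le> b" using card_mono[of "{..<b}" A] insert by auto
  moreover have "b \<notin> A" using insert by auto
  ultimately show ?case using insert by simp
qed

lemma prod_monom: "finite A \<Longrightarrow> (\<Prod>i\<in>A. monom (f i) (g i)) = monom (\<Prod>i\<in>A. f i) (\<Sum>i\<in>A. g i)"
  by (induction A rule: finite_induct) (auto simp: mult_monom)

lemma prod_const_poly: "finite A \<Longrightarrow> (\<Prod>i\<in>A. [:f i:]) = [:(\<Prod>i\<in>A. f i):]"
  by (induction A rule: finite_induct) (auto simp: pCons_one mult.commute)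

lemma poly_of_int: "poly (of_int m) t = of_int m"
  by (cases m) (simp_all add: of_nat_poly)

lemma span_imageE:
  assumes "finite R" "v \<in> vec.span (f ` R)"
  obtains a where "v = (\<Sum>j\<in>R. a j *s f j)"
proof -
  from assms(2) have "\<exists>a. v = (\<Sum>j\<in>R. a j *s f j)"
  proof (induction rule: vec.span_induct_alt)
    case base
    show ?case by (rule exI[of _ "\<lambda>_. 0"]) simp
  next
    case (step c x y)
    then obtain j a where j: "j \<in> R" "x = f j" "y = (\<Sum>j\<in>R. a j *s f j)" by auto
    have "(\<Sum>l\<in>R. (a l + (if l = j then c else 0)) *s f l) = c *s x + y"
      using assms(1) j by (simp add: vec.scale_left_distrib sum.distrib if_distrib[of "\<lambda>u. u *s _"] cong: if_cong)
    then show ?case by (intro exI[of _ "\<lambda>l. a l + (if l = j then c else 0)"]) simp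
  qed
  then show thesis using that by blast
qed

section \<open>Expansion, degree and roots of the Wronskian determinant\<close>

type_synonym 'n cmat = "((complex, 'n) vec, 'n) vec"

text \<open>The rows \<open>V\<close> stand for osculating rows at 1. Two properties are isolated:
  they are real, so complex conjugation acts on the solutions, and they complete any
  \<open>k\<close> distinct unit rows to an invertible matrix, so that no cell loses its leading
  coefficient.\<close>

locale wronski_form =
  fixes k :: nat and V :: "'n::{finite,wellorder} \<Rightarrow> 'n \<Rightarrow> real"
  assumes k_le: "k \<le> CARD('n::{finite,wellorder})"
    and V_nondeg: "\<And>\<delta>. inj_on \<delta> {i::'n::{finite,wellorder}. pos i < k} \<Longrightarrow> (\<And>i. \<delta> i < CARD('n)) \<Longrightarrow>
      det ((\<chi> i b. if pos i < k then if b = col (\<delta> i) then 1 else 0 else V i b) :: real ^ 'n::{finite,wellorder} ^ 'n::{finite,wellorder}) \<noteq> 0"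
begin

definition R :: "'n set" where "R = {i. pos i < k}"

definition q :: nat where "q = sum pos R"

lemma bij_pos_R: "bij_betw pos R {..<k}"
proof -
  have "pos ` R = {..<k}"
  proof
    show "{..<k} \<subseteq> pos ` R"
    proof
      fix e assume e: "e \<in> {..<k}"
      then have "e \<in> range (pos :: 'n \<Rightarrow> nat)" using k_le by (auto simp: range_pos)
      then show "e \<in> pos ` R" using e by (auto simp: R_def)
    qed
  qed (auto simp: R_def)
  then show ?thesis by (auto simp: bij_betw_def intro: inj_on_subset[OF inj_pos])
qed

lemma card_R: "card R = k"
  using bij_betw_same_card[OF bij_pos_R] by simp

lemma q_eq: "q = \<Sum>{..<k}"
  unfolding q_def using sum.reindex_bij_betw[OF bij_pos_R, of "\<lambda>x. x"] by simp

text \<open>Every variable entry carries the degree of its column, so each permutation contributes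
  one monomial, of degree \<open>wt p\<close>. With the osculating choice of \<open>V\<close> and
  nonzero t, the value at t is, up to a power of t, the determinant of the rows of \<open>x\<close>
  stacked on the osculating rows at t.\<close>

definition P :: "'n cmat \<Rightarrow> complex poly" where
  "P x = det (\<chi> i b. if i \<in> R then monom (x $ i $ b) (dg b) else [:complex_of_real (V i b):])"

definition cf :: "('n \<Rightarrow> 'n) \<Rightarrow> real" where
  "cf p = of_int (sign p) * (\<Prod>i\<in>-R. V i (p i))"

definition wt :: "('n \<Rightarrow> 'n) \<Rightarrow> nat" where
  "wt p = (\<Sum>i\<in>R. dg (p i))"

text \<open>For distinct values of \<delta> this is, up to sign, the minor of \<open>V\<close>
  complementary to the columns \<open>col (\<delta> i)\<close>.\<close>

definition lc :: "('n \<Rightarrow> nat) \<Rightarrow> real" where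
  "lc \<delta> = det (\<chi> i b. if i \<in> R then if b = col (\<delta> i) then 1 else 0 else V i b)"

lemma lc_nonzero: "inj_on \<delta> R \<Longrightarrow> (\<And>i. \<delta> i < CARD('n)) \<Longrightarrow> lc \<delta> \<noteq> 0"
  using V_nondeg[of \<delta>] by (simp add: lc_def R_def)

lemma prod_UNIV_split: "prod f (UNIV :: 'n set) = prod f R * prod f (- R)"
  by (subst prod.union_disjoint[symmetric]) auto

lemma P_expand:
  "P x = (\<Sum>p | p permutes UNIV. monom (of_real (cf p) * (\<Prod>i\<in>R. x $ i $ p i)) (wt p))"
  unfolding P_def det_def
proof (intro sum.cong refl)
  fix p :: "'n \<Rightarrow> 'n"
  assume "p \<in> {p. p permutes UNIV}"
  have "(\<Prod>i\<in>R. (if i \<in> R then monom (x $ i $ p i) (dg (p i)) else [:complex_of_real (V i (p i)):]))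
       = monom (\<Prod>i\<in>R. x $ i $ p i) (wt p)"
    by (simp add: prod_monom wt_def cong: prod.cong_simp)
  moreover have "(\<Prod>i\<in>-R. (if i \<in> R then monom (x $ i $ p i) (dg (p i)) else [:complex_of_real (V i (p i)):]))
       = [:(\<Prod>i\<in>-R. complex_of_real (V i (p i))):]"
    by (simp add: prod_const_poly cong: prod.cong_simp)
  ultimately show "of_int (sign p) * (\<Prod>i\<in>UNIV. (\<chi> i b. if i \<in> R then monom (x $ i $ b) (dg b)
       else [:complex_of_real (V i b):]) $ i $ p i)
      = monom (of_real (cf p) * (\<Prod>i\<in>R. x $ i $ p i)) (wt p)"
    by (simp add: prod_UNIV_split cf_def of_int_poly monom_0[symmetric] mult_monom mult_ac smult_monom)
qed

lemma poly_P: "poly (P x) t = (\<Sum>p | p permutes UNIV. of_real (cf p) * (\<Prod>i\<in>R. x $ i $ p i) * t ^ wt p)"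
  by (simp add: P_expand poly_sum poly_monom)

lemma coeff_P: "coeff (P x) e = (\<Sum>p | p permutes UNIV. if wt p = e then of_real (cf p) * (\<Prod>i\<in>R. x $ i $ p i) else 0)"
  by (simp add: P_expand coeff_sum)

lemma lc_expand: "lc \<delta> = (\<Sum>p | p permutes UNIV. if \<forall>i\<in>R. p i = col (\<delta> i) then cf p else 0)"
  unfolding lc_def det_def
proof (intro sum.cong refl)
  fix p :: "'n \<Rightarrow> 'n"
  have 1: "(\<Prod>i\<in>R. (if i \<in> R then if p i = col (\<delta> i) then 1 else 0 else V i (p i)))
     = (if \<forall>i\<in>R. p i = col (\<delta> i) then 1 else 0)"
    by (auto simp: prod_zero_iff intro!: prod.neutral)
  have 2: "(\<Prod>i\<in>-R. (if i \<in> R then if p i = col (\<delta> i) then 1 else 0 else V i (p i))) = (\<Prod>i\<in>-R. V i (p i))"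
    by (intro prod.cong) auto
  show "of_int (sign p) * (\<Prod>i\<in>UNIV. (\<chi> i b. if i \<in> R then if b = col (\<delta> i) then 1 else 0 else V i b) $ i $ p i)
      = (if \<forall>i\<in>R. p i = col (\<delta> i) then cf p else 0)"
    unfolding prod_UNIV_split by (simp add: 1 2 cf_def)
qed

definition le :: "('n \<Rightarrow> nat) \<Rightarrow> 'n cmat \<Rightarrow> bool" where
  "le d x \<longleftrightarrow> (\<forall>i\<in>R. \<forall>b. d i < dg b \<longrightarrow> x $ i $ b = 0)"

lemma prod_eq_0_le:
  assumes "le d x" "i \<in> R" "d i < dg (p i)"
  shows "(\<Prod>i\<in>R. x $ i $ p i) = 0"
  using assms by (intro prod_zero) (auto simp: le_def)

text \<open>Entries of degree above \<open>d i\<close> vanish in row \<open>i\<close>. A surviving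
  permutation therefore has weight at most \<open>sum d R\<close>, with equality only if every row
  uses its pivot column.\<close>

lemma coeff_P_top:
  assumes le: "le d x" and d: "\<And>i. d i < CARD('n)"
  shows "coeff (P x) (sum d R) = of_real (lc d) * (\<Prod>i\<in>R. x $ i $ col (d i))"
proof -
  have "(if wt p = sum d R then of_real (cf p) * (\<Prod>i\<in>R. x $ i $ p i) else 0)
      = of_real (if \<forall>i\<in>R. p i = col (d i) then cf p else 0) * (\<Prod>i\<in>R. x $ i $ col (d i))" for p
  proof (cases "\<forall>i\<in>R. p i = col (d i)")
    case True
    then have "wt p = sum d R" unfolding wt_def by (intro sum.cong) (auto simp: d)
    moreover have "(\<Prod>i\<in>R. x $ i $ p i) = (\<Prod>i\<in>R. x $ i $ col (d i))"
      using True by (intro prod.cong) auto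
    ultimately show ?thesis using True by simp
  next
    case False
    then obtain i where i: "i \<in> R" "p i \<noteq> col (d i)" by auto
    show ?thesis
    proof (cases "\<exists>j\<in>R. d j < dg (p j)")
      case True
      then show ?thesis using False prod_eq_0_le[OF le] by auto
    next
      case nl: False
      have "dg (p i) \<noteq> d i" using i col_dg by metis
      then have "wt p < sum d R"
        unfolding wt_def using nl i by (intro sum_strict_mono_ex1) (auto simp: not_less le_less)
      then show ?thesis using i by auto
    qed
  qed
  then show ?thesis
    by (simp only: coeff_P lc_expand of_real_sum sum_distrib_right)
qed

lemma coeff_P_above:
  assumes le: "le d x" and e: "sum d R < e"
  shows "coeff (P x) e = 0"
  unfolding coeff_P
proof (intro sum.neutral ballI)
  fix p
  show "(if wt p = e then of_real (cf p) * (\<Prod>i\<in>R. x $ i $ p i) else 0) = 0"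
  proof (cases "\<exists>j\<in>R. d j < dg (p j)")
    case True
    then show ?thesis using prod_eq_0_le[OF le] by auto
  next
    case False
    then have "wt p \<le> sum d R" unfolding wt_def by (intro sum_mono) (auto simp: not_less)
    then show ?thesis using e by auto
  qed
qed

lemma degree_P_le: "le d x \<Longrightarrow> degree (P x) \<le> sum d R"
  by (rule degree_le) (auto simp: coeff_P_above)

text \<open>A permutation selects \<open>k\<close> columns of distinct degrees, so no monomial lies
  below 0 + ... + (k - 1).\<close>

lemma coeff_P_below:
  assumes "e < q"
  shows "coeff (P x) e = 0"
  unfolding coeff_P
proof (intro sum.neutral ballI)
  fix p :: "'n \<Rightarrow> 'n"
  assume "p \<in> {p. p permutes UNIV}"
  then have inj: "inj_on (\<lambda>i. dg (p i)) R"
    by (auto intro!: inj_onI dest: permutes_inj injD[OF inj_dg] injD)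
  have "q \<le> \<Sum>((\<lambda>i. dg (p i)) ` R)"
    using sum_lessThan_card_le[of "(\<lambda>i. dg (p i)) ` R"] by (simp add: card_image[OF inj] q_eq card_R)
  then have "q \<le> wt p" by (simp add: sum.reindex[OF inj] wt_def)
  then show "(if wt p = e then of_real (cf p) * (\<Prod>i\<in>R. x $ i $ p i) else 0) = 0"
    using assms by auto
qed

text \<open>The forced zero of order \<open>q\<close> at 0 is added to the prescribed roots, hence 0
  must stay outside \<open>T\<close>. Against the upper bound \<open>sum d R\<close> this leaves
  only cells of dimension at least \<open>card T\<close>.\<close>

lemma degree_P_ge:
  assumes ne: "P x \<noteq> 0" and T: "finite T" "0 \<notin> T"
    and roots: "\<And>t. t \<in> T \<Longrightarrow> poly (P x) (complex_of_real t) = 0"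
  shows "q + card T \<le> degree (P x)"
proof -
  have "monom 1 q dvd P x" by (simp add: monom_1_dvd_iff' coeff_P_below)
  then obtain r where r: "P x = monom 1 q * r" by blast
  have r0: "r \<noteq> 0" using ne r by auto
  have "complex_of_real ` T \<subseteq> {z. poly r z = 0}"
    using roots T r by (force simp: poly_monom)
  then have "card T \<le> card {z. poly r z = 0}"
    using card_mono[OF poly_roots_finite[OF r0]] by (metis card_image inj_of_real inj_on_subset subset_UNIV)
  also have "\<dots> \<le> degree r" by (rule card_poly_roots_bound[OF r0])
  finally show ?thesis using r r0 by (simp add: degree_mult_eq degree_monom_eq monom_eq_0_iff)
qed

text \<open>The transition matrix is extended by the identity outside \<open>R\<close>; its entries
  are constant in t, so they commute with the scaling of columns. The factor depends on
  \<open>A\<close> alone, so one and the same factor serves a whole line of matrices.\<close>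

lemma P_row_transform:
  assumes "\<And>i. i \<in> R \<Longrightarrow> y $ i = (\<Sum>j\<in>R. A i j *s x $ j)"
  shows "P y = det ((\<chi> i j. if i \<in> R then if j \<in> R then [:A i j:] else 0 else if i = j then 1 else 0) :: ((complex poly, 'n) vec, 'n) vec) * P x"
proof -
  let ?M = "\<lambda>x. (\<chi> i b. if i \<in> R then monom (x $ i $ b) (dg b) else [:complex_of_real (V i b):]) :: ((complex poly, 'n) vec, 'n) vec"
  let ?A = "(\<chi> i j. if i \<in> R then if j \<in> R then [:A i j:] else 0 else if i = j then 1 else 0) :: ((complex poly, 'n) vec, 'n) vec"
  have "?M y $ i $ b = (?A ** ?M x) $ i $ b" for i b
  proof (cases "i \<in> R")
    case True
    have "(?A ** ?M x) $ i $ b = (\<Sum>j\<in>R. ?A $ i $ j * ?M x $ j $ b)"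
      unfolding matrix_matrix_mult_def vec_lambda_beta using True by (intro sum.mono_neutral_right) auto
    also have "\<dots> = (\<Sum>j\<in>R. monom (A i j * x $ j $ b) (dg b))"
      using True by (intro sum.cong) (auto simp: smult_monom)
    also have "\<dots> = ?M y $ i $ b"
      using True assms[of i] by (simp add: monom_sum)
    finally show ?thesis by simp
  next
    case False
    have "(?A ** ?M x) $ i $ b = (\<Sum>j\<in>{i}. ?A $ i $ j * ?M x $ j $ b)"
      unfolding matrix_matrix_mult_def vec_lambda_beta using False by (intro sum.mono_neutral_right) auto
    then show ?thesis using False by simp
  qed
  then have "?M y = ?A ** ?M x" by (simp add: vec_eq_iff)
  then show ?thesis unfolding P_def by (simp add: det_mul)
qed

text \<open>Divisibility transfers roots from \<open>x\<close> to \<open>y\<close> and nonvanishing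
  from \<open>y\<close> to \<open>x\<close>, for any linear dependence of the rows, invertible or
  not.\<close>

lemma P_span_dvd:
  assumes "\<And>i. i \<in> R \<Longrightarrow> y $ i \<in> vec.span (($) x ` R)"
  shows "P x dvd P y"
proof -
  have "\<exists>a. y $ i = (\<Sum>j\<in>R. a j *s x $ j)" if "i \<in> R" for i
    using span_imageE[OF _ assms[OF that]] by auto
  then obtain A where "\<And>i. i \<in> R \<Longrightarrow> y $ i = (\<Sum>j\<in>R. A i j *s x $ j)" by metis
  from P_row_transform[OF this] show ?thesis by simp
qed

lemma poly_P_cnj:
  "poly (P (\<chi> i b. cnj (x $ i $ b))) (complex_of_real t) = cnj (poly (P x) (of_real t))"
  by (simp add: poly_P)

end

section \<open>Schubert cells and bounded bases\<close>

lemma span_image_mono: "v \<in> vec.span (f ` A) \<Longrightarrow> A \<subseteq> B \<Longrightarrow> v \<in> vec.span (f ` B)"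
  using vec.span_mono[of "f ` A" "f ` B"] by blast

text \<open>One pass in increasing order is enough: subtracting a multiple of \<open>f b\<close> to
  clear column \<open>\<alpha> b\<close> leaves the earlier columns at 0, because \<open>f b\<close>
  vanishes there.\<close>

lemma ex_vanishing_translate:
  fixes f :: "'a::linorder \<Rightarrow> ('b::field, 'n::finite) vec"
  assumes "finite S"
    and "\<And>i. i \<in> S \<Longrightarrow> f i $ \<alpha> i = 1"
    and "\<And>i l. i \<in> S \<Longrightarrow> l \<in> S \<Longrightarrow> l < i \<Longrightarrow> f i $ \<alpha> l = 0"
  shows "\<exists>g. g - v \<in> vec.span (f ` S) \<and> (\<forall>i\<in>S. g $ \<alpha> i = 0)"
  using assms
proof (induction S rule: finite_linorder_max_induct)
  case empty
  show ?case by (rule exI[of _ v]) (simp add: vec.span_zero)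
next
  case (insert b S)
  then obtain g where g: "g - v \<in> vec.span (f ` S)" "\<forall>i\<in>S. g $ \<alpha> i = 0" by auto
  have "(g - v) - g $ \<alpha> b *s f b \<in> vec.span (f ` insert b S)"
    by (rule vec.span_diff[OF span_image_mono[OF g(1)] vec.span_scale[OF vec.span_base]]) auto
  moreover have "\<forall>i\<in>insert b S. (g - g $ \<alpha> b *s f b) $ \<alpha> i = 0"
    using insert.hyps insert.prems g(2) by auto
  ultimately show ?case by (intro exI[of _ "g - g $ \<alpha> b *s f b"]) (simp add: algebra_simps)
qed

text \<open>Gaussian elimination with partial pivoting keeps all entries bounded by 1; this replaces the
  compactness of the Grassmannian.\<close>
lemma ex_partial_pivoting:
  fixes x :: "'a::linorder \<Rightarrow> ('b::real_normed_field, 'n::finite) vec"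
  assumes "finite S"
    and indep: "\<And>j. j \<in> S \<Longrightarrow> x j \<notin> vec.span (x ` {i\<in>S. i < j})"
  shows "\<exists>f \<alpha>. \<forall>j\<in>S. f j $ \<alpha> j = 1 \<and> (\<forall>b. norm (f j $ b) \<le> 1) \<and> (\<forall>i\<in>S. i < j \<longrightarrow> f j $ \<alpha> i = 0)
      \<and> f j \<in> vec.span (x ` {i\<in>S. i \<le> j})"
  using assms
proof (induction S rule: finite_linorder_max_induct)
  case empty
  then show ?case by auto
next
  case (insert b S)
  have S1: "{i\<in>insert b S. i < j} = {i\<in>S. i < j}" "{i\<in>insert b S. i \<le> j} = {i\<in>S. i \<le> j}" if "j \<in> S" for j
    using insert.hyps that by auto
  have S2: "{i\<in>insert b S. i < b} = S" "{i\<in>insert b S. i \<le> b} = insert b S"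
    using insert.hyps by auto
  have "\<And>j. j \<in> S \<Longrightarrow> x j \<notin> vec.span (x ` {i\<in>S. i < j})"
    using insert.prems S1(1) by (metis insertI2)
  then obtain f \<alpha> where f: "\<forall>j\<in>S. f j $ \<alpha> j = 1 \<and> (\<forall>b. norm (f j $ b) \<le> 1) \<and> (\<forall>i\<in>S. i < j \<longrightarrow> f j $ \<alpha> i = 0)
      \<and> f j \<in> vec.span (x ` {i\<in>S. i \<le> j})"
    using insert.IH by blast
  then obtain g where g: "g - x b \<in> vec.span (f ` S)" "\<forall>i\<in>S. g $ \<alpha> i = 0"
    using ex_vanishing_translate[of S f \<alpha> "x b"] insert.hyps by blast
  have fS: "f ` S \<subseteq> vec.span (x ` S)"
    using f by (auto elim!: span_image_mono)
  then have gx: "g - x b \<in> vec.span (x ` S)"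
    using g(1) vec.span_minimal[OF fS vec.subspace_span] by auto
  have "g \<noteq> 0"
  proof
    assume "g = 0"
    then have "x b \<in> vec.span (x ` S)" using gx vec.span_neg by fastforce
    then show False using insert.prems[of b] S2 by simp
  qed
  \<comment> \<open>The next pivot is an entry of largest norm, so that dividing by it leaves all
    norms at most 1. It is nonzero because \<open>x b\<close> is independent of the earlier
    rows.\<close>
  obtain c where c: "\<And>l. norm (g $ l) \<le> norm (g $ c)"
  proof -
    have "Max (range (\<lambda>l. norm (g $ l))) \<in> range (\<lambda>l. norm (g $ l))" by (intro Max_in) auto
    then obtain c where "Max (range (\<lambda>l. norm (g $ l))) = norm (g $ c)" by (rule imageE)
    then have "norm (g $ l) \<le> norm (g $ c)" for l
      using Max_ge[of "range (\<lambda>l. norm (g $ l))" "norm (g $ l)"] by auto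
    then show thesis using that by blast
  qed
  have gc: "g $ c \<noteq> 0"
  proof
    assume "g $ c = 0"
    then have "g = 0" using c by (auto simp: vec_eq_iff)
    then show False using \<open>g \<noteq> 0\<close> by simp
  qed
  define g' where "g' = (1 / g $ c) *s g"
  have "g \<in> vec.span (x ` insert b S)"
  proof -
    have "(g - x b) + x b \<in> vec.span (x ` insert b S)"
      by (rule vec.span_add[OF span_image_mono[OF gx] vec.span_base]) auto
    then show ?thesis by simp
  qed
  then have g'x: "g' \<in> vec.span (x ` insert b S)"
    unfolding g'_def by (rule vec.span_scale)
  have "b \<notin> S" using insert.hyps by auto
  have "\<forall>j\<in>insert b S. (f(b := g')) j $ (\<alpha>(b := c)) j = 1
      \<and> (\<forall>l. norm ((f(b := g')) j $ l) \<le> 1)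
      \<and> (\<forall>i\<in>insert b S. i < j \<longrightarrow> (f(b := g')) j $ (\<alpha>(b := c)) i = 0)
      \<and> (f(b := g')) j \<in> vec.span (x ` {i\<in>insert b S. i \<le> j})"
  proof
    fix j assume "j \<in> insert b S"
    then consider "j = b" | "j \<in> S" "j \<noteq> b" "\<not> b < j" using \<open>b \<notin> S\<close> insert.hyps by auto
    then show "(f(b := g')) j $ (\<alpha>(b := c)) j = 1
      \<and> (\<forall>l. norm ((f(b := g')) j $ l) \<le> 1)
      \<and> (\<forall>i\<in>insert b S. i < j \<longrightarrow> (f(b := g')) j $ (\<alpha>(b := c)) i = 0)
      \<and> (f(b := g')) j \<in> vec.span (x ` {i\<in>insert b S. i \<le> j})"
    proof cases
      case 1
      then show ?thesis
        using g'x S2 gc c g(2) by (auto simp: g'_def norm_divide norm_mult divide_simps)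
    next
      case 2
      then show ?thesis using f S1 by auto
    qed
  qed
  then show ?case by blast
qed

section \<open>Echelon charts of the Grassmannian\<close>

context wronski_form
begin

definition adm :: "('n \<Rightarrow> nat) \<Rightarrow> bool" where
  "adm d \<longleftrightarrow> strict_mono_on R d \<and> (\<forall>i. d i < CARD('n))"

text \<open>\<open>d\<close> limits the degree of each row, while the unit block sits at the columns
  named by \<open>e\<close>. Equality of the two gives the Schubert cell in reduced echelon form;
  with \<open>e\<close> equal to \<open>d\<close> lowered at one pivot, the chart is a neighbourhood
  of the smaller cell in the closure of the larger one. Rows outside \<open>R\<close> are padded by
  0, so that a system of equations can be a self-map of the square matrices.\<close>

definition chart :: "('n \<Rightarrow> nat) \<Rightarrow> ('n \<Rightarrow> nat) \<Rightarrow> 'n cmat \<Rightarrow> bool" where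
  "chart d e x \<longleftrightarrow> le d x \<and> (\<forall>i\<in>R. \<forall>j\<in>R. x $ i $ col (e j) = (if i = j then 1 else 0)) \<and> (\<forall>i. i \<notin> R \<longrightarrow> x $ i = 0)"

abbreviation cell :: "('n \<Rightarrow> nat) \<Rightarrow> 'n cmat \<Rightarrow> bool" where
  "cell d \<equiv> chart d d"

abbreviation row_span :: "'n cmat \<Rightarrow> (complex, 'n) vec set" where
  "row_span x \<equiv> vec.span (($) x ` R)"

lemma adm_inj: "adm d \<Longrightarrow> inj_on d R"
  by (auto simp: adm_def intro: strict_mono_on_imp_inj_on)

lemma adm_less_card: "adm d \<Longrightarrow> d i < CARD('n)"
  by (simp add: adm_def)

lemma adm_less_iff: "adm d \<Longrightarrow> i \<in> R \<Longrightarrow> j \<in> R \<Longrightarrow> d i < d j \<longleftrightarrow> i < j"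
  unfolding adm_def by (metis strict_mono_on_def less_asym linorder_neqE)

lemma adm_lc: "adm d \<Longrightarrow> lc d \<noteq> 0"
  by (intro lc_nonzero adm_inj) (auto simp: adm_def)

lemma adm_col_eq: "adm d \<Longrightarrow> i \<in> R \<Longrightarrow> j \<in> R \<Longrightarrow> col (d i) = (col (d j) :: 'n) \<longleftrightarrow> i = j"
  by (metis adm_inj adm_less_card dg_col inj_onD)

lemma span_coords:
  assumes "\<And>i j. i \<in> R \<Longrightarrow> j \<in> R \<Longrightarrow> x $ i $ c j = (if i = j then 1 else 0)"
    and "v \<in> row_span x"
  shows "v = (\<Sum>j\<in>R. v $ c j *s x $ j)"
proof -
  obtain a where a: "v = (\<Sum>j\<in>R. a j *s x $ j)" using span_imageE[OF _ assms(2)] by auto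
  have "v $ c i = a i" if "i \<in> R" for i
    unfolding a using that assms(1) by (simp add: if_distrib[of "\<lambda>u. a _ * u"] cong: if_cong)
  then show ?thesis using a by simp
qed

lemma row_span_unique:
  assumes "\<And>i j. i \<in> R \<Longrightarrow> j \<in> R \<Longrightarrow> x $ i $ c j = (if i = j then 1 else 0)"
    and "\<And>i j. i \<in> R \<Longrightarrow> j \<in> R \<Longrightarrow> y $ i $ c j = (if i = j then 1 else 0)"
    and "\<And>i. i \<notin> R \<Longrightarrow> x $ i = y $ i"
    and "\<And>i. i \<in> R \<Longrightarrow> x $ i \<in> row_span y"
  shows "x = y"
proof -
  have "x $ i = y $ i" for i
  proof (cases "i \<in> R")
    case True
    have "x $ i = (\<Sum>j\<in>R. x $ i $ c j *s y $ j)"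
      by (rule span_coords[OF assms(2) assms(4)[OF True]])
    also have "\<dots> = (\<Sum>j\<in>R. (if i = j then y $ j else 0))"
      using assms(1) True by (intro sum.cong) auto
    finally show ?thesis using True by simp
  qed (use assms in auto)
  then show ?thesis by (simp add: vec_eq_iff)
qed

lemma chart_row_span_inj:
  assumes "chart d e x" "chart d e y" "row_span x = row_span y"
  shows "x = y"
proof (rule row_span_unique[of x "\<lambda>j. col (e j)"])
  show "x $ i \<in> row_span y" if "i \<in> R" for i
    using that assms(3) vec.span_base[of "x $ i" "($) x ` R"] by auto
qed (use assms in \<open>auto simp: chart_def\<close>)

lemma coeff_P_cell:
  assumes "adm d" "cell d x"
  shows "coeff (P x) (sum d R) = of_real (lc d)"
  using coeff_P_top[of d x] assms by (simp add: adm_def chart_def)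

lemma P_cell_nonzero: "adm d \<Longrightarrow> cell d x \<Longrightarrow> P x \<noteq> 0"
  using coeff_P_cell[of d x] adm_lc[of d] by auto

text \<open>Reduced echelon form read off from the subspace: the pivots are the leading degrees
  occurring in \<open>K\<close>, and a vector with leading degree \<open>e\<close> is cleared at the
  smaller pivots by induction on \<open>e\<close>.\<close>

lemma ex_cell_row_span:
  assumes K: "vec.subspace K" "vec.dim K = k"
  obtains d x where "adm d" "cell d x" "row_span x = K"
proof -
  define top where "top e f \<longleftrightarrow> f \<in> K \<and> f $ col e = 1 \<and> (\<forall>b. e < dg b \<longrightarrow> f $ b = 0)"
    for e and f :: "(complex, 'n) vec"
  define E where "E = {e. e < CARD('n) \<and> (\<exists>f. top e f)}"
  have finE: "finite E" by (auto simp: E_def)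
  have Ecard: "e < CARD('n)" if "e \<in> E" for e using that by (simp add: E_def)
  have ex: "e \<in> E \<longrightarrow> (\<exists>h. top e h \<and> (\<forall>e'\<in>E - {e}. h $ col e' = 0))" for e
  proof (induction e rule: less_induct)
    case (less e)
    show ?case
    proof
      assume e: "e \<in> E"
      then obtain f where f: "top e f" by (auto simp: E_def)
      obtain h where h: "top e' (h e') \<and> (\<forall>l\<in>E - {e'}. h e' $ col l = 0)" if "e' < e" "e' \<in> E" for e'
        using less.IH by metis
      \<comment> \<open>Only pivots below \<open>e\<close> are cleared: \<open>f\<close> already
        vanishes in all columns of degree above \<open>e\<close>.\<close>
      let ?g = "f - (\<Sum>l\<in>{l\<in>E. l < e}. f $ col l *s h l)"
      have gK: "?g \<in> K" using f h by (intro vec.subspace_diff vec.subspace_sum vec.subspace_scale K) (auto simp: top_def)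
      have g1: "?g $ b = f $ b" if "e \<le> dg b" for b
      proof -
        have "h l $ b = 0" if "l \<in> E" "l < e" for l
          using h[OF that(2,1)] \<open>e \<le> dg b\<close> that by (auto simp: top_def)
        then show ?thesis by simp
      qed
      have "?g $ col l = 0" if l: "l \<in> E - {e}" for l
      proof (cases "l < e")
        case True
        have "(\<Sum>m\<in>{m\<in>E. m < e}. f $ col m * h m $ col l) = (\<Sum>m\<in>{m\<in>E. m < e}. if m = l then f $ col m else 0)"
        proof (intro sum.cong refl)
          fix m assume m: "m \<in> {m\<in>E. m < e}"
          then show "f $ col m * h m $ col l = (if m = l then f $ col m else 0)"
            using h[of m] l by (auto simp: top_def)
        qed
        then show ?thesis using True l finE by simp
      next
        case False
        then have "e < dg (col l :: 'n)" using l Ecard by auto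
        then show ?thesis using g1[of "col l"] f by (simp add: top_def)
      qed
      moreover have "top e ?g"
        unfolding top_def using gK g1[of "col e"] g1 f Ecard[OF e] by (auto simp: top_def)
      ultimately show "\<exists>h. top e h \<and> (\<forall>e'\<in>E - {e}. h $ col e' = 0)" by blast
    qed
  qed
  then obtain h where h: "\<And>e. e \<in> E \<Longrightarrow> top e (h e)"
    and h0: "\<And>e e'. e \<in> E \<Longrightarrow> e' \<in> E \<Longrightarrow> e' \<noteq> e \<Longrightarrow> h e $ col e' = 0"
    by (metis Diff_iff singletonD)
  have h\<delta>: "h e $ col e' = (if e = e' then 1 else 0)" if "e \<in> E" "e' \<in> E" for e e'
    using h[OF that(1)] h0[OF that(1,2)] by (auto simp: top_def)
  \<comment> \<open>If it were nonzero, its own leading degree would belong to \<open>E\<close>,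
    where it has been assumed to vanish.\<close>
  have zero: "v = 0" if v: "v \<in> K" "\<And>e. e \<in> E \<Longrightarrow> v $ col e = 0" for v
  proof (rule ccontr)
    assume "v \<noteq> 0"
    then obtain b0 where b0: "v $ b0 \<noteq> 0" by (auto simp: vec_eq_iff)
    let ?D = "dg ` {b. v $ b \<noteq> 0}"
    have M: "Max ?D \<in> ?D" using b0 by (intro Max_in) auto
    then obtain b where b: "v $ b \<noteq> 0" "Max ?D = dg b" by auto
    have above: "v $ l = 0" if "dg b < dg l" for l
    proof (rule ccontr)
      assume "v $ l \<noteq> 0"
      then have "dg l \<le> Max ?D" by (intro Max_ge) auto
      then show False using b that by simp
    qed
    have "top (dg b) ((1 / v $ b) *s v)"
      using v(1) b above K by (auto simp: top_def intro: vec.subspace_scale)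
    then have "dg b \<in> E" by (auto simp: E_def dg_less_card)
    from v(2)[OF this] b show False by simp
  qed
  have expand: "v = (\<Sum>e\<in>E. v $ col e *s h e)" if v: "v \<in> K" for v
  proof -
    have "v - (\<Sum>e\<in>E. v $ col e *s h e) = 0"
    proof (rule zero)
      show "v - (\<Sum>e\<in>E. v $ col e *s h e) \<in> K"
        using h v by (intro vec.subspace_diff vec.subspace_sum vec.subspace_scale K) (auto simp: top_def)
      fix e assume e: "e \<in> E"
      have "(\<Sum>l\<in>E. v $ col l * h l $ col e) = (\<Sum>l\<in>E. if l = e then v $ col l else 0)"
        using h\<delta> e by (intro sum.cong) auto
      then show "(v - (\<Sum>e\<in>E. v $ col e *s h e)) $ col e = 0" using e finE by simp
    qed
    then show ?thesis by simp
  qed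
  have injh: "inj_on h E" by (metis h\<delta> inj_onI zero_neq_one)
  have spanh: "vec.span (h ` E) = K"
  proof
    show "vec.span (h ` E) \<subseteq> K" using h by (intro vec.span_minimal K) (auto simp: top_def)
    show "K \<subseteq> vec.span (h ` E)"
    proof
      fix v assume "v \<in> K"
      from expand[OF this] show "v \<in> vec.span (h ` E)"
        by (metis (no_types, lifting) vec.span_sum vec.span_scale vec.span_base imageI)
    qed
  qed
  have indep: "vec.independent (h ` E)"
  proof (rule vec.independent_if_scalars_zero)
    show "finite (h ` E)" using finE by simp
    fix g v assume s: "(\<Sum>w\<in>h ` E. g w *s w) = 0" and v: "v \<in> h ` E"
    then obtain e where e: "e \<in> E" "v = h e" by auto
    have "0 = (\<Sum>l\<in>E. g (h l) *s h l) $ col e" using s by (simp add: sum.reindex[OF injh])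
    also have "\<dots> = (\<Sum>l\<in>E. if l = e then g (h l) else 0)"
      unfolding sum_component using h\<delta> e by (intro sum.cong) auto
    finally show "g v = 0" using e finE by simp
  qed
  have "card E = k"
    using vec.dim_eq_card_independent[OF indep] K(2) spanh by (metis card_image injh vec.dim_span)
  then obtain g where g: "bij_betw g {..<k} E" "strict_mono_on {..<k} g"
    using ex_bij_betw_strict_mono_card[OF finE] by blast
  \<comment> \<open>The pivots are listed increasingly along \<open>R\<close>; the value 0 elsewhere
    is a filler below the dimension.\<close>
  define d where "d i = (if i \<in> R then g (pos i) else 0)" for i :: 'n
  have posR: "pos i \<in> {..<k}" if "i \<in> R" for i using that by (simp add: R_def)
  have dE: "bij_betw d R E"
    using bij_betw_trans[OF bij_pos_R g(1)] by (rule bij_betw_cong[THEN iffD1, rotated]) (simp add: d_def)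
  then have dE': "d i \<in> E" if "i \<in> R" for i using that by (auto simp: bij_betw_def)
  have "d i < CARD('n)" for i using dE' Ecard by (cases "i \<in> R") (auto simp: d_def)
  moreover have "strict_mono_on R d"
    using g(2) posR by (auto simp: strict_mono_on_def d_def pos_strict_mono)
  ultimately have adm: "adm d" by (simp add: adm_def)
  define x where "x = (\<chi> i. if i \<in> R then h (d i) else 0)"
  have "cell d x"
    unfolding chart_def le_def
  proof (intro conjI ballI allI impI)
    show "x $ i $ b = 0" if "i \<in> R" "d i < dg b" for i b
      using h[OF dE'[OF that(1)]] that by (simp add: x_def top_def)
    show "x $ i $ col (d j) = (if i = j then 1 else 0)" if "i \<in> R" "j \<in> R" for i j
      using h\<delta>[OF dE' dE', OF that] that adm_inj[OF adm] by (auto simp: x_def inj_on_def)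
    show "x $ i = 0" if "i \<notin> R" for i using that by (simp add: x_def)
  qed
  moreover have "($) x ` R = h ` E"
    using dE by (auto simp: x_def bij_betw_def image_iff)
  ultimately show thesis using that adm spanh by metis
qed

lemma dim_row_span:
  assumes ind: "\<And>a i. (\<Sum>j\<in>R. a j *s x $ j) = 0 \<Longrightarrow> i \<in> R \<Longrightarrow> a i = 0"
  shows "vec.dim (row_span x) = k"
proof -
  have inj: "inj_on (($) x) R"
  proof (rule inj_onI, rule ccontr)
    fix i j assume ij: "i \<in> R" "j \<in> R" "x $ i = x $ j" "i \<noteq> j"
    have "(\<Sum>l\<in>R. (if l = i then 1 else if l = j then -1 else 0) *s x $ l)
        = (\<Sum>l\<in>R. (if l = i then x $ i else 0) - (if l = j then x $ i else 0))"
      using ij by (intro sum.cong) auto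
    also have "\<dots> = 0" using ij by (simp add: sum_subtractf)
    finally show False using ind[of "\<lambda>l. if l = i then 1 else if l = j then -1 else 0" i] ij by simp
  qed
  have "vec.independent (($) x ` R)"
  proof (rule vec.independent_if_scalars_zero)
    fix g v assume s: "(\<Sum>w\<in>($) x ` R. g w *s w) = 0" and v: "v \<in> ($) x ` R"
    then show "g v = 0" using ind[of "\<lambda>j. g (x $ j)"] by (auto simp: sum.reindex[OF inj])
  qed simp
  then show ?thesis
    by (simp add: vec.dim_eq_card_independent card_image[OF inj] card_R)
qed

text \<open>\<open>P x\<close> divides the Wronskian of the echelon basis of the same span, whose
  leading coefficient is nonzero.\<close>

lemma P_nonzero_of_independent:
  assumes ind: "\<And>a i. (\<Sum>j\<in>R. a j *s x $ j) = 0 \<Longrightarrow> i \<in> R \<Longrightarrow> a i = 0"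
  shows "P x \<noteq> 0"
proof -
  have "vec.dim (row_span x) = k" by (rule dim_row_span) (rule ind)
  then obtain d y where y: "adm d" "cell d y" "row_span y = row_span x"
    using ex_cell_row_span[OF vec.subspace_span] by metis
  have "P x dvd P y"
    by (rule P_span_dvd) (metis y(3) vec.span_base imageI)
  then show ?thesis using P_cell_nonzero[OF y(1,2)] by auto
qed

text \<open>The bases that partial pivoting produces under the bound \<open>d\<close>. The pivot
  columns \<alpha> may change from basis to basis, but there are finitely many choices. For each of
  them the conditions are closed and bounded, and the unit triangular pattern survives limits, so a
  limit basis is still independent.\<close>

definition pivoted :: "('n \<Rightarrow> nat) \<Rightarrow> ('n \<Rightarrow> 'n) \<Rightarrow> 'n cmat set" where
  "pivoted d \<alpha> = {f. le d f \<and> (\<forall>j\<in>R. f $ j $ \<alpha> j = 1 \<and> (\<forall>b. norm (f $ j $ b) \<le> 1)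
     \<and> (\<forall>i\<in>R. i < j \<longrightarrow> f $ j $ \<alpha> i = 0)) \<and> (\<forall>i. i \<notin> R \<longrightarrow> f $ i = 0)}"

text \<open>Each new row combines only rows of \<open>x\<close> up to its own index, so the
  increasing degree bounds are respected.\<close>

lemma ex_pivoted:
  assumes "adm d" "cell d x"
  obtains f \<alpha> where "f \<in> pivoted d \<alpha>" "\<And>j. j \<in> R \<Longrightarrow> f $ j \<in> vec.span (($) x ` {i\<in>R. i \<le> j})"
proof -
  have le: "v $ b = 0" if v: "v \<in> vec.span (($) x ` {i\<in>R. d i < dg b})" for v b
  proof -
    obtain a where "v = (\<Sum>j\<in>{i\<in>R. d i < dg b}. a j *s x $ j)" using span_imageE[OF _ v] by auto
    then show ?thesis using assms(2) by (simp add: chart_def le_def)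
  qed
  have "x $ j \<notin> vec.span (($) x ` {i\<in>R. i < j})" if j: "j \<in> R" for j
  proof
    assume "x $ j \<in> vec.span (($) x ` {i\<in>R. i < j})"
    then have "x $ j $ col (d j) = 0"
      using assms(1) j by (intro le) (auto elim!: span_image_mono simp: adm_less_card adm_less_iff)
    then show False using assms(2) j by (simp add: chart_def)
  qed
  then obtain f \<alpha> where f: "\<forall>j\<in>R. f j $ \<alpha> j = 1 \<and> (\<forall>b. norm (f j $ b) \<le> 1) \<and> (\<forall>i\<in>R. i < j \<longrightarrow> f j $ \<alpha> i = 0)
      \<and> f j \<in> vec.span (($) x ` {i\<in>R. i \<le> j})"
    using ex_partial_pivoting[of R "($) x"] by auto
  have "f j $ b = 0" if "j \<in> R" "d j < dg b" for j b
  proof (rule le)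
    have sub: "{i\<in>R. i \<le> j} \<subseteq> {i\<in>R. d i < dg b}"
    proof
      fix i assume i: "i \<in> {i\<in>R. i \<le> j}"
      then have "d i \<le> d j" using adm_less_iff[OF assms(1), of i j] that by (cases "i = j") auto
      then show "i \<in> {i\<in>R. d i < dg b}" using that i by auto
    qed
    then show "f j \<in> vec.span (($) x ` {i\<in>R. d i < dg b})"
      using f that span_image_mono[OF _ sub] by blast
  qed
  then have "(\<chi> i. if i \<in> R then f i else 0) \<in> pivoted d \<alpha>"
    using f by (simp add: pivoted_def le_def)
  then show thesis
    by (rule that) (use f in simp)
qed

lemma P_pivoted_nonzero:
  assumes f: "f \<in> pivoted d \<alpha>"
  shows "P f \<noteq> 0"
proof (rule P_nonzero_of_independent)
  fix a i assume s: "(\<Sum>j\<in>R. a j *s f $ j) = 0" and "i \<in> R"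
  from this(2) show "a i = 0"
  proof (induction i rule: less_induct)
    case (less i)
    have "0 = (\<Sum>j\<in>R. a j * f $ j $ \<alpha> i)" using arg_cong[OF s, of "\<lambda>v. v $ \<alpha> i"] by simp
    also have "\<dots> = (\<Sum>j\<in>R. if j = i then a i else 0)"
    proof (intro sum.cong refl)
      fix j assume j: "j \<in> R"
      consider "j < i" | "j = i" | "i < j" by (rule linorder_cases)
      then show "a j * f $ j $ \<alpha> i = (if j = i then a i else 0)"
        using j less f by cases (auto simp: pivoted_def)
    qed
    finally show ?case using less.prems by simp
  qed
qed

lemma compact_pivoted: "compact (pivoted d \<alpha>)"
  unfolding compact_eq_bounded_closed
proof
  have "norm f \<le> real CARD('n) * real CARD('n)" if f: "f \<in> pivoted d \<alpha>" for f
  proof -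
    have e: "norm (f $ i $ b) \<le> 1" for i b
      using f by (cases "i \<in> R") (auto simp: pivoted_def)
    have "norm (f $ i) \<le> real CARD('n)" for i
    proof -
      have "norm (f $ i) \<le> (\<Sum>b\<in>UNIV. norm (f $ i $ b))" by (simp add: norm_vec_def L2_set_le_sum)
      also have "\<dots> \<le> (\<Sum>b\<in>(UNIV :: 'n set). 1)" by (intro sum_mono e)
      finally show ?thesis by simp
    qed
    note r = this
    have "norm f \<le> (\<Sum>i\<in>UNIV. norm (f $ i))" by (simp add: norm_vec_def L2_set_le_sum)
    also have "\<dots> \<le> (\<Sum>i\<in>(UNIV :: 'n set). real CARD('n))" by (intro sum_mono r)
    finally show ?thesis by simp
  qed
  then show "bounded (pivoted d \<alpha>)" unfolding bounded_iff by blast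
  show "closed (pivoted d \<alpha>)"
    unfolding closed_sequential_limits
  proof (intro allI impI, elim conjE)
    fix s l assume s: "\<forall>n. s n \<in> pivoted d \<alpha>" and l: "s \<longlonglongrightarrow> l"
    have t: "(\<lambda>n. s n $ i $ b) \<longlonglongrightarrow> l $ i $ b" for i b
      by (intro tendsto_vec_nth l)
    have const: "l $ i $ b = c" if "\<And>n. s n $ i $ b = c" for i b c
      using t[of i b] that by (simp add: LIMSEQ_const_iff)
    have nrm: "norm (l $ i $ b) \<le> 1" if "\<And>n. norm (s n $ i $ b) \<le> 1" for i b
      using that by (intro LIMSEQ_le_const2[OF tendsto_norm[OF t]]) auto
    show "l \<in> pivoted d \<alpha>"
      unfolding pivoted_def le_def mem_Collect_eq
    proof (intro conjI ballI allI impI)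
      show "l $ i $ b = 0" if "i \<in> R" "d i < dg b" for i b
        using s that by (intro const) (auto simp: pivoted_def le_def)
      show "l $ j $ \<alpha> j = 1" if "j \<in> R" for j
        using s that by (intro const) (auto simp: pivoted_def)
      show "norm (l $ j $ b) \<le> 1" if "j \<in> R" for j b
        using s that by (intro nrm) (auto simp: pivoted_def)
      show "l $ j $ \<alpha> i = 0" if "j \<in> R" "i \<in> R" "i < j" for i j
        using s that by (intro const) (auto simp: pivoted_def)
      show "l $ i = 0" if "i \<notin> R" for i
        unfolding vec_eq_iff using s that by (intro allI, simp, intro const) (auto simp: pivoted_def)
    qed
  qed
qed

text \<open>Forward substitution: \<open>f\<close> is obtained from \<open>y\<close> by a triangular
  matrix with convergent entries \<open>f n $ j $ c i\<close> whose diagonal has nonzero limits, so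
  the rows of \<open>y\<close> converge one after another.\<close>

lemma normalised_convergent:
  fixes f y :: "nat \<Rightarrow> 'n cmat"
  assumes f: "f \<longlonglongrightarrow> F" and Fc: "\<And>j. j \<in> R \<Longrightarrow> F $ j $ c j \<noteq> 0"
    and coords: "\<And>n j. j \<in> R \<Longrightarrow> f n $ j = (\<Sum>i\<in>R. f n $ j $ c i *s y n $ i)"
    and tri: "\<And>n i j. i \<in> R \<Longrightarrow> j \<in> R \<Longrightarrow> j < i \<Longrightarrow> f n $ j $ c i = 0"
    and off: "\<And>n i. i \<notin> R \<Longrightarrow> y n $ i = 0"
  shows "convergent y"
proof -
  have ft: "(\<lambda>n. f n $ j $ b) \<longlonglongrightarrow> F $ j $ b" for j b
    by (intro tendsto_vec_nth f)
  have "j \<in> R \<longrightarrow> (\<forall>b. convergent (\<lambda>n. y n $ j $ b))" for j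
  proof (induction j rule: less_induct)
    case (less j)
    show ?case
    proof (intro impI allI)
      fix b assume j: "j \<in> R"
      let ?g = "\<lambda>n. (f n $ j $ b - (\<Sum>i\<in>{i\<in>R. i < j}. f n $ j $ c i * y n $ i $ b)) / f n $ j $ c j"
      have "convergent (\<lambda>n. f n $ j $ c i * y n $ i $ b)" if "i \<in> {i\<in>R. i < j}" for i
        using less that by (intro convergent_mult) (auto intro!: convergentI[OF ft])
      then have "convergent (\<lambda>n. \<Sum>i\<in>{i\<in>R. i < j}. f n $ j $ c i * y n $ i $ b)"
        by (intro convergent_sum)
      then obtain L where L: "(\<lambda>n. \<Sum>i\<in>{i\<in>R. i < j}. f n $ j $ c i * y n $ i $ b) \<longlonglongrightarrow> L"
        by (auto simp: convergent_def)
      have gl: "?g \<longlonglongrightarrow> (F $ j $ b - L) / F $ j $ c j"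
        by (intro tendsto_intros ft L Fc j)
      have "eventually (\<lambda>n. f n $ j $ c j \<noteq> 0) sequentially"
        by (rule tendsto_imp_eventually_ne[OF ft Fc[OF j]])
      then have "eventually (\<lambda>n. ?g n = y n $ j $ b) sequentially"
      proof eventually_elim
        case (elim n)
        have "f n $ j $ b = (\<Sum>i\<in>R. f n $ j $ c i * y n $ i $ b)"
          using arg_cong[OF coords[OF j, of n], of "\<lambda>v. v $ b"] by simp
        also have "\<dots> = (\<Sum>i\<in>insert j {i\<in>R. i < j}. f n $ j $ c i * y n $ i $ b)"
          using tri j by (intro sum.mono_neutral_right) (auto, metis linorder_neqE)
        finally show ?case using elim by (simp add: field_simps)
      qed
      from tendsto_cong[OF this] gl show "convergent (\<lambda>n. y n $ j $ b)"
        by (auto simp: convergent_def)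
    qed
  qed
  moreover have "convergent (\<lambda>n. y n $ j $ b)" if "j \<notin> R" for j b
    using off[OF that] by (simp add: convergent_const)
  ultimately have "\<exists>L. (\<lambda>n. y n $ j $ b) \<longlonglongrightarrow> L" for j b
    unfolding convergent_def by blast
  then obtain L where L: "\<And>j b. (\<lambda>n. y n $ j $ b) \<longlonglongrightarrow> L j b" by metis
  have "y \<longlonglongrightarrow> (\<chi> j b. L j b)"
    by (intro vec_tendstoI) (simp add: L)
  then show ?thesis by (auto simp: convergent_def)
qed

end

section \<open>Continuously differentiable systems\<close>

text \<open>The derivative takes values in bounded linear maps, so that its continuity is in
  operator norm, as the inverse function theorem asks.\<close>

definition C1 :: "('a::real_normed_vector \<Rightarrow> 'b::real_normed_vector) \<Rightarrow> bool" where
  "C1 f \<longleftrightarrow> (\<exists>f'. (\<forall>x. (f has_derivative blinfun_apply (f' x)) (at x)) \<and> continuous_on UNIV f')"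

lemma C1I:
  "(\<And>x. (f has_derivative blinfun_apply (f' x)) (at x)) \<Longrightarrow> continuous_on UNIV f' \<Longrightarrow> C1 f"
  by (auto simp: C1_def)

lemma C1_continuous: "C1 f \<Longrightarrow> continuous_on UNIV f"
  unfolding C1_def by (metis continuous_at_imp_continuous_on has_derivative_continuous)

lemma C1_const: "C1 (\<lambda>x. c)"
  by (rule C1I[where f' = "\<lambda>_. 0"]) (simp_all add: zero_blinfun.rep_eq)

lemma C1_bounded_linear:
  assumes "bounded_linear f"
  shows "C1 f"
  unfolding C1_def
  by (intro exI[of _ "\<lambda>_. Blinfun f"])
    (auto simp: bounded_linear_Blinfun_apply[OF assms] bounded_linear_imp_has_derivative[OF assms])

lemma C1_compose_linear:
  assumes L: "bounded_linear L" and f: "C1 f"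
  shows "C1 (\<lambda>x. L (f x))"
proof -
  obtain f' where f': "\<And>x. (f has_derivative blinfun_apply (f' x)) (at x)" "continuous_on UNIV f'"
    using f by (auto simp: C1_def)
  have "((\<lambda>x. L (f x)) has_derivative blinfun_apply (Blinfun L o\<^sub>L f' x)) (at x)" for x
    using bounded_linear.has_derivative[OF L f'(1), of x]
    by (rule has_derivative_eq_rhs) (auto simp: bounded_linear_Blinfun_apply[OF L])
  moreover have "continuous_on UNIV (\<lambda>x. Blinfun L o\<^sub>L f' x)"
    by (intro continuous_intros f')
  ultimately show ?thesis by (rule C1I)
qed

lemma C1_add:
  assumes f: "C1 f" and g: "C1 g"
  shows "C1 (\<lambda>x. f x + g x)"
proof -
  obtain f' where f': "\<And>x. (f has_derivative blinfun_apply (f' x)) (at x)" "continuous_on UNIV f'"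
    using f by (auto simp: C1_def)
  obtain g' where g': "\<And>x. (g has_derivative blinfun_apply (g' x)) (at x)" "continuous_on UNIV g'"
    using g by (auto simp: C1_def)
  have "((\<lambda>x. f x + g x) has_derivative blinfun_apply (f' x + g' x)) (at x)" for x
    using has_derivative_add[OF f'(1) g'(1), of x] by (rule has_derivative_eq_rhs) (auto simp: blinfun.add_left)
  moreover have "continuous_on UNIV (\<lambda>x. f' x + g' x)"
    by (intro continuous_intros f' g')
  ultimately show ?thesis by (rule C1I)
qed

lemma C1_sum: "(\<And>i. i \<in> A \<Longrightarrow> C1 (f i)) \<Longrightarrow> C1 (\<lambda>x. \<Sum>i\<in>A. f i x)"
  by (induction A rule: infinite_finite_induct) (auto intro: C1_const C1_add)

lemma C1_mult:
  fixes f g :: "'a::real_normed_vector \<Rightarrow> 'b::real_normed_algebra"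
  assumes f: "C1 f" and g: "C1 g"
  shows "C1 (\<lambda>x. f x * g x)"
proof -
  obtain f' where f': "\<And>x. (f has_derivative blinfun_apply (f' x)) (at x)" "continuous_on UNIV f'"
    using f by (auto simp: C1_def)
  obtain g' where g': "\<And>x. (g has_derivative blinfun_apply (g' x)) (at x)" "continuous_on UNIV g'"
    using g by (auto simp: C1_def)
  have "((\<lambda>x. f x * g x) has_derivative
      blinfun_apply ((blinfun_mult_right (f x) o\<^sub>L g' x) + (blinfun_mult_left (g x) o\<^sub>L f' x))) (at x)" for x
    using has_derivative_mult[OF f'(1) g'(1), of x] by (rule has_derivative_eq_rhs) (auto simp: blinfun.add_left)
  moreover have "continuous_on UNIV (\<lambda>x. (blinfun_mult_right (f x) o\<^sub>L g' x) + (blinfun_mult_left (g x) o\<^sub>L f' x))"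
    by (intro continuous_intros f' g'
        bounded_linear.continuous_on[OF bounded_linear_blinfun_mult_right]
        bounded_linear.continuous_on[OF bounded_linear_blinfun_mult_left] C1_continuous f g)
  ultimately show ?thesis by (rule C1I)
qed

lemma C1_prod:
  fixes f :: "'i \<Rightarrow> 'a::real_normed_vector \<Rightarrow> 'b::{real_normed_algebra,comm_ring_1}"
  shows "(\<And>i. i \<in> A \<Longrightarrow> C1 (f i)) \<Longrightarrow> C1 (\<lambda>x. \<Prod>i\<in>A. f i x)"
  by (induction A rule: infinite_finite_induct) (auto intro: C1_const C1_mult)

lemma C1_power:
  fixes f :: "'a::real_normed_vector \<Rightarrow> 'b::{real_normed_algebra,comm_ring_1}"
  shows "C1 f \<Longrightarrow> C1 (\<lambda>x. f x ^ n)"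
  by (induction n) (auto intro: C1_const C1_mult)

lemma bounded_linear_axis: "bounded_linear (axis i :: 'a::euclidean_space \<Rightarrow> 'a ^ 'n::finite)"
  unfolding linear_conv_bounded_linear[symmetric]
  by (rule linearI) (auto simp: vec_eq_iff axis_def)

lemma C1_vec:
  fixes f :: "'a::real_normed_vector \<Rightarrow> 'n::finite \<Rightarrow> 'b::euclidean_space"
  assumes "\<And>i. C1 (\<lambda>x. f x i)"
  shows "C1 (\<lambda>x. \<chi> i. f x i)"
proof -
  have "(\<chi> i. f x i) = (\<Sum>i\<in>UNIV. axis i (f x i))" for x
    by (simp add: vec_eq_iff axis_def if_distrib cong: if_cong)
  then show ?thesis
    by (simp only:) (intro C1_sum C1_compose_linear[OF bounded_linear_axis] assms)
qed

lemma C1_Pair: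
  assumes "C1 f" "C1 g"
  shows "C1 (\<lambda>x. (f x, g x))"
proof -
  have "C1 (\<lambda>x. (f x, 0) + (0, g x))"
    by (intro C1_add C1_compose_linear[of "\<lambda>a. (a, 0)"] C1_compose_linear[of "\<lambda>a. (0, a)"] assms
        bounded_linear_Pair bounded_linear_ident bounded_linear_zero)
  then show ?thesis by simp
qed

text \<open>An injective linear self-map in finite dimension is invertible. The last property,
  injectivity of the derivative on all of \<open>U\<close>, is what makes new solutions
  nondegenerate.\<close>

lemma C1_local_inverse:
  fixes f :: "'a::euclidean_space \<Rightarrow> 'a"
  assumes f: "C1 f" and D: "(f has_derivative D) (at x0)" and inj: "\<And>h. D h = 0 \<Longrightarrow> h = 0"
  obtains U V g where "open U" "x0 \<in> U" "open V" "f x0 \<in> V" "homeomorphism U V f g"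
    "\<And>p D h. p \<in> U \<Longrightarrow> (f has_derivative D) (at p) \<Longrightarrow> D h = 0 \<Longrightarrow> h = 0"
proof -
  obtain f' where f': "\<And>x. (f has_derivative blinfun_apply (f' x)) (at x)" "continuous_on UNIV f'"
    using f by (auto simp: C1_def)
  have D': "D = blinfun_apply (f' x0)" by (rule has_derivative_unique[OF D f'(1)])
  have lin: "linear D" using D has_derivative_linear by blast
  have "inj D" using inj linear_injective_0[OF lin] by auto
  then obtain i where i: "linear i" "i \<circ> D = id" using linear_injective_left_inverse[OF lin] by auto
  have "Blinfun i o\<^sub>L f' x0 = id_blinfun"
    using i(2) i(1)[unfolded linear_conv_bounded_linear]
    by (intro blinfun_eqI) (simp add: bounded_linear_Blinfun_apply D' fun_eq_iff)
  from inverse_function_theorem[OF open_UNIV f'(1) f'(2) UNIV_I this]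
  obtain U V g g' where U: "open U" "x0 \<in> U" "open V" "f x0 \<in> V" "homeomorphism U V f g"
    and bij: "\<And>y. y \<in> V \<Longrightarrow> bij (blinfun_apply (f' (g y)))"
    by metis
  have "h = 0" if "p \<in> U" "(f has_derivative E) (at p)" "E h = 0" for p E h
  proof -
    have "g (f p) = p" "f p \<in> V" using U(5) that(1) by (auto simp: homeomorphism_def)
    then have "inj (blinfun_apply (f' p))" using bij[of "f p"] by (simp add: bij_def)
    moreover have "E = blinfun_apply (f' p)" by (rule has_derivative_unique[OF that(2) f'(1)])
    ultimately show ?thesis using that(3) by (metis blinfun.zero_right injD)
  qed
  then show thesis using that U by blast
qed

lemma has_vector_derivative_line:
  assumes "(f has_derivative D) (at p)"
  shows "((\<lambda>z::real. f (p + z *\<^sub>R h)) has_vector_derivative D h) (at 0)"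
proof -
  interpret bounded_linear D using assms by (rule has_derivative_bounded_linear)
  have "((\<lambda>z::real. p + z *\<^sub>R h) has_derivative (\<lambda>z. z *\<^sub>R h)) (at 0)"
    by (auto intro!: derivative_eq_intros)
  then have "((\<lambda>z::real. f (p + z *\<^sub>R h)) has_derivative (\<lambda>z. D (z *\<^sub>R h))) (at 0)"
    using has_derivative_compose[of "\<lambda>z::real. p + z *\<^sub>R h" _ 0 UNIV f D] assms by simp
  then show ?thesis by (simp add: has_vector_derivative_def scaleR)
qed

lemma poly_eq_sum_le:
  fixes p :: "'a::comm_ring_1 poly"
  assumes "degree p \<le> n"
  shows "poly p x = (\<Sum>e\<le>n. coeff p e * x ^ e)"
proof -
  have "poly p x = poly (\<Sum>e\<le>n. monom (coeff p e) e) x" by (simp add: poly_as_sum_of_monoms'[OF assms])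
  then show ?thesis by (simp add: poly_sum poly_monom)
qed

lemma sum_powers_eq_poly_inverse:
  fixes p :: "complex poly"
  assumes deg: "degree p \<le> n" and \<tau>: "\<tau> \<noteq> (0::real)"
  shows "(\<Sum>e\<le>n. coeff p e * of_real \<tau> ^ (n - e)) = of_real \<tau> ^ n * poly p (of_real (1 / \<tau>))"
proof -
  have *: "coeff p e * of_real \<tau> ^ (n - e) = of_real \<tau> ^ n * (coeff p e * of_real (1 / \<tau>) ^ e)" if "e \<le> n" for e
    using that \<tau> by (simp add: power_diff divide_inverse power_inverse)
  show ?thesis
    unfolding poly_eq_sum_le[OF deg] sum_distrib_left by (intro sum.cong refl *) simp
qed

section \<open>Transversality and the root at infinity\<close>

context wronski_form
begin

definition tangent :: "('n \<Rightarrow> nat) \<Rightarrow> ('n \<Rightarrow> nat) \<Rightarrow> 'n cmat \<Rightarrow> bool" where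
  "tangent d e v \<longleftrightarrow> le d v \<and> (\<forall>i\<in>R. \<forall>j\<in>R. v $ i $ col (e j) = 0) \<and> (\<forall>i. i \<notin> R \<longrightarrow> v $ i = 0)"

definition vanishes :: "real set \<Rightarrow> 'n cmat \<Rightarrow> bool" where
  "vanishes T x \<longleftrightarrow> (\<forall>t\<in>T. poly (P x) (complex_of_real t) = 0)"

definition critical :: "real set \<Rightarrow> 'n cmat \<Rightarrow> 'n cmat \<Rightarrow> bool" where
  "critical T x v \<longleftrightarrow>
     (\<forall>t\<in>T. ((\<lambda>z::real. poly (P (x + z *\<^sub>R v)) (complex_of_real t)) has_vector_derivative 0) (at 0))"

text \<open>Transversality: the Jacobian of the equations is injective on the tangent space of the
  chart. Real parameters in \<open>critical\<close> suffice, as the directions \<open>v\<close> are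
  themselves complex.\<close>

definition nondegenerate :: "('n \<Rightarrow> nat) \<Rightarrow> ('n \<Rightarrow> nat) \<Rightarrow> real set \<Rightarrow> 'n cmat \<Rightarrow> bool" where
  "nondegenerate d e T x \<longleftrightarrow> (\<forall>v. tangent d e v \<longrightarrow> critical T x v \<longrightarrow> v = 0)"

definition cnj_mat :: "'n cmat \<Rightarrow> 'n cmat" where
  "cnj_mat x = (\<chi> i b. cnj (x $ i $ b))"

text \<open>When the degree of \<open>P x\<close> is at most \<open>D\<close>, this is the
  reciprocal polynomial, \<tau>^D times the value of \<open>P x\<close> at 1/\<tau>; writing it
  through coefficients extends it to \<tau> = 0.\<close>

definition Q :: "nat \<Rightarrow> 'n cmat \<Rightarrow> real \<Rightarrow> complex" where
  "Q D x \<tau> = (\<Sum>e\<le>D. coeff (P x) e * of_real \<tau> ^ (D - e))"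

text \<open>Conjugation maps every ball around a real solution to itself, which turns local
  uniqueness into reality.\<close>

lemma dist_cnj_mat: "dist (cnj_mat x) (cnj_mat y) = dist x y"
proof -
  have "dist (cnj_mat x $ i) (cnj_mat y $ i) = dist (x $ i) (y $ i)" for i
    unfolding dist_vec_def[of "cnj_mat x $ i"] dist_vec_def[of "x $ i"]
    by (simp add: cnj_mat_def dist_norm flip: complex_cnj_diff)
  then show ?thesis unfolding dist_vec_def[of "cnj_mat x"] dist_vec_def[of x] by simp
qed

lemma chart_cnj_mat: "chart d e x \<Longrightarrow> chart d e (cnj_mat x)"
  by (auto simp: chart_def le_def cnj_mat_def vec_eq_iff)

lemma vanishes_cnj_mat: "vanishes T x \<Longrightarrow> vanishes T (cnj_mat x)"
  by (auto simp: vanishes_def cnj_mat_def poly_P_cnj)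

lemma bounded_linear_entry: "bounded_linear (\<lambda>x::'n cmat. x $ i $ b)"
  by (intro bounded_linear_compose[OF bounded_linear_vec_nth bounded_linear_vec_nth])

lemma C1_poly_P: "C1 (\<lambda>x. poly (P x) t)"
  unfolding poly_P
  by (rule C1_sum, rule C1_mult, rule C1_mult, rule C1_const, rule C1_prod,
      rule C1_bounded_linear[OF bounded_linear_entry], rule C1_const)

lemma C1_fst:
  fixes f :: "'a::real_normed_vector \<Rightarrow> 'c::real_normed_vector"
  assumes "C1 f"
  shows "C1 (\<lambda>p::'a \<times> 'b::real_normed_vector. f (fst p))"
proof -
  obtain f' where f': "\<And>x. (f has_derivative blinfun_apply (f' x)) (at x)" "continuous_on UNIV f'"
    using assms by (auto simp: C1_def)
  have "((\<lambda>p. f (fst p)) has_derivative blinfun_apply (f' (fst p) o\<^sub>L fst_blinfun)) (at p)" for p :: "'a \<times> 'b"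
    using has_derivative_compose[OF has_derivative_fst[OF has_derivative_ident] f'(1)]
    by (rule has_derivative_eq_rhs) auto
  moreover have "continuous_on UNIV (\<lambda>p::'a \<times> 'b. f' (fst p) o\<^sub>L fst_blinfun)"
    by (intro continuous_intros continuous_on_compose2[OF f'(2)]) auto
  ultimately show ?thesis by (rule C1I)
qed

lemma C1_coeff_P: "C1 (\<lambda>x. coeff (P x) e)"
proof -
  have "coeff (P x) e = (\<Sum>p | p permutes UNIV. (if wt p = e then of_real (cf p) else 0) * (\<Prod>i\<in>R. x $ i $ p i))" for x
    unfolding coeff_P by (intro sum.cong) auto
  then show ?thesis
    by (simp only:) (rule C1_sum, rule C1_mult, rule C1_const, rule C1_prod,
        rule C1_bounded_linear[OF bounded_linear_entry])
qed

lemma C1_Q: "C1 (\<lambda>p. Q D (fst p) (snd p))"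
  unfolding Q_def
  by (rule C1_sum, rule C1_mult, rule C1_fst[OF C1_coeff_P], rule C1_power, rule C1_bounded_linear,
      rule bounded_linear_compose[OF bounded_linear_of_real bounded_linear_snd])

lemma Q_eq:
  assumes "le d x" "\<tau> \<noteq> 0"
  shows "Q (sum d R) x \<tau> = of_real \<tau> ^ sum d R * poly (P x) (of_real (1 / \<tau>))"
  unfolding Q_def by (rule sum_powers_eq_poly_inverse[OF degree_P_le[OF assms(1)] assms(2)])

lemma Q_zero: "Q D x 0 = coeff (P x) D"
proof -
  have "Q D x 0 = (\<Sum>e\<in>{D}. coeff (P x) e * of_real 0 ^ (D - e))"
    unfolding Q_def by (rule sum.mono_neutral_right) auto
  then show ?thesis by simp
qed

end

section \<open>Solutions near a solution in a smaller cell\<close>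

context wronski_form
begin

lemma chart_add_tangent: "chart d e x \<Longrightarrow> tangent d e v \<Longrightarrow> chart d e (x + z *\<^sub>R v)"
  by (auto simp: chart_def tangent_def le_def)

text \<open>Lowering one pivot by 1 keeps the two sequences interlaced. This comparison drives the
  dimension count of the chart and the triangularity arguments between the two unit blocks.\<close>

lemma lowered_le_iff:
  assumes "adm d" "i0 \<in> R" "0 < d i0" "adm (d(i0 := d i0 - 1))" "l \<in> R" "j \<in> R"
  shows "(d(i0 := d i0 - 1)) l \<le> d j \<longleftrightarrow> l \<le> j"
proof -
  let ?e = "d(i0 := d i0 - 1)"
  consider "l = j" | "l < j" | "j < l" "l \<noteq> i0" | "j < l" "l = i0" by (metis linorder_neqE)
  then show ?thesis
  proof cases
    case 2
    then have "d l < d j" using adm_less_iff[OF assms(1,5,6)] by simp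
    then have "?e l \<le> d j" by auto
    then show ?thesis using 2 by simp
  next
    case 3
    then have "d j < d l" using adm_less_iff[OF assms(1,6,5)] by simp
    then show ?thesis using 3 by simp
  next
    case 4
    then have "?e j < ?e l" "j \<noteq> i0" using adm_less_iff[OF assms(4,6,5)] by auto
    then show ?thesis using 4 by simp
  qed auto
qed

definition free :: "('n \<Rightarrow> nat) \<Rightarrow> ('n \<Rightarrow> nat) \<Rightarrow> ('n \<times> 'n) set" where
  "free d e = {(j, b). j \<in> R \<and> dg b \<le> d j \<and> (\<forall>l\<in>R. b \<noteq> col (e l))}"

lemma R_downward: "j \<in> R \<Longrightarrow> l \<le> j \<Longrightarrow> l \<in> R"
  using pos_less_iff[of l j] by (auto simp: R_def le_less)

lemma card_atMost_pos: "card {l::'n. l \<le> j} = pos j + 1"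
proof -
  have "{l::'n. l \<le> j} = insert j {l. l < j}" by auto
  then show ?thesis by (simp add: pos_def)
qed

text \<open>Row \<open>j\<close> has \<open>d j + 1\<close> columns of allowed degree, of which the
  unit block reserves those of the pivots \<open>e l\<close> with \<open>l \<le> j\<close>,
  \<open>pos j + 1\<close> in number. What remains adds up to the dimension of the cell.\<close>

lemma card_free:
  assumes d: "adm d" and e: "adm e" and le: "\<And>l j. l \<in> R \<Longrightarrow> j \<in> R \<Longrightarrow> e l \<le> d j \<longleftrightarrow> l \<le> j"
  shows "card (free d e) + q = sum d R"
proof -
  define A where "A j = {b::'n. dg b \<le> d j \<and> (\<forall>l\<in>R. b \<noteq> col (e l))}" for j
  have "card (A j) + pos j = d j" if j: "j \<in> R" for j
  proof -
    let ?B = "(\<lambda>l. col (e l) :: 'n) ` {l. l \<le> j}"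
    have sub: "{l. l \<le> j} \<subseteq> R" using R_downward[OF j] by auto
    have inj: "inj_on (\<lambda>l. col (e l) :: 'n) {l. l \<le> j}"
      using adm_col_eq[OF e] sub by (auto simp: inj_on_def)
    have "{b. dg b \<le> d j} = A j \<union> ?B"
    proof (intro set_eqI iffI)
      fix b :: 'n assume b: "b \<in> {b. dg b \<le> d j}"
      show "b \<in> A j \<union> ?B"
      proof (cases "\<exists>l\<in>R. b = col (e l)")
        case True
        then obtain l where l: "l \<in> R" "b = col (e l)" by auto
        then have "e l \<le> d j" using b e by (auto simp: adm_less_card)
        then have "l \<le> j" using le l j by simp
        then show ?thesis using l by auto
      qed (use b in \<open>auto simp: A_def\<close>)
    next
      fix b :: 'n assume "b \<in> A j \<union> ?B"
      then show "b \<in> {b. dg b \<le> d j}"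
        using le[OF _ j] sub e by (auto simp: A_def adm_less_card)
    qed
    moreover have "A j \<inter> ?B = {}" using sub by (auto simp: A_def)
    ultimately have "card {b::'n. dg b \<le> d j} = card (A j) + card ?B"
      by (simp add: card_Un_disjoint)
    moreover have "card {b::'n. dg b \<le> d j} = d j + 1"
    proof -
      have "dg ` {b::'n. dg b \<le> d j} = {..d j}"
      proof
        show "{..d j} \<subseteq> dg ` {b::'n. dg b \<le> d j}"
        proof
          fix a assume "a \<in> {..d j}"
          then have "a \<le> d j" "a < CARD('n)" using adm_less_card[OF d, of j] by auto
          then show "a \<in> dg ` {b::'n. dg b \<le> d j}" by (intro image_eqI[of _ _ "col a"]) auto
        qed
      qed auto
      then show ?thesis using card_image[OF inj_on_subset[OF inj_dg], of "{b::'n. dg b \<le> d j}"] by simp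
    qed
    ultimately show ?thesis by (simp add: card_image[OF inj] card_atMost_pos)
  qed
  then have "(\<Sum>j\<in>R. card (A j)) + q = sum d R"
    unfolding q_def sum.distrib[symmetric] by (intro sum.cong) auto
  moreover have "free d e = (SIGMA j:R. A j)" by (auto simp: free_def A_def)
  ultimately show ?thesis by simp
qed

text \<open>The equations at infinity: as \<open>\<tau>\<close> tends to 0 the root \<open>1 / \<tau>\<close> escapes to infinity and the
  last equation degenerates to the vanishing of the leading coefficient.  Coordinates that are
  fixed by the chart are kept as dummy equations so that the system is square.\<close>
definition system :: "nat \<Rightarrow> ('n \<times> 'n) set \<Rightarrow> 'n \<times> 'n \<Rightarrow> ('n \<times> 'n \<Rightarrow> real) \<Rightarrow> 'n cmat \<times> real \<Rightarrow> 'n cmat" where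
  "system D S s0 h p = (\<chi> j b. if (j, b) = s0 then Q D (fst p) (snd p)
     else if (j, b) \<in> S then poly (P (fst p)) (of_real (h (j, b))) else fst p $ j $ b)"

lemma C1_system: "C1 (\<lambda>p. (system D S s0 h p, snd p))"
proof -
  have "C1 (\<lambda>p. if (j, b) = s0 then Q D (fst p) (snd p)
     else if (j, b) \<in> S then poly (P (fst p)) (of_real (h (j, b))) else fst p $ j $ b)" for j b
  proof -
    consider "(j, b) = s0" | "(j, b) \<noteq> s0" "(j, b) \<in> S" | "(j, b) \<noteq> s0" "(j, b) \<notin> S" by blast
    then show ?thesis
      by cases (simp_all add: C1_Q C1_fst[OF C1_poly_P] C1_fst[OF C1_bounded_linear[OF bounded_linear_entry]])
  qed
  then show ?thesis
    unfolding system_def by (intro C1_Pair C1_vec C1_bounded_linear[OF bounded_linear_snd])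
qed

lemma system_derivative_entry:
  assumes "((\<lambda>p. (system D S s0 h p, snd p)) has_derivative E) (at (x, \<tau>))"
  shows "((\<lambda>z::real. if (j, b) = s0 then Q D (x + z *\<^sub>R v) (\<tau> + z * \<sigma>)
       else if (j, b) \<in> S then poly (P (x + z *\<^sub>R v)) (of_real (h (j, b))) else x $ j $ b + z *\<^sub>R v $ j $ b)
     has_vector_derivative fst (E (v, \<sigma>)) $ j $ b) (at 0)"
    and "snd (E (v, \<sigma>)) = \<sigma>"
proof -
  note line = has_vector_derivative_line[OF assms, of "(v, \<sigma>)"]
  from bounded_linear.has_vector_derivative[OF bounded_linear_compose[OF bounded_linear_entry[of j b] bounded_linear_fst] line]
  show "((\<lambda>z::real. if (j, b) = s0 then Q D (x + z *\<^sub>R v) (\<tau> + z * \<sigma>)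
       else if (j, b) \<in> S then poly (P (x + z *\<^sub>R v)) (of_real (h (j, b))) else x $ j $ b + z *\<^sub>R v $ j $ b)
     has_vector_derivative fst (E (v, \<sigma>)) $ j $ b) (at 0)"
    by (simp add: system_def cong: if_cong)
  have "((\<lambda>z::real. \<tau> + z * \<sigma>) has_vector_derivative snd (E (v, \<sigma>))) (at 0)"
    using bounded_linear.has_vector_derivative[OF bounded_linear_snd line] by simp
  moreover have "((\<lambda>z::real. \<tau> + z * \<sigma>) has_vector_derivative \<sigma>) (at 0)"
    by (auto intro!: derivative_eq_intros)
  ultimately show "snd (E (v, \<sigma>)) = \<sigma>" by (rule vector_derivative_unique_at)
qed

text \<open>The smaller solution paired with \<tau> = 0 solves the extended system. The local
  inverse continues it to small \<tau>, and injectivity near it gives uniqueness. All radii up to a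
  fixed \<open>r0\<close> are allowed, because the count needs a radius small compared with the
  distances between several solutions.\<close>

lemma local_solutions:
  assumes d: "adm d" and i0: "i0 \<in> R" "0 < d i0" and e: "e = d(i0 := d i0 - 1)" "adm e"
    and T: "finite T" "q + card T = sum e R"
    and x: "cell e x" "vanishes T x" "nondegenerate e e T x" "cnj_mat x = x"
  obtains r0 where "r0 > 0" and "\<And>r. 0 < r \<Longrightarrow> r \<le> r0 \<Longrightarrow> \<forall>\<^sub>F \<tau> in at_right 0.
     \<exists>y. chart d e y \<and> vanishes (insert (1 / \<tau>) T) y \<and> dist y x < r \<and>
       nondegenerate d e (insert (1 / \<tau>) T) y \<and> cnj_mat y = y \<and>
       (\<forall>y'. chart d e y' \<longrightarrow> vanishes (insert (1 / \<tau>) T) y' \<longrightarrow> dist y' x < r \<longrightarrow> y' = y)"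
proof -
  define S where "S = free d e"
  \<comment> \<open>The one coordinate that is free in the chart but 0 on the smaller cell; the
    equation for the new root is assigned to it.\<close>
  define s0 where "s0 = (i0, col (d i0) :: 'n)"
  define D where "D = sum d R"
  have le_iff: "e l \<le> d j \<longleftrightarrow> l \<le> j" if "l \<in> R" "j \<in> R" for l j
    unfolding e(1) using lowered_le_iff[of d i0 l j] d i0 e that by simp
  have sum_e: "sum e R + 1 = D"
  proof -
    have "sum e (R - {i0}) = sum d (R - {i0})" unfolding e(1) by (intro sum.cong) auto
    then show ?thesis
      using i0 by (simp add: D_def e(1) sum.remove[of R i0])
  qed
  have d_ne: "d i0 \<noteq> e l" if "l \<in> R" for l
  proof
    assume a: "d i0 = e l"
    then have "l \<noteq> i0" using i0 e by auto
    then have "d l = d i0" using a e by auto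
    then show False using \<open>l \<noteq> i0\<close> adm_inj[OF d] that i0 by (auto simp: inj_on_def)
  qed
  have s0S: "s0 \<in> S"
    using d_ne i0 d e(2) by (auto simp: S_def s0_def free_def col_eq_iff adm_less_card)
  have "card S = card T + 1"
    using card_free[OF d e(2) le_iff] T(2) sum_e by (simp add: S_def D_def)
  then have "card (S - {s0}) = card T" using s0S by simp
  \<comment> \<open>There are as many remaining free coordinates as points in \<open>T\<close>; any
    pairing turns the equations into a self-map of the matrix space.\<close>
  then obtain h where h: "bij_betw h (S - {s0}) T"
    using finite_same_card_bij[of "S - {s0}" T] T(1) by (auto simp: S_def)
  define G where "G = (\<lambda>p. (system D S s0 h p, snd p))"
  have e_le: "e i \<le> d i" for i by (simp add: e(1))
  have lex: "le d x"
    using x(1) le_less_trans[OF e_le] by (auto simp: chart_def le_def)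
  have fixed: "y $ j $ b = x $ j $ b" if "chart d e y" "(j, b) \<notin> S" for y j b
  proof -
    show ?thesis
    proof (cases "j \<in> R")
      case True
      then consider "d j < dg b" | l where "l \<in> R" "b = col (e l)"
        using \<open>(j, b) \<notin> S\<close> by (auto simp: S_def free_def not_le)
      then show ?thesis
        using \<open>chart d e y\<close> lex x(1) True by cases (auto simp: chart_def le_def chart_def)
    qed (use \<open>chart d e y\<close> x(1) in \<open>auto simp: chart_def\<close>)
  qed
  have chart_x: "chart d e x"
    using x(1) lex by (simp add: chart_def)
  \<comment> \<open>The target value: 0 for each equation, and the entry of \<open>x\<close> at
    every coordinate frozen by the chart.\<close>
  define Y where "Y = (\<chi> j b. if (j, b) \<in> S then 0 else x $ j $ b)"
  have Y_iff: "system D S s0 h (y, \<tau>) = Y \<longleftrightarrow> chart d e y \<and> vanishes (insert (1 / \<tau>) T) y"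
    if \<tau>: "\<tau> \<noteq> 0" for y \<tau>
  proof
    assume eq: "system D S s0 h (y, \<tau>) = Y"
    have ent: "(if (j, b) = s0 then Q D y \<tau>
        else if (j, b) \<in> S then poly (P y) (of_real (h (j, b))) else y $ j $ b)
       = (if (j, b) \<in> S then 0 else x $ j $ b)" for j b
      using arg_cong[OF eq, of "\<lambda>m. m $ j $ b"] unfolding system_def Y_def
      by (simp only: vec_lambda_beta fst_conv snd_conv)
    have fx: "y $ j $ b = x $ j $ b" if "(j, b) \<notin> S" for j b
      using ent[of j b] that s0S by (auto split: if_splits)
    have ch: "chart d e y"
      unfolding chart_def le_def
    proof (intro conjI ballI allI impI)
      show "y $ i $ b = 0" if "i \<in> R" "d i < dg b" for i b
        using fx[of i b] chart_x that by (auto simp: S_def free_def chart_def le_def)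
      show "y $ i $ col (e j) = (if i = j then 1 else 0)" if "i \<in> R" "j \<in> R" for i j
      proof -
        have "(i, col (e j)) \<notin> S" using that by (auto simp: S_def free_def)
        then show ?thesis using fx chart_x that by (simp add: chart_def)
      qed
      show "y $ i = 0" if "i \<notin> R" for i
        using fx[of i] chart_x that by (auto simp: vec_eq_iff S_def free_def chart_def)
    qed
    have "Q D y \<tau> = 0" using ent[of "fst s0" "snd s0"] s0S by simp
    then have "poly (P y) (of_real (1 / \<tau>)) = 0"
      using Q_eq[of d y \<tau>] ch \<tau> by (simp add: chart_def D_def)
    moreover have "poly (P y) (of_real t) = 0" if "t \<in> T" for t
    proof -
      have "t \<in> h ` (S - {s0})" using h that by (simp add: bij_betw_def)
      then obtain s where s: "s \<in> S - {s0}" "h s = t" by blast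
      then show ?thesis using ent[of "fst s" "snd s"] by auto
    qed
    ultimately show "chart d e y \<and> vanishes (insert (1 / \<tau>) T) y"
      using ch by (auto simp: vanishes_def)
  next
    assume a: "chart d e y \<and> vanishes (insert (1 / \<tau>) T) y"
    then have "Q D y \<tau> = 0" using Q_eq[of d y \<tau>] \<tau> by (simp add: chart_def D_def vanishes_def)
    moreover have "poly (P y) (of_real (h s)) = 0" if "s \<in> S" "s \<noteq> s0" for s
      using a h that by (auto simp: vanishes_def bij_betw_def)
    ultimately show "system D S s0 h (y, \<tau>) = Y"
      using fixed[of y] a s0S by (auto simp: system_def Y_def vec_eq_iff)
  qed
  have Y0: "G (x, 0) = (Y, 0)"
  proof -
    have lex: "le e x" using x(1) by (simp add: chart_def)
    have "coeff (P x) D = 0" using coeff_P_above[OF lex, of D] sum_e by simp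
    then have "Q D x 0 = 0" by (simp add: Q_zero)
    moreover have "poly (P x) (of_real (h s)) = 0" if "s \<in> S" "s \<noteq> s0" for s
      using x(2) h that by (auto simp: vanishes_def bij_betw_def)
    ultimately show ?thesis using s0S by (auto simp: G_def system_def Y_def vec_eq_iff)
  qed
  have C1G: "C1 G" unfolding G_def by (rule C1_system)
  then obtain E where E: "(G has_derivative E) (at (x, 0))" by (auto simp: C1_def)
  \<comment> \<open>The kernel is cut down in turn: the last component kills \<sigma>, the dummy
    equations make \<open>v\<close> tangent to the chart, the equation at infinity makes it tangent
    to the smaller cell, and nondegeneracy of \<open>x\<close> finishes.\<close>
  have injE: "w = 0" if w: "E w = 0" for w
  proof -
    obtain v \<sigma> where w': "w = (v, \<sigma>)" by fastforce
    note der = system_derivative_entry[OF E[unfolded G_def], where v = v and \<sigma> = \<sigma>]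
    have \<sigma>: "\<sigma> = 0" using der(2) w w' by simp
    have off: "v $ j $ b = 0" if "(j, b) \<notin> S" for j b
    proof -
      have "(j, b) \<noteq> s0" using that s0S by auto
      then have "((\<lambda>z::real. x $ j $ b + z *\<^sub>R v $ j $ b) has_vector_derivative 0) (at 0)"
        using der(1)[of j b] that w w' by simp
      moreover have "((\<lambda>z::real. x $ j $ b + z *\<^sub>R v $ j $ b) has_vector_derivative v $ j $ b) (at 0)"
        by (auto intro!: derivative_eq_intros)
      ultimately show ?thesis using vector_derivative_unique_at by metis
    qed
    have ve: "v $ i $ col (e j) = 0" if "i \<in> R" "j \<in> R" for i j
      using off that by (auto simp: S_def free_def)
    have lev: "le d v" using off by (auto simp: le_def S_def free_def)
    have crit: "critical T x v"
      unfolding critical_def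
    proof
      fix t assume "t \<in> T"
      then obtain s where s: "s \<in> S - {s0}" "h s = t" using h by (auto simp: bij_betw_def)
      then show "((\<lambda>z::real. poly (P (x + z *\<^sub>R v)) (of_real t)) has_vector_derivative 0) (at 0)"
        using der(1)[of "fst s" "snd s"] w w' by auto
    qed
    \<comment> \<open>At \<tau> = 0 the new equation is the top coefficient, a multiple of the
      product of the entries at the old pivots. All of them but the one at \<open>s0\<close> equal
      1, so it is linear along the line.\<close>
    have "Q D (x + z *\<^sub>R v) 0 = z *\<^sub>R (of_real (lc d) * v $ i0 $ col (d i0))" for z
    proof -
      have "le d (x + z *\<^sub>R v)" using chart_x lev by (auto simp: le_def chart_def)
      then have "Q D (x + z *\<^sub>R v) 0 = of_real (lc d) * (\<Prod>i\<in>R. (x + z *\<^sub>R v) $ i $ col (d i))"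
        unfolding Q_zero D_def by (rule coeff_P_top) (rule adm_less_card[OF d])
      also have "(\<Prod>i\<in>R. (x + z *\<^sub>R v) $ i $ col (d i))
         = (x + z *\<^sub>R v) $ i0 $ col (d i0) * (\<Prod>i\<in>R - {i0}. (x + z *\<^sub>R v) $ i $ col (d i))"
        using i0 by (simp add: prod.remove)
      also have "(\<Prod>i\<in>R - {i0}. (x + z *\<^sub>R v) $ i $ col (d i)) = 1"
      proof (rule prod.neutral, rule ballI)
        fix i assume i: "i \<in> R - {i0}"
        then have "d i = e i" using e by simp
        then show "(x + z *\<^sub>R v) $ i $ col (d i) = 1" using ve[of i i] chart_x i by (simp add: chart_def)
      qed
      also have "(x + z *\<^sub>R v) $ i0 $ col (d i0) = z *\<^sub>R v $ i0 $ col (d i0)"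
      proof -
        have "e i0 < d i0" using e i0 by simp
        then have "x $ i0 $ col (d i0) = 0" using x(1) i0 d by (auto simp: chart_def le_def adm_less_card)
        then show ?thesis by simp
      qed
      finally show ?thesis by (simp add: scaleR_conv_of_real)
    qed
    then have "((\<lambda>z::real. z *\<^sub>R (of_real (lc d) * v $ i0 $ col (d i0))) has_vector_derivative 0) (at 0)"
      using der(1)[of "fst s0" "snd s0"] w w' \<sigma> by simp
    moreover have "((\<lambda>z::real. z *\<^sub>R (of_real (lc d) * v $ i0 $ col (d i0)))
        has_vector_derivative of_real (lc d) * v $ i0 $ col (d i0)) (at 0)"
      by (auto intro!: derivative_eq_intros)
    ultimately have "of_real (lc d) * v $ i0 $ col (d i0) = 0"
      using vector_derivative_unique_at by metis
    then have v0: "v $ i0 $ col (d i0) = 0" using adm_lc[OF d] by simp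
    have "tangent e e v"
      unfolding tangent_def le_def
    proof (intro conjI ballI allI impI)
      show "v $ i $ b = 0" if i: "i \<in> R" and b: "e i < dg b" for i b
      proof (cases "d i < dg b")
        case True
        then show ?thesis using lev i by (simp add: le_def)
      next
        case False
        then have "i = i0" "dg b = d i0" using b e i0 by (auto split: if_splits)
        then show ?thesis using v0 by (metis col_dg)
      qed
      show "v $ i $ col (e j) = 0" if "i \<in> R" "j \<in> R" for i j using ve that by simp
      show "v $ i = 0" if "i \<notin> R" for i using off[of i] that by (simp add: vec_eq_iff S_def free_def)
    qed
    then have "v = 0" using x(3) crit by (simp add: nondegenerate_def)
    then show "w = 0" using w' \<sigma> by (simp add: zero_prod_def)
  qed
  obtain U W g where U: "open U" "(x, 0) \<in> U" "open W" "G (x, 0) \<in> W" "homeomorphism U W G g"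
    and injU: "\<And>p E w. p \<in> U \<Longrightarrow> (G has_derivative E) (at p) \<Longrightarrow> E w = 0 \<Longrightarrow> w = 0"
    using C1_local_inverse[OF C1G E injE] by metis
  \<comment> \<open>A product neighbourhood makes the uniqueness radius in \<open>x\<close>
    independent of \<tau>.\<close>
  obtain A B where AB: "open A" "open B" "(x, 0) \<in> A \<times> B" "A \<times> B \<subseteq> U"
    using open_prod_elim[OF U(1,2)] by metis
  obtain r0 where r0: "r0 > 0" "ball x r0 \<subseteq> A" using AB openE by blast
  obtain r1 where r1: "r1 > 0" "ball 0 r1 \<subseteq> B" using AB openE by blast
  have nd: "nondegenerate d e (insert (1 / \<tau>) T) y"
    if y: "chart d e y" "(y, \<tau>) \<in> U" and \<tau>: "\<tau> \<noteq> 0" for y \<tau>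
    unfolding nondegenerate_def
  proof (intro allI impI)
    fix v assume tan: "tangent d e v" and crit: "critical (insert (1 / \<tau>) T) y v"
    obtain E where E: "(G has_derivative E) (at (y, \<tau>))" using C1G by (auto simp: C1_def)
    note der = system_derivative_entry[OF E[unfolded G_def], where v = v and \<sigma> = 0]
    have "fst (E (v, 0)) $ j $ b = 0" for j b
    proof -
      consider "(j, b) = s0" | "(j, b) \<noteq> s0" "(j, b) \<in> S" | "(j, b) \<notin> S" by blast
      then have "((\<lambda>z::real. if (j, b) = s0 then Q D (y + z *\<^sub>R v) (\<tau> + z * 0)
         else if (j, b) \<in> S then poly (P (y + z *\<^sub>R v)) (of_real (h (j, b))) else y $ j $ b + z *\<^sub>R v $ j $ b)
         has_vector_derivative 0) (at 0)"
      proof cases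
        case 1
        \<comment> \<open>For nonzero \<tau> the last equation differs from the root condition by
          the constant factor \<tau>^D, so a direction critical for the roots is critical for the
          system.\<close>
        have "Q D (y + z *\<^sub>R v) \<tau> = of_real \<tau> ^ D * poly (P (y + z *\<^sub>R v)) (of_real (1 / \<tau>))" for z
          using chart_add_tangent[OF y(1) tan, of z] Q_eq[of d _ \<tau>] \<tau> by (simp add: chart_def D_def)
        moreover have "((\<lambda>z::real. of_real \<tau> ^ D * poly (P (y + z *\<^sub>R v)) (of_real (1 / \<tau>)))
            has_vector_derivative of_real \<tau> ^ D * 0) (at 0)"
          using crit by (intro has_vector_derivative_mult_right) (simp add: critical_def)
        ultimately show ?thesis using 1 by simp
      next
        case 2
        then have "h (j, b) \<in> T" using h by (auto simp: bij_betw_def)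
        then show ?thesis using crit 2 by (simp add: critical_def)
      next
        case 3
        then have "(j, b) \<noteq> s0" using s0S by auto
        moreover have "v $ j $ b = 0"
        proof (cases "j \<in> R")
          case True
          then consider "d j < dg b" | l where "l \<in> R" "b = col (e l)"
            using 3 by (auto simp: S_def free_def not_le)
          then show ?thesis using tan True by cases (auto simp: tangent_def le_def)
        qed (use tan in \<open>auto simp: tangent_def\<close>)
        ultimately show ?thesis using 3 by simp
      qed
      from vector_derivative_unique_at[OF der(1) this] show ?thesis .
    qed
    then have "fst (E (v, 0)) = 0" by (simp add: vec_eq_iff)
    then have "E (v, 0) = 0" using der(2) by (simp add: prod_eq_iff)
    from injU[OF y(2) E this] show "v = 0" by (simp add: zero_prod_def)
  qed
  have injG: "p = p'" if "p \<in> U" "p' \<in> U" "G p = G p'" for p p'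
    using U(5) that by (metis homeomorphism_def)
  show thesis
  proof (rule that[OF r0(1)])
    fix r assume r: "0 < r" "r \<le> r0"
    have gx: "g (Y, 0) = (x, 0)" using U(2,5) Y0 by (metis homeomorphism_def)
    have "continuous_on W g" using U(5) by (simp add: homeomorphism_def)
    then have "isCont g (Y, 0)" using U(3,4) Y0 by (simp add: continuous_on_eq_continuous_at)
    then have "(g \<longlongrightarrow> (x, 0)) (at (Y, 0))" using gx by (simp add: isCont_def)
    moreover have "((\<lambda>\<tau>. (Y, \<tau>)) \<longlongrightarrow> (Y, 0)) (at_right (0::real))"
      by (intro tendsto_intros)
    ultimately have "((\<lambda>\<tau>. g (Y, \<tau>)) \<longlongrightarrow> (x, 0)) (at_right 0)"
      using gx isCont_tendsto_compose[OF \<open>isCont g (Y, 0)\<close>] by fastforce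
    from tendsto_fst[OF this] have near: "\<forall>\<^sub>F \<tau> in at_right 0. dist (fst (g (Y, \<tau>))) x < r"
      using r(1) by (simp add: tendsto_iff)
    have "((\<lambda>\<tau>. (Y, \<tau>)) \<longlongrightarrow> (Y, 0)) (at_right (0::real))"
      by (intro tendsto_intros)
    then have inW: "\<forall>\<^sub>F \<tau> in at_right 0. (Y, \<tau>) \<in> W"
      using U(3,4) Y0 by (simp add: topological_tendstoD)
    have small: "\<forall>\<^sub>F \<tau> in at_right (0::real). 0 < \<tau> \<and> \<tau> < r1"
      using eventually_at_right_real[OF r1(1)] by (simp add: greaterThanLessThan_iff)
    show "\<forall>\<^sub>F \<tau> in at_right 0.
     \<exists>y. chart d e y \<and> vanishes (insert (1 / \<tau>) T) y \<and> dist y x < r \<and>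
       nondegenerate d e (insert (1 / \<tau>) T) y \<and> cnj_mat y = y \<and>
       (\<forall>y'. chart d e y' \<longrightarrow> vanishes (insert (1 / \<tau>) T) y' \<longrightarrow> dist y' x < r \<longrightarrow> y' = y)"
      using near inW small
    proof eventually_elim
      case (elim \<tau>)
      define y where "y = fst (g (Y, \<tau>))"
      have inU: "(y', \<tau>) \<in> U" if "dist y' x < r" for y'
      proof -
        have "y' \<in> ball x r0" using that r by (simp add: dist_commute)
        moreover have "\<tau> \<in> ball 0 r1" using elim by simp
        ultimately have "(y', \<tau>) \<in> A \<times> B" using r0(2) r1(2) by blast
        then show ?thesis using AB(4) by blast
      qed
      have "G (g (Y, \<tau>)) = (Y, \<tau>)" using U(5) elim by (simp add: homeomorphism_def)
      then have "snd (g (Y, \<tau>)) = \<tau>" by (simp add: G_def)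
      then have Gy: "G (y, \<tau>) = (Y, \<tau>)" using \<open>G (g (Y, \<tau>)) = (Y, \<tau>)\<close> y_def by (metis prod.collapse)
      then have y: "chart d e y" "vanishes (insert (1 / \<tau>) T) y"
        using Y_iff[of \<tau> y] elim by (auto simp: G_def)
      have dy: "dist y x < r" using elim y_def by simp
      have uniq: "y' = y" if "chart d e y'" "vanishes (insert (1 / \<tau>) T) y'" "dist y' x < r" for y'
      proof -
        have "G (y', \<tau>) = (Y, \<tau>)" using Y_iff[of \<tau> y'] that elim by (auto simp: G_def)
        then show ?thesis using injG[OF inU inU, of y' y] that dy Gy by simp
      qed
      \<comment> \<open>The conjugate solves the same real problem at the same distance from the
        real matrix \<open>x\<close>.\<close>
      moreover have "cnj_mat y = y"
        using dist_cnj_mat[of y x] x(4) dy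
        by (intro uniq chart_cnj_mat[OF y(1)] vanishes_cnj_mat[OF y(2)]) simp
      moreover have "nondegenerate d e (insert (1 / \<tau>) T) y"
        using elim by (intro nd[OF y(1) inU[OF dy]]) simp
      ultimately show ?case using y dy by blast
    qed
  qed
qed

end

section \<open>Change of chart\<close>

context wronski_form
begin

lemma vanishes_row_span:
  assumes "\<And>i. i \<in> R \<Longrightarrow> y $ i \<in> row_span x" "vanishes T x"
  shows "vanishes T y"
proof -
  have "P x dvd P y" by (rule P_span_dvd) (rule assms)
  then show ?thesis using assms(2) by (auto simp: vanishes_def elim!: dvdE)
qed

lemma row_in_span: "i \<in> R \<Longrightarrow> x $ i \<in> row_span x"
  by (intro vec.span_base) auto

lemma row_span_eqI:
  assumes "\<And>i. i \<in> R \<Longrightarrow> y $ i \<in> row_span x" "\<And>i. i \<in> R \<Longrightarrow> x $ i \<in> row_span y"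
  shows "row_span x = row_span y"
  by (intro equalityI vec.span_minimal vec.subspace_span) (use assms in auto)

definition pivot :: "'n \<Rightarrow> 'n \<Rightarrow> 'n cmat \<Rightarrow> 'n cmat" where
  "pivot i c x = (\<chi> j. if j = i then (1 / x $ i $ c) *s x $ i
     else if j \<in> R then x $ j - (x $ j $ c / x $ i $ c) *s x $ i else 0)"

lemma row_span_pivot:
  assumes i: "i \<in> R" "x $ i $ c \<noteq> 0"
  shows "row_span (pivot i c x) = row_span x"
proof (rule row_span_eqI)
  let ?y = "pivot i c x"
  fix j assume j: "j \<in> R"
  have yi: "x $ i = x $ i $ c *s ?y $ i" using i by (simp add: pivot_def vec_eq_iff)
  show "?y $ j \<in> row_span x"
    using i j by (auto simp: pivot_def intro!: vec.span_diff vec.span_scale row_in_span)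
  show "x $ j \<in> row_span ?y"
  proof (cases "j = i")
    case True
    then show ?thesis using yi i by (metis vec.span_scale row_in_span)
  next
    case False
    then have "x $ j = ?y $ j + x $ j $ c *s ?y $ i"
      using i j by (simp add: pivot_def vec_eq_iff)
    then show ?thesis using i j by (metis vec.span_add vec.span_scale row_in_span)
  qed
qed

text \<open>The row operation respects the bounds \<open>d\<close>: for \<open>j < i\<close> the
  entry to be cleared is already 0, so nothing is subtracted, and for \<open>j > i\<close> row
  \<open>i\<close> has the smaller bound.\<close>

lemma chart_pivot:
  assumes d: "adm d" and x: "chart d e x" and i: "i \<in> R" and e': "\<And>j. j \<noteq> i \<Longrightarrow> e' j = e j"
    and c: "x $ i $ col (e' i) \<noteq> 0" "e' i < CARD('n)" "\<And>j. j \<in> R \<Longrightarrow> j < i \<Longrightarrow> d j < e' i"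
  shows "chart d e' (pivot i (col (e' i)) x)"
  unfolding chart_def le_def
proof (intro conjI ballI allI impI)
  fix j b :: 'n assume j: "j \<in> R" and b: "d j < dg b"
  show "pivot i (col (e' i)) x $ j $ b = 0"
  proof (cases "j = i")
    case True
    then show ?thesis using x j b by (auto simp: pivot_def chart_def le_def)
  next
    case False
    have xj: "x $ j $ b = 0" using x j b by (auto simp: chart_def le_def)
    have "x $ j $ col (e' i) = 0 \<or> x $ i $ b = 0"
    proof (cases "j < i")
      case True
      then show ?thesis using x j c by (auto simp: chart_def le_def)
    next
      case nl: False
      then have "d i < dg b" using False adm_less_iff[OF d i j] b by auto
      then show ?thesis using x i by (auto simp: chart_def le_def)
    qed
    then show ?thesis using False j xj by (auto simp: pivot_def)
  qed
next
  fix l j assume l: "l \<in> R" and j: "j \<in> R"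
  show "pivot i (col (e' i)) x $ l $ col (e' j) = (if l = j then 1 else 0)"
    using x l j i c e' by (cases "j = i"; cases "l = i") (auto simp: pivot_def chart_def)
next
  fix j assume "j \<notin> R"
  then show "pivot i (col (e' i)) x $ j = 0" using i by (auto simp: pivot_def)
qed

text \<open>A tangent vector is transported by the transition matrix and corrected by rows in the
  span, a direction in which the subspace does not move. If the result is 0, the rows of
  \<open>v\<close> lie in the span of \<open>x\<close> and vanish in the columns of its unit block,
  so they are 0.\<close>

lemma nondegenerate_change_chart:
  assumes d: "adm d" and x: "chart d e' x" and y: "chart d e y" and span: "row_span x = row_span y"
    and e: "\<And>l j. l \<in> R \<Longrightarrow> j \<in> R \<Longrightarrow> e l \<le> d j \<longleftrightarrow> l \<le> j" "\<And>j. e j < CARD('n)"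
    and e': "\<And>l j. l \<in> R \<Longrightarrow> j \<in> R \<Longrightarrow> e' l \<le> d j \<longleftrightarrow> l \<le> j" "\<And>j. e' j < CARD('n)"
    and T: "vanishes T y" and nd: "nondegenerate d e T y"
  shows "nondegenerate d e' T x"
  unfolding nondegenerate_def
proof (intro allI impI)
  fix v assume tan: "tangent d e' v" and crit: "critical T x v"
  have d_mono: "d l \<le> d j" if "l \<in> R" "j \<in> R" "l \<le> j" for l j
    using adm_less_iff[OF d that(1,2)] that(3) by (cases "l = j") auto
  define A where "A i j = y $ i $ col (e' j)" for i j
  define A' where "A' i j = x $ i $ col (e j)" for i j
  have yA: "y $ i = (\<Sum>j\<in>R. A i j *s x $ j)" if "i \<in> R" for i
    unfolding A_def using x row_in_span[OF that, of y] span
    by (intro span_coords[where c = "\<lambda>j. col (e' j)"]) (auto simp: chart_def)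
  have xA': "x $ i = (\<Sum>j\<in>R. A' i j *s y $ j)" if "i \<in> R" for i
    unfolding A'_def using y row_in_span[OF that, of x] span
    by (intro span_coords[where c = "\<lambda>j. col (e j)"]) (auto simp: chart_def)
  define u :: "'n cmat" where "u = (\<chi> i. if i \<in> R then \<Sum>j\<in>R. A i j *s v $ j else 0)"
  \<comment> \<open>Clearing the columns of the other unit block makes the transported vector
    tangent to the second chart.\<close>
  define w :: "'n cmat" where "w = (\<chi> i. if i \<in> R then u $ i - (\<Sum>l\<in>R. u $ i $ col (e l) *s y $ l) else 0)"
  have A0: "A i j = 0" if "i \<in> R" "j \<in> R" "\<not> j \<le> i" for i j
    using y e'(1)[of j i] e'(2)[of j] that by (auto simp: A_def chart_def le_def)
  have leu: "u $ i $ b = 0" if i: "i \<in> R" and b: "d i < dg b" for i b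
  proof -
    have "A i j * v $ j $ b = 0" if j: "j \<in> R" for j
    proof (cases "j \<le> i")
      case True
      then have "d j < dg b" using d_mono[OF j i] b by simp
      then show ?thesis using tan j by (simp add: tangent_def le_def)
    qed (use A0 i j in simp)
    then show ?thesis using i by (auto simp: u_def intro!: sum.neutral)
  qed
  have lew: "w $ i $ b = 0" if i: "i \<in> R" and b: "d i < dg b" for i b
  proof -
    have "u $ i $ col (e l) * y $ l $ b = 0" if l: "l \<in> R" for l
    proof (cases "l \<le> i")
      case True
      then have "d l < dg b" using d_mono[OF l i] b by simp
      then show ?thesis using y l by (simp add: chart_def le_def)
    next
      case False
      then have "d i < e l" using e(1)[OF l i] by simp
      then show ?thesis using leu[OF i, of "col (e l)"] e(2) by simp
    qed
    then show ?thesis using i leu[OF i b] by (auto simp: w_def intro!: sum.neutral)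
  qed
  have tanw: "tangent d e w"
    unfolding tangent_def le_def
  proof (intro conjI ballI allI impI)
    show "w $ i $ b = 0" if "i \<in> R" "d i < dg b" for i b using lew that .
    show "w $ i $ col (e j) = 0" if "i \<in> R" "j \<in> R" for i j
    proof -
      have "(\<Sum>l\<in>R. u $ i $ col (e l) * y $ l $ col (e j)) = (\<Sum>l\<in>R. if l = j then u $ i $ col (e l) else 0)"
        using y that by (intro sum.cong) (auto simp: chart_def)
      then show ?thesis using that by (simp add: w_def)
    qed
    show "w $ i = 0" if "i \<notin> R" for i using that by (simp add: w_def)
  qed
  have critw: "critical T y w"
    unfolding critical_def
  proof
    fix t assume t: "t \<in> T"
    obtain E where E: "((\<lambda>x. poly (P x) (complex_of_real t)) has_derivative E) (at y)"
      using C1_poly_P[of "complex_of_real t"] by (auto simp: C1_def)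
    interpret E: bounded_linear E using E by (rule has_derivative_bounded_linear)
    have line: "((\<lambda>z::real. poly (P (y + z *\<^sub>R a)) (complex_of_real t)) has_vector_derivative E a) (at 0)" for a
      by (rule has_vector_derivative_line[OF E])
    define B :: "'n cmat" where "B = (\<chi> i. if i \<in> R then \<Sum>l\<in>R. u $ i $ col (e l) *s y $ l else 0)"
    have "E u = 0"
    proof -
      have rows: "(y + z *\<^sub>R u) $ i = (\<Sum>j\<in>R. A i j *s (x + z *\<^sub>R v) $ j)" if "i \<in> R" for i z
        using that by (simp add: yA u_def vec_eq_iff sum.distrib scaleR_sum_right distrib_left)
      \<comment> \<open>The determinant of the transition matrix is the same for all
        \<open>z\<close>, so along the line the two Wronskians differ by a fixed factor.\<close>
      obtain dt where dt: "P (y + z *\<^sub>R u) = dt * P (x + z *\<^sub>R v)" for z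
        using P_row_transform[of "y + _ *\<^sub>R u" A "x + _ *\<^sub>R v"] rows by blast
      have "((\<lambda>z::real. poly dt (of_real t) * poly (P (x + z *\<^sub>R v)) (of_real t)) has_vector_derivative
          poly dt (of_real t) * 0) (at 0)"
        using crit t by (intro has_vector_derivative_mult_right) (simp add: critical_def)
      then have "((\<lambda>z::real. poly (P (y + z *\<^sub>R u)) (of_real t)) has_vector_derivative 0) (at 0)"
        by (simp add: dt)
      then show ?thesis using vector_derivative_unique_at[OF line[of u]] by blast
    qed
    moreover have "E B = 0"
    proof -
      \<comment> \<open>Along \<open>B\<close> the rows stay in the span of \<open>y\<close>, so the
        equations hold identically in \<open>z\<close>.\<close>
      have "poly (P (y + z *\<^sub>R B)) (of_real t) = 0" for z
      proof -
        have "vanishes T (y + z *\<^sub>R B)"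
        proof (rule vanishes_row_span[OF _ T])
          fix i assume i: "i \<in> R"
          have "z *\<^sub>R B $ i = complex_of_real z *s B $ i" by (simp add: vec_eq_iff scaleR_conv_of_real[where 'a = complex])
          then show "(y + z *\<^sub>R B) $ i \<in> row_span y"
            using i by (auto simp: B_def intro!: vec.span_add vec.span_scale vec.span_sum row_in_span)
        qed
        then show ?thesis using t by (simp add: vanishes_def)
      qed
      then have "((\<lambda>z::real. poly (P (y + z *\<^sub>R B)) (of_real t)) has_vector_derivative 0) (at 0)" by simp
      then show ?thesis using vector_derivative_unique_at[OF line[of B]] by blast
    qed
    moreover have "w = u - B" by (simp add: w_def B_def u_def vec_eq_iff)
    ultimately have "E w = 0" by (simp add: E.diff)
    then show "((\<lambda>z::real. poly (P (y + z *\<^sub>R w)) (of_real t)) has_vector_derivative 0) (at 0)"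
      using line[of w] by simp
  qed
  have "w = 0" using nd tanw critw by (simp add: nondegenerate_def)
  have u_span: "u $ i \<in> row_span y" if i: "i \<in> R" for i
  proof -
    have "u $ i = (\<Sum>l\<in>R. u $ i $ col (e l) *s y $ l)"
      using arg_cong[OF \<open>w = 0\<close>, of "\<lambda>m. m $ i"] i by (simp add: w_def)
    then show ?thesis by (metis (no_types, lifting) vec.span_sum vec.span_scale row_in_span)
  qed
  have A'A: "(\<Sum>i\<in>R. A' j i * A i l) = (if j = l then 1 else 0)" if "j \<in> R" "l \<in> R" for j l
  proof -
    have "x $ j $ col (e' l) = (\<Sum>i\<in>R. A' j i * A i l)"
      using arg_cong[OF xA'[OF that(1)], of "\<lambda>m. m $ col (e' l)"] by (simp add: A_def)
    then show ?thesis using x that by (simp add: chart_def)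
  qed
  have "v $ j = 0" for j
  proof (cases "j \<in> R")
    case True
    have "(\<Sum>i\<in>R. A' j i *s u $ i) = v $ j"
    proof -
      have "(\<Sum>i\<in>R. A' j i *s u $ i) $ b = v $ j $ b" for b
      proof -
        have "(\<Sum>i\<in>R. A' j i *s u $ i) $ b = (\<Sum>i\<in>R. \<Sum>l\<in>R. A' j i * A i l * v $ l $ b)"
          by (simp add: u_def sum_distrib_left mult.assoc)
        also have "\<dots> = (\<Sum>l\<in>R. (\<Sum>i\<in>R. A' j i * A i l) * v $ l $ b)"
          by (subst sum.swap) (simp add: sum_distrib_right)
        also have "\<dots> = (\<Sum>l\<in>R. if j = l then v $ l $ b else 0)"
          using A'A[OF True] by (intro sum.cong) auto
        finally show ?thesis using True by simp
      qed
      then show ?thesis by (simp add: vec_eq_iff)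
    qed
    moreover have "(\<Sum>i\<in>R. A' j i *s u $ i) \<in> row_span y"
      by (intro vec.span_sum vec.span_scale u_span)
    ultimately have "v $ j \<in> row_span x" using span by simp
    then have "v $ j = (\<Sum>l\<in>R. v $ j $ col (e' l) *s x $ l)"
      using x by (intro span_coords[where c = "\<lambda>l. col (e' l)"]) (auto simp: chart_def)
    then show ?thesis using tan True by (simp add: tangent_def)
  qed (use tan in \<open>auto simp: tangent_def\<close>)
  then show "v = 0" by (simp add: vec_eq_iff)
qed

lemma lc_not_inj:
  assumes "\<not> inj_on \<delta> R" "\<And>i. \<delta> i < CARD('n)"
  shows "lc \<delta> = 0"
  unfolding lc_expand
proof (intro sum.neutral ballI)
  fix p :: "'n \<Rightarrow> 'n" assume "p \<in> {p. p permutes UNIV}"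
  then have "inj p" by (simp add: permutes_inj)
  have "\<not> (\<forall>i\<in>R. p i = col (\<delta> i))"
  proof
    assume a: "\<forall>i\<in>R. p i = col (\<delta> i)"
    have "inj_on \<delta> R"
    proof (rule inj_onI)
      fix i j assume "i \<in> R" "j \<in> R" "\<delta> i = \<delta> j"
      then have "p i = p j" using a by simp
      then show "i = j" using \<open>inj p\<close> by (simp add: injD)
    qed
    then show False using assms by simp
  qed
  then show "(if \<forall>i\<in>R. p i = col (\<delta> i) then cf p else 0) = 0" by auto
qed

definition lowerable :: "('n \<Rightarrow> nat) \<Rightarrow> 'n set" where
  "lowerable d = {i \<in> R. 0 < d i \<and> adm (d(i := d i - 1))}"

lemma adm_lowered:
  assumes d: "adm d" and i: "i \<in> R" "0 < d i" and inj: "inj_on (d(i := d i - 1)) R"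
  shows "adm (d(i := d i - 1))"
proof -
  let ?e = "d(i := d i - 1)"
  have "?e a < ?e b" if ab: "a \<in> R" "b \<in> R" "a < b" for a b
  proof -
    have "d a < d b" using adm_less_iff[OF d ab(1,2)] ab by simp
    then have "?e a \<le> ?e b" using ab by auto
    moreover have "?e a \<noteq> ?e b" using inj_onD[OF inj _ ab(1,2)] ab(3) by blast
    ultimately show ?thesis by simp
  qed
  moreover have "?e j < CARD('n)" for j using adm_less_card[OF d, of j] adm_less_card[OF d, of i] by auto
  ultimately show ?thesis unfolding adm_def strict_mono_on_def by blast
qed

text \<open>The vanishing top coefficient makes some row lose its leading entry, and the degree
  allows a total loss of only 1. So the coefficient at the lowered sum is nonzero: its factor
  \<open>lc\<close> forces distinct pivots, and its product factor gives the nonzero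
  entries.\<close>

lemma limit_degrees:
  assumes d: "adm d" and l: "le d l" and nz: "P l \<noteq> 0"
    and top: "coeff (P l) (sum d R) = 0" and sub: "sum d R \<le> degree (P l) + 1"
  obtains i where "i \<in> lowerable d" "\<And>j. j \<in> R \<Longrightarrow> l $ j $ col ((d(i := d i - 1)) j) \<noteq> 0"
proof -
  have "(\<Prod>i\<in>R. l $ i $ col (d i)) = 0"
    using coeff_P_top[OF l adm_less_card[OF d]] top adm_lc[OF d] by simp
  then obtain i where i: "i \<in> R" "l $ i $ col (d i) = 0" by auto
  have li: "l $ i $ b = 0" if "d i \<le> dg b" for b
  proof (cases "d i = dg b")
    case True
    then show ?thesis using i by simp
  next
    case False
    then show ?thesis using l i that by (simp add: le_def)
  qed
  have di: "0 < d i"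
  proof (rule ccontr)
    assume "\<not> 0 < d i"
    then have "l $ i = 0" using li by (simp add: vec_eq_iff)
    then have "(\<Prod>a\<in>R. l $ a $ p a) = 0" for p using i by (intro prod_zero) (auto intro!: bexI[of _ i])
    then have "P l = 0" unfolding poly_eq_iff coeff_P by (auto intro!: sum.neutral simp del: prod_zero_iff)
    then show False using nz by simp
  qed
  let ?e = "d(i := d i - 1)"
  have le: "le ?e l" using li l di by (auto simp: le_def)
  have e_lt: "?e j < CARD('n)" for j using adm_less_card[OF d, of j] adm_less_card[OF d, of i] by auto
  have sum_e: "sum ?e R + 1 = sum d R"
  proof -
    have "sum ?e (R - {i}) = sum d (R - {i})" by (intro sum.cong) auto
    then show ?thesis using i di by (simp add: sum.remove[of R i])
  qed
  have "degree (P l) = sum ?e R" using degree_P_le[OF le] sub sum_e by simp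
  then have "coeff (P l) (sum ?e R) \<noteq> 0" using nz by (metis leading_coeff_0_iff)
  then have "complex_of_real (lc ?e) * (\<Prod>j\<in>R. l $ j $ col (?e j)) \<noteq> 0"
    unfolding coeff_P_top[OF le e_lt] .
  then have ne: "lc ?e \<noteq> 0" "(\<Prod>j\<in>R. l $ j $ col (?e j)) \<noteq> 0"
    by (metis mult_zero_left of_real_0, metis mult_zero_right)
  then have "inj_on ?e R" using lc_not_inj[of ?e] e_lt by blast
  then have "i \<in> lowerable d" using adm_lowered[OF d i(1) di] i(1) di by (simp add: lowerable_def)
  then show thesis using that ne(2) by simp
qed

end

section \<open>Limits of solutions\<close>

context wronski_form
begin

lemma chart_limit:
  assumes y: "\<And>n. chart d e (y n)" and lim: "y \<longlonglongrightarrow> Y"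
  shows "chart d e Y"
proof -
  have const: "Y $ i $ b = c" if "\<And>n. y n $ i $ b = c" for i b c
    using tendsto_vec_nth[OF tendsto_vec_nth[OF lim], of i b] that by (simp add: LIMSEQ_const_iff)
  show ?thesis
    unfolding chart_def le_def
  proof (intro conjI ballI allI impI)
    show "Y $ i $ b = 0" if "i \<in> R" "d i < dg b" for i b
      using y that by (intro const) (auto simp: chart_def le_def)
    show "Y $ i $ col (e j) = (if i = j then 1 else 0)" if "i \<in> R" "j \<in> R" for i j
      using y that by (intro const) (auto simp: chart_def)
    show "Y $ i = 0" if "i \<notin> R" for i
      unfolding vec_eq_iff using y that by (intro allI, simp, intro const) (auto simp: chart_def)
  qed
qed

text \<open>Passing to the reciprocal polynomial before taking the limit turns the escaping root
  into the vanishing of the top coefficient.\<close>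

lemma limit_equations:
  assumes f: "f \<longlonglongrightarrow> F" and \<tau>: "\<tau> \<longlonglongrightarrow> 0" "\<And>n. \<tau> n \<noteq> 0"
    and le: "\<And>n. le d (f n)" and van: "\<And>n. vanishes (insert (1 / \<tau> n) T) (f n)"
  shows "vanishes T F" and "coeff (P F) (sum d R) = 0"
proof -
  show "vanishes T F"
    unfolding vanishes_def
  proof
    fix t assume t: "t \<in> T"
    have "isCont (\<lambda>x. poly (P x) (complex_of_real t)) F"
      using C1_continuous[OF C1_poly_P] by (simp add: continuous_on_eq_continuous_at)
    from isCont_tendsto_compose[OF this f]
    have "(\<lambda>n. poly (P (f n)) (complex_of_real t)) \<longlonglongrightarrow> poly (P F) (of_real t)" .
    then show "poly (P F) (of_real t) = 0"
      using van t by (simp add: vanishes_def LIMSEQ_const_iff)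
  qed
  have "Q (sum d R) (f n) (\<tau> n) = 0" for n
    using Q_eq[OF le \<tau>(2), of n n] van[of n] by (simp add: vanishes_def)
  moreover have "(\<lambda>n. Q (sum d R) (f n) (\<tau> n)) \<longlonglongrightarrow> Q (sum d R) F 0"
  proof -
    have "isCont (\<lambda>p. Q (sum d R) (fst p) (snd p)) (F, 0)"
      using C1_continuous[OF C1_Q] by (simp add: continuous_on_eq_continuous_at)
    from isCont_tendsto_compose[OF this tendsto_Pair[OF f \<tau>(1)]] show ?thesis by simp
  qed
  ultimately show "coeff (P F) (sum d R) = 0" by (simp add: LIMSEQ_const_iff Q_zero)
qed

lemma cell_lowered_of_chart:
  assumes d: "adm d" and i: "i \<in> lowerable d"
    and y: "chart d (d(i := d i - 1)) y" and top: "y $ i $ col (d i) = 0"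
  shows "cell (d(i := d i - 1)) y"
proof -
  have "le (d(i := d i - 1)) y"
    unfolding le_def
  proof (intro ballI allI impI)
    fix l b :: 'n assume l: "l \<in> R" and b: "(d(i := d i - 1)) l < dg b"
    show "y $ l $ b = 0"
    proof (cases "d l < dg b")
      case True
      then show ?thesis using y l by (auto simp: chart_def le_def)
    next
      case False
      then have "l = i" "dg b = d i" using b i by (auto simp: lowerable_def split: if_splits)
      then show ?thesis using top by (metis col_dg)
    qed
  qed
  then show ?thesis using y by (simp add: chart_def)
qed

lemma coeff_top_chart:
  assumes d: "adm d" and i: "i \<in> R" and y: "chart d (d(i := d i - 1)) y"
  shows "coeff (P y) (sum d R) = of_real (lc d) * y $ i $ col (d i)"
proof -
  have "(\<Prod>j\<in>R. y $ j $ col (d j)) = y $ i $ col (d i) * (\<Prod>j\<in>R - {i}. y $ j $ col (d j))"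
    using i by (simp add: prod.remove)
  also have "(\<Prod>j\<in>R - {i}. y $ j $ col (d j)) = 1"
  proof (rule prod.neutral, rule ballI)
    fix j assume j: "j \<in> R - {i}"
    then have "y $ j $ col ((d(i := d i - 1)) j) = 1"
      using y unfolding chart_def by (metis DiffD1)
    then show "y $ j $ col (d j) = 1" using j by simp
  qed
  finally show ?thesis
    using coeff_P_top[of d y] adm_less_card[OF d] y by (simp add: chart_def)
qed

lemma sum_lowered:
  fixes d :: "'n \<Rightarrow> nat"
  assumes "i \<in> R" "0 < d i"
  shows "sum (d(i := d i - 1)) R + 1 = sum d R"
proof -
  have "sum (d(i := d i - 1)) (R - {i}) = sum d (R - {i})" by (intro sum.cong) auto
  then show ?thesis using assms by (simp add: sum.remove[of R i])
qed

text \<open>The entries of the solutions may be unbounded, so compactness is applied to pivoted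
  bases of the same spans. Their limit shows which pivot drops; with that index the solutions are
  renormalised to a chart in which they themselves converge.\<close>

lemma eventually_near_limit:
  assumes d: "adm d" and T: "finite T" "0 \<notin> T" "q + card T + 1 = sum d R" and r: "r > 0"
  shows "\<forall>\<^sub>F \<tau> in at_right 0. \<forall>x. cell d x \<longrightarrow> vanishes (insert (1 / \<tau>) T) x \<longrightarrow>
    (\<exists>i\<in>lowerable d. x $ i $ col (d i - 1) \<noteq> 0 \<and>
      (\<exists>x'. cell (d(i := d i - 1)) x' \<and> vanishes T x' \<and> dist (pivot i (col (d i - 1)) x) x' < r))"
    (is "eventually ?good _")
proof (rule ccontr)
  assume "\<not> eventually ?good (at_right 0)"
  then have "\<exists>\<tau>>0. \<tau> < b \<and> \<not> ?good \<tau>" if "b > 0" for b :: real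
    using that eventually_at_right[of 0 1 ?good] by auto
  then have "\<exists>\<tau>>0. \<tau> < 1 / real (Suc n) \<and> \<not> ?good \<tau>" for n by simp
  then obtain \<tau> where \<tau>: "\<And>n. \<tau> n > 0" "\<And>n. \<tau> n < 1 / real (Suc n)" and bad: "\<And>n. \<not> ?good (\<tau> n)"
    by metis
  have \<tau>0: "\<tau> \<longlonglongrightarrow> 0"
  proof (rule tendsto_sandwich[OF _ _ tendsto_const LIMSEQ_Suc[OF lim_1_over_n]])
    show "\<forall>\<^sub>F n in sequentially. 0 \<le> \<tau> n" using \<tau>(1) by (simp add: less_imp_le)
    show "\<forall>\<^sub>F n in sequentially. \<tau> n \<le> 1 / real (Suc n)" using \<tau>(2) by (simp add: less_imp_le)
  qed
  have "\<exists>x. cell d x \<and> vanishes (insert (1 / \<tau> n) T) x \<and>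
    \<not> (\<exists>i\<in>lowerable d. x $ i $ col (d i - 1) \<noteq> 0 \<and>
      (\<exists>x'. cell (d(i := d i - 1)) x' \<and> vanishes T x' \<and> dist (pivot i (col (d i - 1)) x) x' < r))" for n
    using bad[of n] by blast
  then obtain x where x: "\<And>n. cell d (x n)" "\<And>n. vanishes (insert (1 / \<tau> n) T) (x n)"
    and xbad: "\<And>n i x'. i \<in> lowerable d \<Longrightarrow> x n $ i $ col (d i - 1) \<noteq> 0 \<Longrightarrow> cell (d(i := d i - 1)) x' \<Longrightarrow>
      vanishes T x' \<Longrightarrow> \<not> dist (pivot i (col (d i - 1)) (x n)) x' < r"
    by metis
  have lex: "le d (x n)" for n using x(1)[of n] by (simp add: chart_def)
  have "\<exists>f \<alpha>. f \<in> pivoted d \<alpha> \<and> (\<forall>j\<in>R. f $ j \<in> vec.span (($) (x n) ` {i\<in>R. i \<le> j}))" for n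
    using ex_pivoted[OF d x(1)[of n]] by metis
  then obtain f \<alpha> where f: "\<And>n. f n \<in> pivoted d (\<alpha> n)"
    and fspan: "\<And>n j. j \<in> R \<Longrightarrow> f n $ j \<in> vec.span (($) (x n) ` {i\<in>R. i \<le> j})"
    by metis
  have fx: "f n $ j \<in> row_span (x n)" if "j \<in> R" for n j
    using span_image_mono[OF fspan[OF that]] by auto
  have fvan: "vanishes (insert (1 / \<tau> n) T) (f n)" for n
    by (rule vanishes_row_span[OF fx x(2)])
  have fle: "le d (f n)" for n using f[of n] by (simp add: pivoted_def)
  have "compact (\<Union>\<alpha>. pivoted d \<alpha>)" by (intro compact_UN compact_pivoted) simp
  then obtain l \<rho> where l: "l \<in> (\<Union>\<alpha>. pivoted d \<alpha>)" and \<rho>: "strict_mono \<rho>" and lim: "(f \<circ> \<rho>) \<longlonglongrightarrow> l"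
    using f unfolding compact_def by (metis UN_I UNIV_I)
  have \<tau>\<rho>: "(\<tau> \<circ> \<rho>) \<longlonglongrightarrow> 0" by (rule LIMSEQ_subseq_LIMSEQ[OF \<tau>0 \<rho>])
  obtain \<beta> where l\<beta>: "l \<in> pivoted d \<beta>" using l by auto
  have lle: "le d l" using l\<beta> by (simp add: pivoted_def)
  have lnz: "P l \<noteq> 0" by (rule P_pivoted_nonzero[OF l\<beta>])
  have "vanishes T l" and ltop: "coeff (P l) (sum d R) = 0"
    using limit_equations[OF lim \<tau>\<rho>, of d T] fle fvan \<tau>(1) by (auto simp: less_imp_neq[symmetric])
  then have "q + card T \<le> degree (P l)"
    using degree_P_ge[OF lnz T(1,2)] by (simp add: vanishes_def)
  then obtain i where i: "i \<in> lowerable d" and li: "\<And>j. j \<in> R \<Longrightarrow> l $ j $ col ((d(i := d i - 1)) j) \<noteq> 0"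
    using limit_degrees[OF d lle lnz ltop] T(3) by (metis add_le_cancel_right)
  define e where "e = d(i := d i - 1)"
  have iR: "i \<in> R" "0 < d i" and e: "adm e" using i by (auto simp: lowerable_def e_def)
  have ei: "e i = d i - 1" by (simp add: e_def)
  have le_iff: "e l \<le> d j \<longleftrightarrow> l \<le> j" if "l \<in> R" "j \<in> R" for l j
    using lowered_le_iff[OF d iR e[unfolded e_def] that] by (simp add: e_def)
  have "(\<lambda>n. (f \<circ> \<rho>) n $ i $ col (e i)) \<longlonglongrightarrow> l $ i $ col (e i)"
    by (intro tendsto_vec_nth lim)
  then have "\<forall>\<^sub>F n in sequentially. (f \<circ> \<rho>) n $ i $ col (e i) \<noteq> 0"
    by (rule tendsto_imp_eventually_ne) (use li[OF iR(1)] in \<open>simp add: e_def\<close>)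
  then obtain N where N: "\<And>n. n \<ge> N \<Longrightarrow> f (\<rho> n) $ i $ col (e i) \<noteq> 0"
    by (auto simp: eventually_sequentially)
  define \<sigma> where "\<sigma> n = \<rho> (n + N)" for n
  have flim: "(\<lambda>n. f (\<sigma> n)) \<longlonglongrightarrow> l" and \<tau>\<sigma>: "(\<lambda>n. \<tau> (\<sigma> n)) \<longlonglongrightarrow> 0"
    using LIMSEQ_ignore_initial_segment[OF lim, of N] LIMSEQ_ignore_initial_segment[OF \<tau>\<rho>, of N]
    by (simp_all add: \<sigma>_def)
  \<comment> \<open>Row \<open>i\<close> of \<open>f\<close> combines rows of \<open>x\<close> up to
    \<open>i\<close>, and those before \<open>i\<close> have degree below \<open>e i\<close>. A zero
    here would therefore pass to \<open>f\<close>, whose entry is nonzero from \<open>N\<close>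
    on.\<close>
  have xi: "x (\<sigma> n) $ i $ col (e i) \<noteq> 0" for n
  proof
    assume z: "x (\<sigma> n) $ i $ col (e i) = 0"
    obtain a where a: "f (\<sigma> n) $ i = (\<Sum>j\<in>{j\<in>R. j \<le> i}. a j *s x (\<sigma> n) $ j)"
      by (rule span_imageE[OF finite fspan[OF iR(1), of "\<sigma> n"]])
    have "x (\<sigma> n) $ j $ col (e i) = 0" if "j \<in> R" "j \<le> i" for j
    proof (cases "j = i")
      case False
      then have "d j < e i" using le_iff[OF iR(1) that(1)] that(2) by (simp flip: not_le)
      then show ?thesis using lex[of "\<sigma> n"] that e by (simp add: le_def adm_less_card)
    qed (use z in simp)
    then have "f (\<sigma> n) $ i $ col (e i) = 0" by (simp add: a)
    then show False using N[of "n + N"] by (simp add: \<sigma>_def)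
  qed
  define y where "y n = pivot i (col (e i)) (x (\<sigma> n))" for n
  have ych: "chart d e (y n)" for n
    unfolding y_def
  proof (rule chart_pivot[OF d, where e = d])
    show "chart d d (x (\<sigma> n))" using x(1) by simp
    show "d j < e i" if "j \<in> R" "j < i" for j
      using le_iff[OF iR(1) that(1)] that(2) by (simp flip: not_le)
    show "e i < CARD('n)" by (rule adm_less_card[OF e])
  qed (use xi iR in \<open>auto simp: e_def\<close>)
  have yspan: "row_span (y n) = row_span (x (\<sigma> n))" for n
    unfolding y_def by (rule row_span_pivot[OF iR(1) xi])
  have "convergent y"
  proof (rule normalised_convergent[OF flim, of "\<lambda>j. col (e j)"])
    show "l $ j $ col (e j) \<noteq> 0" if "j \<in> R" for j using li[OF that] by (simp add: e_def)
    show "f (\<sigma> n) $ j = (\<Sum>m\<in>R. f (\<sigma> n) $ j $ col (e m) *s y n $ m)" if "j \<in> R" for n j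
      using ych[of n] fx[OF that, of "\<sigma> n"] yspan[of n]
      by (intro span_coords[where c = "\<lambda>j. col (e j)"]) (auto simp: chart_def)
    show "f (\<sigma> n) $ j $ col (e m) = 0" if "m \<in> R" "j \<in> R" "j < m" for n m j
    proof -
      have "d j < e m" using le_iff[OF that(1,2)] that(3) by (simp flip: not_le)
      then show ?thesis using fle[of "\<sigma> n"] that e by (simp add: le_def adm_less_card)
    qed
    show "y n $ m = 0" if "m \<notin> R" for n m using ych[of n] that by (simp add: chart_def)
  qed
  then obtain Y where Y: "y \<longlonglongrightarrow> Y" by (auto simp: convergent_def)
  have Ych: "chart d e Y" by (rule chart_limit[OF ych Y])
  have yvan: "vanishes (insert (1 / \<tau> (\<sigma> n)) T) (y n)" for n
    by (rule vanishes_row_span[OF _ x(2)]) (metis yspan row_in_span)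
  have "vanishes T Y" "coeff (P Y) (sum d R) = 0"
    using limit_equations[OF Y \<tau>\<sigma>, of d T] yvan ych \<tau>(1) by (auto simp: chart_def less_imp_neq[symmetric])
  \<comment> \<open>In this chart the top coefficient is a nonzero multiple of the entry at the old
    pivot, so its vanishing puts the limit into the smaller cell.\<close>
  moreover from this(2) have "cell e Y"
    unfolding e_def using coeff_top_chart[OF d iR(1), of Y] adm_lc[OF d] Ych
    by (intro cell_lowered_of_chart[OF d i]) (auto simp: e_def)
  moreover have "\<exists>n. dist (y n) Y < r"
    using Y r unfolding LIMSEQ_def by blast
  ultimately show False
    using xbad[OF i, of "\<sigma> _" Y] xi unfolding y_def e_def fun_upd_same by blast
qed

end

section \<open>Counting solutions\<close>

text \<open>Hence lowerings that make two pivots collide contribute nothing to the branching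
  sum.\<close>

lemma diff_prod_not_inj:
  fixes R :: "'a::linorder set"
  assumes "finite R" "\<not> inj_on d R"
  shows "diff_prod R d = 0"
proof -
  obtain a b where ab: "a \<in> R" "b \<in> R" "a \<noteq> b" "d a = d b" using assms(2) by (auto simp: inj_on_def)
  have "\<exists>p\<in>{p \<in> R \<times> R. fst p < snd p}. d (snd p) - d (fst p) = 0"
  proof (cases "a < b")
    case True
    then show ?thesis using ab by (intro bexI[of _ "(a, b)"]) auto
  next
    case False
    then show ?thesis using ab by (intro bexI[of _ "(b, a)"]) auto
  qed
  then show ?thesis unfolding diff_prod_def using assms(1) by (intro prod_zero) auto
qed

context wronski_form
begin

definition Sol :: "('n \<Rightarrow> nat) \<Rightarrow> real set \<Rightarrow> 'n cmat set" where
  "Sol d T = {x. cell d x \<and> vanishes T x}"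

text \<open>The induction invariant. The middle clause is Frobenius' formula with denominators
  cleared; nondegeneracy and reality are what the next continuation consumes.\<close>

definition good :: "('n \<Rightarrow> nat) \<Rightarrow> real set \<Rightarrow> bool" where
  "good d T \<longleftrightarrow> finite (Sol d T)
     \<and> real (card (Sol d T)) * (\<Prod>i\<in>R. fact (d i)) = fact (card T) * diff_prod R (\<lambda>i. real (d i))
     \<and> (\<forall>x\<in>Sol d T. nondegenerate d d T x \<and> cnj_mat x = x)"

lemma cnj_mat_pivot: "cnj_mat (pivot i c y) = pivot i c (cnj_mat y)"
  by (simp add: cnj_mat_def pivot_def vec_eq_iff)

lemma norm_entry_le: "norm (x $ i $ b) \<le> norm (x :: 'n cmat)"
  using Finite_Cartesian_Product.norm_nth_le[of "x $ i" b] Finite_Cartesian_Product.norm_nth_le[of x i] by linarith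

lemma real_q: "real q = real (card R * (card R - 1)) / 2"
proof -
  have "2 * \<Sum>{..<k} = k * (k - 1)" by (induction k) (auto simp: algebra_simps diff_mult_distrib2)
  then have "2 * real q = real (k * (k - 1))" unfolding q_eq by (metis of_nat_mult of_nat_numeral)
  then show ?thesis by (simp add: card_R)
qed

lemma count_step:
  assumes d: "adm d" and sum_d: "q + m + 1 = sum d R"
    and N: "\<And>i. i \<in> lowerable d \<Longrightarrow> real (N i) * (\<Prod>j\<in>R. fact ((d(i := d i - 1)) j))
        = fact m * diff_prod R (\<lambda>j. real ((d(i := d i - 1)) j))"
  shows "real (\<Sum>i\<in>lowerable d. N i) * (\<Prod>j\<in>R. fact (d j)) = fact (m + 1) * diff_prod R (\<lambda>j. real (d j))"
proof -
  let ?D = "\<lambda>j. real (d j)"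
  have shift: "(\<lambda>j. real ((d(i := d i - 1)) j)) = ?D(i := ?D i - 1)" if "0 < d i" for i
    using that by (auto simp: fun_eq_iff of_nat_diff)
  have summand: "real (N i) * (\<Prod>j\<in>R. fact (d j)) = fact m * (?D i * diff_prod R (?D(i := ?D i - 1)))"
    if i: "i \<in> lowerable d" for i
  proof -
    have i': "i \<in> R" "0 < d i" using i by (auto simp: lowerable_def)
    have "(\<Prod>j\<in>R - {i}. fact ((d(i := d i - 1)) j)) = (\<Prod>j\<in>R - {i}. fact (d j) :: real)"
      by (intro prod.cong) auto
    moreover have "(fact (d i) :: real) = real (d i) * fact (d i - 1)" using i'(2) by (simp add: fact_reduce)
    ultimately have pr: "(\<Prod>j\<in>R. fact (d j)) = real (d i) * (\<Prod>j\<in>R. fact ((d(i := d i - 1)) j))"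
      using i'(1) by (simp add: prod.remove[of R i])
    show ?thesis
      unfolding pr using N[OF i, unfolded shift[OF i'(2)]] by (simp del: fun_upd_apply add: algebra_simps)
  qed
  have "real (\<Sum>i\<in>lowerable d. N i) * (\<Prod>j\<in>R. fact (d j))
      = (\<Sum>i\<in>lowerable d. fact m * (?D i * diff_prod R (?D(i := ?D i - 1))))"
    unfolding of_nat_sum sum_distrib_right by (intro sum.cong refl summand)
  \<comment> \<open>The added indices contribute 0: if \<open>d i = 0\<close>, the weight vanishes
    and truncated subtraction does no harm; otherwise the lowered pivots collide.\<close>
  also have "\<dots> = (\<Sum>i\<in>R. fact m * (?D i * diff_prod R (?D(i := ?D i - 1))))"
  proof (rule sum.mono_neutral_left)
    show "\<forall>i\<in>R - lowerable d. fact m * (?D i * diff_prod R (?D(i := ?D i - 1))) = 0"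
    proof
      fix i assume i: "i \<in> R - lowerable d"
      show "fact m * (?D i * diff_prod R (?D(i := ?D i - 1))) = 0"
      proof (cases "d i = 0")
        case False
        then have "\<not> inj_on (d(i := d i - 1)) R"
          using i adm_lowered[OF d, of i] by (auto simp: lowerable_def)
        then have "\<not> inj_on (\<lambda>j. real ((d(i := d i - 1)) j)) R" by (simp add: inj_on_def)
        then have "diff_prod R (?D(i := ?D i - 1)) = 0"
          using False diff_prod_not_inj[of R] shift[of i] by simp
        then show ?thesis by simp
      qed simp
    qed
  qed (auto simp: lowerable_def)
  also have "\<dots> = fact m * (diff_prod R ?D * (sum ?D R - real (card R * (card R - 1)) / 2))"
    using diff_prod_branching[of R ?D] adm_inj[OF d] by (simp add: sum_distrib_left[symmetric] inj_on_def)
  also have "sum ?D R - real (card R * (card R - 1)) / 2 = real (m + 1)"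
    using arg_cong[OF sum_d, of real] real_q by simp
  finally show ?thesis by (simp add: algebra_simps)
qed

text \<open>Continuing each solution of each lowered cell and renormalising it to the cell of
  \<open>d\<close> is a bijection for small \<tau>. Surjectivity is the compactness statement,
  injectivity for one \<open>i\<close> comes from disjoint balls, and different \<open>i\<close> are
  separated by the size of an entry.\<close>

lemma good_step:
  assumes d: "adm d" and T: "finite T" "0 \<notin> T" and sum_d: "q + card T + 1 = sum d R"
    and IH: "\<And>i. i \<in> lowerable d \<Longrightarrow> good (d(i := d i - 1)) T"
  shows "\<forall>\<^sub>F \<tau> in at_right 0. good d (insert (1 / \<tau>) T)"
proof -
  define L where "L i = d(i := d i - 1)" for i
  define S where "S i = Sol (L i) T" for i
  let ?I = "lowerable d"
  have I: "i \<in> R" "0 < d i" "adm (L i)" if "i \<in> ?I" for i using that by (auto simp: lowerable_def L_def)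
  have sum_L: "q + card T = sum (L i) R" if "i \<in> ?I" for i
    using sum_lowered[of i d, OF I(1,2)[OF that]] sum_d by (simp add: L_def)
  have le_iff: "L i l \<le> d j \<longleftrightarrow> l \<le> j" if "i \<in> ?I" "l \<in> R" "j \<in> R" for i l j
    using lowered_le_iff[OF d I(1,2)[OF that(1)] I(3)[OF that(1), unfolded L_def] that(2,3)] by (simp add: L_def)
  have finS: "finite (S i)" if "i \<in> ?I" for i using IH[OF that] by (simp add: good_def S_def L_def)
  have finI: "finite ?I" by simp
  define loc where "loc i x r = (\<lambda>\<tau>. \<exists>y. chart d (L i) y \<and> vanishes (insert (1 / \<tau>) T) y \<and> dist y x < r \<and>
       nondegenerate d (L i) (insert (1 / \<tau>) T) y \<and> cnj_mat y = y \<and>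
       (\<forall>y'. chart d (L i) y' \<longrightarrow> vanishes (insert (1 / \<tau>) T) y' \<longrightarrow> dist y' x < r \<longrightarrow> y' = y))"
    for i x r
  have ex_loc: "\<exists>s>0. \<forall>r. 0 < r \<longrightarrow> r \<le> s \<longrightarrow> (\<forall>\<^sub>F \<tau> in at_right 0. loc i x r \<tau>)"
    if i: "i \<in> ?I" and x: "x \<in> S i" for i x
  proof -
    have x': "cell (L i) x" "vanishes T x" "nondegenerate (L i) (L i) T x" "cnj_mat x = x"
      using x IH[OF i] by (auto simp: S_def Sol_def good_def L_def)
    obtain s where "s > 0" "\<And>r. 0 < r \<Longrightarrow> r \<le> s \<Longrightarrow> \<forall>\<^sub>F \<tau> in at_right 0. loc i x r \<tau>"
      by (rule local_solutions[OF d I(1,2)[OF i] L_def I(3)[OF i] T(1) sum_L[OF i] x', folded loc_def])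
        (rule that)
    then show ?thesis by blast
  qed
  define r0 where "r0 i x = (SOME s. 0 < s \<and> (\<forall>r. 0 < r \<longrightarrow> r \<le> s \<longrightarrow> (\<forall>\<^sub>F \<tau> in at_right 0. loc i x r \<tau>)))"
    for i x
  have r0: "0 < r0 i x" "\<forall>r. 0 < r \<longrightarrow> r \<le> r0 i x \<longrightarrow> (\<forall>\<^sub>F \<tau> in at_right 0. loc i x r \<tau>)"
    if "i \<in> ?I" "x \<in> S i" for i x
    using someI_ex[OF ex_loc[OF that]] unfolding r0_def by simp_all
  \<comment> \<open>The radius has three duties: local uniqueness (\<open>r0\<close>), disjoint
    balls for one \<open>i\<close> (half the distances), and separation of different
    \<open>i\<close> (the bound \<open>1 / (norm x + 1)\<close>).\<close>
  have "\<forall>\<^sub>F r in at_right 0. 0 < r \<and> r < 1 \<and> (\<forall>i\<in>?I. \<forall>x\<in>S i. r < r0 i x \<and> r < 1 / (norm x + 1) \<and>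
      (\<forall>x'\<in>S i. x \<noteq> x' \<longrightarrow> r < dist x x' / 2))"
  proof -
    have pos: "\<forall>\<^sub>F r in at_right 0. r < c" if "c > 0" for c :: real
      using eventually_at_right_real[OF that] by eventually_elim simp
    have "\<forall>\<^sub>F r in at_right 0. r < r0 i x \<and> r < 1 / (norm x + 1) \<and> (\<forall>x'\<in>S i. x \<noteq> x' \<longrightarrow> r < dist x x' / 2)"
      if "i \<in> ?I" "x \<in> S i" for i x
    proof (intro eventually_conj eventually_ball_finite ballI)
      show "\<forall>\<^sub>F r in at_right 0. r < r0 i x" using r0(1)[OF that] by (rule pos)
      show "\<forall>\<^sub>F r in at_right 0. r < 1 / (norm x + 1)" by (rule pos) (simp add: add_nonneg_pos)
      show "finite (S i)" by (rule finS[OF that(1)])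
      show "\<forall>\<^sub>F r in at_right 0. x \<noteq> x' \<longrightarrow> r < dist x x' / 2" if "x' \<in> S i" for x'
        using pos[of "dist x x' / 2"] by (cases "x = x'") simp_all
    qed
    then have "\<forall>\<^sub>F r in at_right 0. \<forall>i\<in>?I. \<forall>x\<in>S i. r < r0 i x \<and> r < 1 / (norm x + 1) \<and>
      (\<forall>x'\<in>S i. x \<noteq> x' \<longrightarrow> r < dist x x' / 2)"
      using finS finI by (intro eventually_ball_finite ballI) auto
    moreover have "\<forall>\<^sub>F r in at_right (0::real). 0 < r \<and> r < 1"
      using eventually_at_right_real[of 0 1] by (simp add: greaterThanLessThan_iff)
    ultimately show ?thesis by eventually_elim auto
  qed
  then obtain r where r: "0 < r" "r < 1"
    and rr: "\<And>i x. i \<in> ?I \<Longrightarrow> x \<in> S i \<Longrightarrow> r < r0 i x"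
      "\<And>i x. i \<in> ?I \<Longrightarrow> x \<in> S i \<Longrightarrow> r < 1 / (norm x + 1)"
      "\<And>i x x'. i \<in> ?I \<Longrightarrow> x \<in> S i \<Longrightarrow> x' \<in> S i \<Longrightarrow> x \<noteq> x' \<Longrightarrow> r < dist x x' / 2"
    using eventually_happens'[OF trivial_limit_at_right_real] by blast
  have ev1: "\<forall>\<^sub>F \<tau> in at_right 0. \<forall>i\<in>?I. \<forall>x\<in>S i. loc i x r \<tau>"
    using finS finI r0(2) r(1) rr(1) by (intro eventually_ball_finite ballI) (auto simp: less_imp_le)
  have ev2: "\<forall>\<^sub>F \<tau> in at_right 0. \<tau> \<noteq> 0 \<and> 1 / \<tau> \<notin> T"
  proof -
    have "\<forall>\<^sub>F \<tau> in at_right 0. \<tau> \<noteq> 1 / t" if "t \<in> T" for t :: real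
    proof (cases "t > 0")
      case True
      then show ?thesis using eventually_at_right_real[of 0 "1 / t"] by (auto elim: eventually_mono)
    next
      case False
      then have "1 / t \<le> 0" by (simp add: divide_nonneg_nonpos)
      then show ?thesis using eventually_at_right_less[of "0::real"] by (auto elim: eventually_mono)
    qed
    then have "\<forall>\<^sub>F \<tau> in at_right 0. \<forall>t\<in>T. \<tau> \<noteq> 1 / t" using T(1) by (intro eventually_ball_finite) auto
    then show ?thesis using eventually_at_right_less[of "0::real"]
      by eventually_elim auto
  qed
  from ev1 ev2 eventually_near_limit[OF d T sum_d r(1)]
  show ?thesis
  proof eventually_elim
    case (elim \<tau>)
    define T' where "T' = insert (1 / \<tau>) T"
    have T': "finite T'" "0 \<notin> T'" "card T' = card T + 1" using T elim by (auto simp: T'_def)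
    define y where "y i x = (SOME y. chart d (L i) y \<and> vanishes T' y \<and> dist y x < r \<and>
       nondegenerate d (L i) T' y \<and> cnj_mat y = y \<and>
       (\<forall>y'. chart d (L i) y' \<longrightarrow> vanishes T' y' \<longrightarrow> dist y' x < r \<longrightarrow> y' = y))" for i x
    have y: "chart d (L i) (y i x) \<and> vanishes T' (y i x) \<and> dist (y i x) x < r \<and>
       nondegenerate d (L i) T' (y i x) \<and> cnj_mat (y i x) = y i x \<and>
       (\<forall>y'. chart d (L i) y' \<longrightarrow> vanishes T' y' \<longrightarrow> dist y' x < r \<longrightarrow> y' = y i x)"
      if "i \<in> ?I" "x \<in> S i" for i x
    proof -
      have "loc i x r \<tau>" using elim(1) that by blast
      then show ?thesis unfolding y_def loc_def T'_def by (rule someI_ex)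
    qed
    have ych: "chart d (L i) (y i x)" and yv: "vanishes T' (y i x)" and yd: "dist (y i x) x < r"
      and ynd: "nondegenerate d (L i) T' (y i x)" and yreal: "cnj_mat (y i x) = y i x"
      if "i \<in> ?I" "x \<in> S i" for i x
      using y[OF that] by blast+
    have yuniq: "y' = y i x"
      if "i \<in> ?I" "x \<in> S i" "chart d (L i) y'" "vanishes T' y'" "dist y' x < r" for i x y'
      using y[OF that(1,2)] that(3-5) by blast
    define z where "z i x = pivot i (col (d i)) (y i x)" for i x
    \<comment> \<open>If this entry were 0, \<open>y i x\<close> would lie in the smaller cell,
      where the degree of the Wronskian leaves no room for \<open>card T + 1\<close> nonzero
      roots.\<close>
    have y0: "y i x $ i $ col (d i) \<noteq> 0" if ix: "i \<in> ?I" "x \<in> S i" for i x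
    proof
      assume "y i x $ i $ col (d i) = 0"
      then have cell: "cell (L i) (y i x)"
        unfolding L_def using ych[OF ix] by (intro cell_lowered_of_chart[OF d ix(1)]) (simp_all add: L_def)
      have "degree (P (y i x)) \<le> q + card T"
        using degree_P_le[of "L i" "y i x"] cell sum_L[OF ix(1)] by (simp add: chart_def)
      moreover have "q + card T' \<le> degree (P (y i x))"
        using yv[OF ix] by (intro degree_P_ge[OF P_cell_nonzero[OF I(3)[OF ix(1)] cell] T'(1,2)]) (simp add: vanishes_def)
      ultimately show False using T'(3) by simp
    qed
    have y_small: "norm (y i x $ i $ col (d i)) < r" if ix: "i \<in> ?I" "x \<in> S i" for i x
    proof -
      have "x $ i $ col (d i) = 0"
        using ix I[OF ix(1)] d by (auto simp: S_def Sol_def chart_def le_def L_def adm_less_card)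
      then have "norm (y i x $ i $ col (d i)) \<le> norm (y i x - x)"
        using norm_entry_le[of "y i x - x" i "col (d i)"] by simp
      then show ?thesis using yd[OF ix] by (simp add: dist_norm)
    qed
    have zspan: "row_span (z i x) = row_span (y i x)" if ix: "i \<in> ?I" "x \<in> S i" for i x
      unfolding z_def by (rule row_span_pivot[OF I(1)[OF ix(1)] y0[OF ix]])
    have zcell: "cell d (z i x)" if ix: "i \<in> ?I" "x \<in> S i" for i x
      unfolding z_def
    proof (rule chart_pivot[OF d ych[OF ix] I(1)[OF ix(1)]])
      show "d j < d i" if "j \<in> R" "j < i" for j
        using adm_less_iff[OF d that(1) I(1)[OF ix(1)]] that(2) by simp
    qed (use y0[OF ix] adm_less_card[OF d] in \<open>auto simp: L_def\<close>)
    have zv: "vanishes T' (z i x)" if ix: "i \<in> ?I" "x \<in> S i" for i x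
      by (rule vanishes_row_span[OF _ yv[OF ix]]) (metis zspan[OF ix] row_in_span)
    have z_sol: "z i x \<in> Sol d T'" if "i \<in> ?I" "x \<in> S i" for i x
      using zcell zv that by (simp add: Sol_def)
    have z_nd: "nondegenerate d d T' (z i x)" if ix: "i \<in> ?I" "x \<in> S i" for i x
    proof (rule nondegenerate_change_chart[OF d _ ych[OF ix] zspan[OF ix] le_iff[OF ix(1)] _ _ _ yv[OF ix] ynd[OF ix]])
      show "chart d d (z i x)" using zcell[OF ix] by simp
      show "d l \<le> d j \<longleftrightarrow> l \<le> j" if "l \<in> R" "j \<in> R" for l j
        using adm_less_iff[OF d that(2,1)] by (simp flip: not_less)
    qed (use adm_less_card[OF d] adm_less_card[OF I(3)[OF ix(1)]] in auto)
    have z_real: "cnj_mat (z i x) = z i x" if ix: "i \<in> ?I" "x \<in> S i" for i x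
      by (simp add: z_def cnj_mat_pivot yreal[OF ix])
    have surj: "w \<in> (\<Union>i\<in>?I. z i ` S i)" if w: "w \<in> Sol d T'" for w
    proof -
      have wc: "cell d w" "vanishes T' w" using w by (auto simp: Sol_def)
      then obtain i x where i: "i \<in> ?I" and wi: "w $ i $ col (d i - 1) \<noteq> 0"
        and x: "cell (d(i := d i - 1)) x" "vanishes T x" "dist (pivot i (col (d i - 1)) w) x < r"
        using elim(3) unfolding T'_def by blast
      have xS: "x \<in> S i" using x by (simp add: S_def Sol_def L_def)
      let ?y = "pivot i (col (d i - 1)) w"
      have "chart d (L i) (pivot i (col (L i i)) w)"
      proof (rule chart_pivot[OF d _ I(1)[OF i], of d])
        show "chart d d w" using wc by simp
        show "d j < L i i" if "j \<in> R" "j < i" for j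
          using le_iff[OF i I(1)[OF i] that(1)] that(2) by (simp flip: not_le)
        show "L i i < CARD('n)" by (rule adm_less_card[OF I(3)[OF i]])
      qed (use wi in \<open>auto simp: L_def\<close>)
      then have ch: "chart d (L i) ?y" by (simp add: L_def)
      have span: "row_span ?y = row_span w" by (rule row_span_pivot[OF I(1)[OF i] wi])
      have "vanishes T' ?y"
        by (rule vanishes_row_span[OF _ wc(2)]) (metis span row_in_span)
      then have "?y = y i x" by (rule yuniq[OF i xS ch _ x(3)])
      then have "row_span (z i x) = row_span w" using zspan[OF i xS] span by simp
      then have "z i x = w" by (rule chart_row_span_inj[OF zcell[OF i xS] wc(1)])
      then show ?thesis using i xS by blast
    qed
    have inj: "inj_on (z i) (S i)" if i: "i \<in> ?I" for i
    proof (rule inj_onI, rule ccontr)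
      fix x x' assume x: "x \<in> S i" "x' \<in> S i" "z i x = z i x'" "x \<noteq> x'"
      then have "row_span (y i x) = row_span (y i x')" using zspan[OF i] by metis
      then have "y i x = y i x'" by (rule chart_row_span_inj[OF ych[OF i x(1)] ych[OF i x(2)]])
      then have "dist x x' < 2 * r" using yd[OF i x(1)] yd[OF i x(2)] dist_triangle[of x x' "y i x"]
        by (simp add: dist_commute)
      then show False using rr(3)[OF i x(1,2,4)] by simp
    qed
    \<comment> \<open>The entry in row \<open>i\<close> and column \<open>col (d i - 1)\<close>
      tells the families apart: in \<open>z i x\<close> it is the reciprocal of a number of norm
      below \<open>r\<close>, while in \<open>z l x'\<close> its norm is at most
      \<open>norm x' + 1\<close>, less than \<open>1 / r\<close>.\<close>
    have disj: "z i ` S i \<inter> z l ` S l = {}" if i: "i \<in> ?I" and l: "l \<in> ?I" and il: "i \<noteq> l" for i l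
    proof (rule ccontr)
      assume "z i ` S i \<inter> z l ` S l \<noteq> {}"
      then obtain x x' where x: "x \<in> S i" "x' \<in> S l" "z i x = z l x'" by auto
      let ?c = "col (d i - 1) :: 'n"
      have "y i x $ i $ col (L i i) = 1"
        using ych[OF i x(1)] I(1)[OF i] by (simp add: chart_def)
      then have "z i x $ i $ ?c = 1 / y i x $ i $ col (d i)"
        by (simp add: z_def pivot_def L_def)
      moreover have "z l x' $ i $ ?c = y l x' $ i $ ?c"
      proof -
        have "y l x' $ i $ col (d l) = 0 \<or> y l x' $ l $ ?c = 0"
        proof (cases "i < l")
          case True
          then have "d i < dg (col (d l) :: 'n)" using adm_less_iff[OF d I(1)[OF i] I(1)[OF l]] d by (simp add: adm_less_card)
          then show ?thesis using ych[OF l x(2)] I[OF i] by (simp add: chart_def le_def)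
        next
          case False
          then have "d l < L i i" using le_iff[OF i I(1)[OF i] I(1)[OF l]] il by (simp flip: not_le)
          then have "d l < dg ?c" using adm_less_card[OF I(3)[OF i], of i] by (simp add: L_def)
          then show ?thesis using ych[OF l x(2)] I[OF l] by (simp add: chart_def le_def)
        qed
        then show ?thesis using il I[OF i] by (auto simp: z_def pivot_def)
      qed
      ultimately have eq: "1 / y i x $ i $ col (d i) = y l x' $ i $ ?c" using x(3) by simp
      have "norm (y l x' $ i $ ?c) \<le> norm x' + 1"
        using norm_entry_le[of "y l x'" i ?c] norm_triangle_sub[of "y l x'" x'] yd[OF l x(2)] r(2)
        by (simp add: dist_norm)
      then have "1 / norm (y i x $ i $ col (d i)) \<le> norm x' + 1"
        using arg_cong[OF eq, of norm] by (simp add: norm_divide)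
      then have "1 \<le> (norm x' + 1) * norm (y i x $ i $ col (d i))"
        using y0[OF i x(1)] by (simp add: divide_le_eq)
      also have "\<dots> \<le> (norm x' + 1) * r" using y_small[OF i x(1)] by (intro mult_left_mono) auto
      also have "\<dots> < 1" using rr(2)[OF l x(2)] by (simp add: less_divide_eq add_nonneg_pos mult.commute)
      finally show False by simp
    qed
    have Sol_eq: "Sol d T' = (\<Union>i\<in>?I. z i ` S i)" using surj z_sol by auto
    have "finite (Sol d T')" unfolding Sol_eq using finS by simp
    moreover have "card (Sol d T') = (\<Sum>i\<in>?I. card (S i))"
    proof -
      have "card (Sol d T') = (\<Sum>i\<in>?I. card (z i ` S i))"
        unfolding Sol_eq using finS disj by (intro card_UN_disjoint) auto
      also have "\<dots> = (\<Sum>i\<in>?I. card (S i))" by (intro sum.cong refl card_image inj)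
      finally show ?thesis .
    qed
    moreover have "real (\<Sum>i\<in>?I. card (S i)) * (\<Prod>j\<in>R. fact (d j)) = fact (card T + 1) * diff_prod R (\<lambda>j. real (d j))"
    proof (rule count_step[OF d sum_d])
      show "real (card (S i)) * (\<Prod>j\<in>R. fact ((d(i := d i - 1)) j)) = fact (card T) * diff_prod R (\<lambda>j. real ((d(i := d i - 1)) j))"
        if "i \<in> ?I" for i
        using IH[OF that] unfolding good_def S_def L_def by blast
    qed
    moreover have "\<forall>x\<in>Sol d T'. nondegenerate d d T' x \<and> cnj_mat x = x"
      unfolding Sol_eq using z_nd z_real by auto
    ultimately have "good d T'" unfolding good_def by (simp only: T'(3) simp_thms)
    then show ?case by (simp only: T'_def)
  qed
qed

section \<open>The one-point cell and the choice of the points\<close>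

lemma card_lessThan_pos_image: "bij_betw pos {i::'n. i < j} {..<pos j}"
proof -
  have inj: "inj_on pos {i::'n. i < j}" by (rule inj_on_subset[OF inj_pos]) simp
  have "pos ` {i::'n. i < j} = {..<pos j}"
    by (rule card_subset_eq) (auto simp: pos_strict_mono card_image[OF inj], simp add: pos_def)
  then show ?thesis using inj by (simp add: bij_betw_def)
qed

text \<open>For fixed \<open>j\<close> the differences to the earlier positions run through 1, ...,
  \<open>pos j\<close>. The shift \<open>c\<close> cancels, so the same value serves the one-point
  cell and the open cell.\<close>

lemma diff_prod_pos:
  assumes "\<And>i. i \<in> R \<Longrightarrow> f i = real (pos i) + c"
  shows "diff_prod R f = (\<Prod>j\<in>R. fact (pos j))"
proof -
  have eq: "{p \<in> R \<times> R. fst p < snd p} = (\<lambda>(j, i). (i, j)) ` (SIGMA j:R. {i. i < j})"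
    using R_downward by (auto simp: image_iff)
  have inj: "inj_on (\<lambda>(j::'n, i::'n). (i, j)) (SIGMA j:R. {i. i < j})" by (auto simp: inj_on_def)
  have "diff_prod R f = (\<Prod>p\<in>(SIGMA j:R. {i. i < j}). f (fst p) - f (snd p))"
    unfolding diff_prod_def eq prod.reindex[OF inj] by (intro prod.cong) auto
  also have "\<dots> = (\<Prod>j\<in>R. \<Prod>i\<in>{i. i < j}. f j - f i)"
    by (subst prod.Sigma) (auto simp: case_prod_beta)
  also have "\<dots> = (\<Prod>j\<in>R. fact (pos j))"
  proof (intro prod.cong refl)
    fix j assume j: "j \<in> R"
    have "(\<Prod>i\<in>{i. i < j}. f j - f i) = (\<Prod>i\<in>{i. i < j}. real (pos j - pos i))"
      using assms j R_downward[OF j] by (intro prod.cong) (auto simp: of_nat_diff pos_strict_mono less_imp_le)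
    also have "\<dots> = (\<Prod>a\<in>{..<pos j}. real (pos j - a))"
      by (rule prod.reindex_bij_betw[OF card_lessThan_pos_image])
    also have "\<dots> = fact (pos j)" by (simp add: fact_prod_rev atLeast0LessThan)
    finally show "(\<Prod>i\<in>{i. i < j}. f j - f i) = fact (pos j)" .
  qed
  finally show ?thesis .
qed

lemma pos_le_adm:
  assumes "adm d" "i \<in> R"
  shows "pos i \<le> d i"
proof -
  have "inj_on d {l. l < i}" using adm_inj[OF assms(1)] R_downward[OF assms(2)] by (auto simp: inj_on_def)
  moreover have "d ` {l. l < i} \<subseteq> {..<d i}"
    using adm_less_iff[OF assms(1) _ assms(2)] R_downward[OF assms(2)] by auto
  ultimately have "card {l. l < i} \<le> card {..<d i}" by (intro card_inj_on_le) auto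
  then show ?thesis by (simp add: pos_def)
qed

text \<open>\<open>q\<close> is the least possible sum, so the pivots are the positions themselves;
  no free coordinate is left and the cell is a point.\<close>

lemma good_base:
  assumes d: "adm d" and sum_d: "sum d R = q"
  shows "good d {}"
proof -
  have d_pos: "d i = pos i" if "i \<in> R" for i
  proof (rule ccontr)
    assume "d i \<noteq> pos i"
    then have "pos i < d i" using pos_le_adm[OF d that] by simp
    then have "sum pos R < sum d R"
      using that pos_le_adm[OF d] by (intro sum_strict_mono_ex1) auto
    then show False using sum_d by (simp add: q_def)
  qed
  have "card (free d d) + q = sum d R"
    by (rule card_free[OF d d]) (use adm_less_iff[OF d] in \<open>simp flip: not_less\<close>)
  moreover have "finite (free d d)" by simp
  ultimately have free: "free d d = {}" using sum_d by simp
  have cases: "i \<notin> R \<or> d i < dg b \<or> (\<exists>l\<in>R. b = col (d l))" for i b :: 'n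
  proof (rule ccontr)
    assume "\<not> ?thesis"
    then have "(i, b) \<in> free d d" by (auto simp: free_def)
    then show False using free by simp
  qed
  define x0 :: "'n cmat" where "x0 = (\<chi> i b. if i \<in> R \<and> b = col (d i) then 1 else 0)"
  have x0: "cell d x0"
    unfolding chart_def le_def x0_def
    using adm_col_eq[OF d] adm_less_card[OF d] by (auto simp: vec_eq_iff)
  have "x = x0" if x: "cell d x" for x
  proof -
    have "x $ i $ b = x0 $ i $ b" for i b
      using cases[of i b] x x0 by (cases "i \<in> R") (auto simp: chart_def le_def)
    then show ?thesis by (simp add: vec_eq_iff)
  qed
  then have "x \<in> Sol d {} \<longleftrightarrow> x = x0" for x using x0 unfolding Sol_def vanishes_def by blast
  then have Sol: "Sol d {} = {x0}" by blast
  have "nondegenerate d d {} x0"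
    unfolding nondegenerate_def
  proof (intro allI impI)
    fix v assume v: "tangent d d v"
    have "v $ i $ b = 0" for i b
      using cases[of i b] v by (cases "i \<in> R") (auto simp: tangent_def le_def)
    then show "v = 0" by (simp add: vec_eq_iff)
  qed
  moreover have "cnj_mat x0 = x0" by (simp add: cnj_mat_def x0_def vec_eq_iff)
  moreover have "(\<Prod>i\<in>R. fact (d i)) = diff_prod R (\<lambda>i. real (d i))"
    using diff_prod_pos[of "\<lambda>i. real (d i)" 0] d_pos by simp
  ultimately show ?thesis by (simp add: good_def Sol)
qed

text \<open>The points must work for all cells of dimension \<open>m\<close> at once, because the
  step for a cell uses every lowering of it with the same points. As there are finitely many
  admissible \<open>d\<close>, one small \<tau> serves them all.\<close>

lemma ex_good:
  "\<exists>T. finite T \<and> card T = m \<and> (\<forall>t\<in>T. 0 < t) \<and> (\<forall>d. adm d \<longrightarrow> sum d R = q + m \<longrightarrow> good d T)"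
proof (induction m)
  case 0
  show ?case by (rule exI[of _ "{}"]) (auto intro: good_base)
next
  case (Suc m)
  then obtain T where T: "finite T" "card T = m" "\<And>t. t \<in> T \<Longrightarrow> 0 < t"
    and good: "\<And>d. adm d \<Longrightarrow> sum d R = q + m \<Longrightarrow> good d T" by auto
  have T0: "0 \<notin> T" using T(3) by auto
  let ?A = "{d. adm d \<and> sum d R = q + Suc m}"
  have "?A \<subseteq> (\<Pi>\<^sub>E i\<in>UNIV. {..<CARD('n)})" by (auto simp: adm_def)
  then have finA: "finite ?A" by (rule finite_subset) (auto intro: finite_PiE)
  have "\<forall>\<^sub>F \<tau> in at_right 0. good d (insert (1 / \<tau>) T)" if "d \<in> ?A" for d
  proof (rule good_step[OF _ T(1) T0])
    show "adm d" "q + card T + 1 = sum d R" using that T(2) by auto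
    show "good (d(i := d i - 1)) T" if "i \<in> lowerable d" for i
      using that sum_lowered[of i d] \<open>d \<in> ?A\<close> by (intro good) (auto simp: lowerable_def)
  qed
  then have ev: "\<forall>\<^sub>F \<tau> in at_right 0. \<forall>d\<in>?A. good d (insert (1 / \<tau>) T)"
    using finA by (intro eventually_ball_finite) auto
  have "\<forall>\<^sub>F \<tau> in at_right 0. 0 < \<tau> \<and> 1 / \<tau> \<notin> T"
  proof -
    have "\<forall>\<^sub>F \<tau> in at_right 0. \<tau> \<noteq> 1 / t" if "t \<in> T" for t :: real
      using eventually_at_right_real[of 0 "1 / t"] T(3)[OF that] by (auto elim: eventually_mono)
    then have "\<forall>\<^sub>F \<tau> in at_right 0. \<forall>t\<in>T. \<tau> \<noteq> 1 / t" using T(1) by (intro eventually_ball_finite) auto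
    then show ?thesis using eventually_at_right_less[of "0::real"]
      by eventually_elim auto
  qed
  from eventually_happens'[OF trivial_limit_at_right_real eventually_conj[OF ev this]]
  obtain \<tau> where "\<forall>d\<in>?A. good d (insert (1 / \<tau>) T)" "0 < \<tau>" "1 / \<tau> \<notin> T" by auto
  then show ?case using T by (intro exI[of _ "insert (1 / \<tau>) T"]) auto
qed

end

section \<open>Osculating flags\<close>

lemma det_eq_0_iff_row_relation:
  fixes A :: "'a::field ^ 'n::finite ^ 'n"
  shows "det A = 0 \<longleftrightarrow> (\<exists>w. w \<noteq> 0 \<and> (\<forall>b. (\<Sum>i\<in>UNIV. w $ i * A $ i $ b) = 0))"
proof -
  have "(\<exists>w. w \<noteq> 0 \<and> (\<forall>b. (\<Sum>i\<in>UNIV. w $ i * A $ i $ b) = 0))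
     \<longleftrightarrow> \<not> (\<forall>w. transpose A *v w = 0 \<longrightarrow> w = 0)"
    by (auto simp: matrix_vector_mult_def transpose_def vec_eq_iff mult.commute)
  also have "\<dots> \<longleftrightarrow> \<not> inj ((*v) (transpose A))"
    by (simp add: vec.inj_iff_eq_0)
  also have "\<dots> \<longleftrightarrow> det A = 0"
    by (metis det_transpose inj_matrix_vector_mult invertible_det_nz invertible_left_inverse
        matrix_left_invertible_injective)
  finally show ?thesis by simp
qed

text \<open>The sum is a polynomial in \<open>z\<close> of degree below \<open>N\<close>, so
  \<open>N\<close> zeros make it vanish identically. Evaluating it at \<open>z = r i\<close> then
  isolates \<open>w i\<close>, since the binomials of larger lower index vanish there and the
  smaller ones are settled by induction.\<close>

lemma binomial_sums_vanish:
  fixes w :: "'i::wellorder \<Rightarrow> real"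
  assumes A: "finite A" and r: "\<And>i j. i \<in> A \<Longrightarrow> j \<in> A \<Longrightarrow> i < j \<Longrightarrow> r i < r j"
    and N: "\<And>i. i \<in> A \<Longrightarrow> r i < N"
    and Z: "N \<le> card Z" "finite Z" "\<And>z. z \<in> Z \<Longrightarrow> (\<Sum>i\<in>A. w i * real (z choose r i)) = 0"
    and i: "i \<in> A"
  shows "w i = 0"
proof -
  define p where "p = (\<Sum>i\<in>A. smult (w i / fact (r i)) (\<Prod>a<r i. [:- real a, 1:]))"
  have p: "poly p (real z) = (\<Sum>i\<in>A. w i * real (z choose r i))" for z
    unfolding p_def poly_sum poly_smult poly_prod
    by (intro sum.cong refl)
      (simp add: binomial_gbinomial gbinomial_prod_rev atLeast0LessThan algebra_simps)
  have "p = 0"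
  proof (rule ccontr)
    assume "p \<noteq> 0"
    have "degree p < N"
      unfolding p_def
    proof (rule degree_sum_less)
      show "0 < N" using N[OF i] by simp
      show "degree (smult (w i / fact (r i)) (\<Prod>a<r i. [:- real a, 1:])) < N" if "i \<in> A" for i
      proof -
        have "degree (\<Prod>a<r i. [:- real a, 1:]) \<le> r i"
          using degree_prod_sum_le[of "{..<r i}" "\<lambda>a. [:- real a, 1:]"] by simp
        then show ?thesis using N[OF that] degree_smult_le[of "w i / fact (r i)"] le_trans le_less_trans by metis
      qed
    qed
    have "real ` Z \<subseteq> {z. poly p z = 0}" using p Z(3) by auto
    then have "card (real ` Z) \<le> card {z. poly p z = 0}" by (intro card_mono poly_roots_finite[OF \<open>p \<noteq> 0\<close>])
    also have "\<dots> \<le> degree p" by (rule card_poly_roots_bound[OF \<open>p \<noteq> 0\<close>])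
    finally have "card Z \<le> degree p" by (simp add: card_image inj_on_def)
    then show False using Z(1) \<open>degree p < N\<close> by simp
  qed
  then have vanish: "(\<Sum>i\<in>A. w i * real (z choose r i)) = 0" for z using p[of z] by simp
  show ?thesis using i
  proof (induction i rule: less_induct)
    case (less i)
    have "0 = (\<Sum>j\<in>A. w j * real (r i choose r j))" using vanish by simp
    also have "\<dots> = (\<Sum>j\<in>A. if j = i then w i else 0)"
    proof (intro sum.cong refl)
      fix j assume j: "j \<in> A"
      consider "j < i" | "j = i" | "i < j" by (rule linorder_cases)
      then show "w j * real (r i choose r j) = (if j = i then w i else 0)"
        using less j r[OF less.prems j] by cases (auto simp: binomial_eq_0)
    qed
    finally show ?case using A less.prems by simp
  qed
qed

text \<open>For positions at least \<open>k\<close>, the osculating row of index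
  \<open>pos i - k\<close> at t = 1.\<close>

definition binom_row :: "nat \<Rightarrow> 'n::{finite,wellorder} \<Rightarrow> 'n \<Rightarrow> real" where
  "binom_row k i b = real (pos b choose (pos i - k))"

text \<open>In a row relation, the columns other than \<open>col (\<delta> i)\<close> see only the
  binomial rows: a polynomial of degree below n - k in the position, with at least n - k zeros. So
  these rows have coefficient 0, and then so do the distinct unit rows.\<close>

lemma wronski_form_binom_row:
  assumes k: "k < CARD('n::{finite,wellorder})"
  shows "wronski_form k (binom_row k :: 'n \<Rightarrow> 'n \<Rightarrow> real)"
proof
  show "k \<le> CARD('n)" using k by simp
  fix \<delta> :: "'n \<Rightarrow> nat"
  assume inj: "inj_on \<delta> {i::'n. pos i < k}" and lt: "\<And>i. \<delta> i < CARD('n)"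
  let ?R = "{i::'n. pos i < k}"
  let ?M = "(\<chi> i b. if pos i < k then if b = col (\<delta> i) then 1 else 0 else binom_row k i b) :: ((real, 'n) vec, 'n) vec"
  show "det ?M \<noteq> 0"
  proof
    assume "det ?M = 0"
    then obtain w where w: "w \<noteq> 0" "\<And>b. (\<Sum>i\<in>UNIV. w $ i * ?M $ i $ b) = 0"
      using det_eq_0_iff_row_relation[of ?M] by auto
    have split: "(\<Sum>i\<in>?R. if b = col (\<delta> i) then w $ i else 0) + (\<Sum>i\<in>- ?R. w $ i * binom_row k i b) = 0" for b
    proof -
      have "(\<Sum>i\<in>UNIV. w $ i * ?M $ i $ b) = (\<Sum>i\<in>?R. w $ i * ?M $ i $ b) + (\<Sum>i\<in>- ?R. w $ i * ?M $ i $ b)"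
        by (subst sum.union_disjoint[symmetric]) (auto intro: sum.cong)
      also have "(\<Sum>i\<in>?R. w $ i * ?M $ i $ b) = (\<Sum>i\<in>?R. if b = col (\<delta> i) then w $ i else 0)"
        by (intro sum.cong) auto
      also have "(\<Sum>i\<in>- ?R. w $ i * ?M $ i $ b) = (\<Sum>i\<in>- ?R. w $ i * binom_row k i b)"
        by (intro sum.cong) auto
      finally show ?thesis using w(2)[of b] by simp
    qed
    have "inj_on pos ?R" by (rule inj_on_subset[OF inj_pos]) simp
    then have cardR: "card ?R \<le> k" using card_inj_on_le[of pos ?R "{..<k}"] by auto
    let ?Z = "pos ` (- (\<lambda>i. col (\<delta> i) :: 'n) ` ?R)"
    have comp: "w $ i = 0" if "i \<in> - ?R" for i
    proof (rule binomial_sums_vanish[of "- ?R" "\<lambda>i. pos i - k" "CARD('n) - k" ?Z "\<lambda>i. w $ i"])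
      show "pos i - k < pos j - k" if "i \<in> - ?R" "j \<in> - ?R" "i < j" for i j
        using that pos_strict_mono[of i j] by auto
      show "pos i - k < CARD('n) - k" if "i \<in> - ?R" for i using pos_less_card[of i] that by auto
      have "card ((\<lambda>i. col (\<delta> i) :: 'n) ` ?R) \<le> k"
        using card_image_le[of ?R "\<lambda>i. col (\<delta> i) :: 'n"] cardR by simp
      then show "CARD('n) - k \<le> card ?Z"
        by (simp add: card_image inj_on_subset[OF inj_pos subset_UNIV] Compl_eq_Diff_UNIV card_Diff_subset)
      show "(\<Sum>i\<in>- ?R. w $ i * real (z choose (pos i - k))) = 0" if z: "z \<in> ?Z" for z
      proof -
        obtain b :: 'n where b: "z = pos b" "b \<notin> (\<lambda>i. col (\<delta> i)) ` ?R" using z by auto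
        have "(\<Sum>i\<in>?R. if b = col (\<delta> i) then w $ i else 0) = 0" using b(2) by (intro sum.neutral) auto
        then show ?thesis using split[of b] b(1) by (simp add: binom_row_def)
      qed
    qed (use that in auto)
    have "w $ i = 0" if i: "i \<in> ?R" for i
    proof -
      have "(\<Sum>j\<in>?R. if col (\<delta> i) = (col (\<delta> j) :: 'n) then w $ j else 0) = (\<Sum>j\<in>?R. if j = i then w $ i else 0)"
      proof (intro sum.cong refl)
        fix j assume j: "j \<in> ?R"
        have "col (\<delta> i) = (col (\<delta> j) :: 'n) \<longleftrightarrow> i = j"
          using inj_onD[OF inj _ i j] lt by (metis dg_col)
        then show "(if col (\<delta> i) = (col (\<delta> j) :: 'n) then w $ j else 0) = (if j = i then w $ i else 0)" by auto
      qed
      moreover have "(\<Sum>j\<in>- ?R. w $ j * binom_row k j (col (\<delta> i))) = 0" using comp by (intro sum.neutral) auto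
      ultimately show ?thesis using split[of "col (\<delta> i)"] i by simp
    qed
    then have "w = 0" using comp by (auto simp: vec_eq_iff)
    then show False using w(1) by simp
  qed
qed

lemma osc_row_eq: "osc_row a t $ b = of_nat (pos b choose a) * t ^ (pos b - a)"
  by (auto simp: osc_row_def binomial_eq_0)

context
  fixes k :: nat
  assumes k: "k < CARD('n::{finite,wellorder})"
begin

interpretation W: wronski_form k "binom_row k :: 'n \<Rightarrow> 'n \<Rightarrow> real"
  by (rule wronski_form_binom_row[OF k])

lemma osc_flag_eq: "osc_flag (CARD('n) - k) t = vec.span ((\<lambda>i::'n. osc_row (pos i - k) t :: (complex, 'n) vec) ` (- W.R))"
proof -
  have "{osc_row a t | a. a < CARD('n) - k} = (\<lambda>i::'n. osc_row (pos i - k) t :: (complex, 'n) vec) ` (- W.R)"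
  proof (intro set_eqI iffI)
    fix v assume "v \<in> {osc_row a t :: (complex, 'n) vec | a. a < CARD('n) - k}"
    then obtain a where a: "v = osc_row a t" "a < CARD('n) - k" by auto
    then have "a + k \<in> range (pos :: 'n \<Rightarrow> nat)" unfolding range_pos using k by simp
    then obtain i :: 'n where i: "pos i = a + k" by (metis imageE)
    show "v \<in> (\<lambda>i::'n. osc_row (pos i - k) t) ` (- W.R)"
      by (rule image_eqI[of _ _ i]) (use a i in \<open>auto simp: W.R_def\<close>)
  next
    fix v assume "v \<in> (\<lambda>i::'n. osc_row (pos i - k) t :: (complex, 'n) vec) ` (- W.R)"
    then obtain i :: 'n where i: "v = osc_row (pos i - k) t" "\<not> pos i < k" by (auto simp: W.R_def)
    then have "pos i - k < CARD('n) - k" using pos_less_card[of i] by simp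
    then show "v \<in> {osc_row a t | a. a < CARD('n) - k}" using i by blast
  qed
  then show ?thesis by (simp add: osc_flag_def)
qed

lemma osc_rows_independent:
  assumes "(\<Sum>i\<in>- W.R. w i *s (osc_row (pos i - k) t :: (complex, 'n) vec)) = 0" and i: "i \<in> - W.R"
  shows "w i = 0"
  using i
proof (induction i rule: less_induct)
  case (less i)
  have "pos i - k \<in> range (pos :: 'n \<Rightarrow> nat)" unfolding range_pos using pos_less_card[of i] by simp
  then obtain b :: 'n where b: "pos b = pos i - k" by (metis imageE)
  have "0 = (\<Sum>j\<in>- W.R. w j * (osc_row (pos j - k) t :: (complex, 'n) vec) $ b)"
    using arg_cong[OF assms(1), of "\<lambda>v. v $ b"] by simp
  also have "\<dots> = (\<Sum>j\<in>- W.R. if j = i then w i else 0)"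
  proof (intro sum.cong refl)
    fix j assume j: "j \<in> - W.R"
    consider "j < i" | "j = i" | "i < j" by (rule linorder_cases)
    then show "w j * (osc_row (pos j - k) t :: (complex, 'n) vec) $ b = (if j = i then w i else 0)"
    proof cases
      case 3
      then have "pos b < pos j - k" using b pos_strict_mono[of i j] less.prems by (auto simp: W.R_def)
      then show ?thesis using 3 by (simp add: osc_row_eq binomial_eq_0)
    qed (use less j b in \<open>auto simp: osc_row_eq\<close>)
  qed
  finally show ?case using less.prems by simp
qed

lemma poly_P_det:
  "poly (W.P x) t = det (\<chi> i b. if i \<in> W.R then x $ i $ b * t ^ dg b else of_real (binom_row k i b))"
proof -
  have "poly (W.P x) t = (\<Sum>p | p permutes UNIV. of_int (sign p) *
      (\<Prod>i\<in>UNIV. poly (if i \<in> W.R then monom (x $ i $ p i) (dg (p i)) else [:complex_of_real (binom_row k i (p i)):]) t))"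
    by (simp add: W.P_def det_def poly_sum poly_prod poly_of_int)
  also have "\<dots> = det (\<chi> i b. if i \<in> W.R then x $ i $ b * t ^ dg b else of_real (binom_row k i b))"
    unfolding det_def by (intro sum.cong refl arg_cong2[of _ _ _ _ "(*)"] prod.cong) (auto simp: poly_monom)
  finally show ?thesis .
qed

text \<open>Both sides say that the rows of \<open>x\<close> and the osculating rows together are
  linearly dependent. As \<open>t\<close> is nonzero, the matrix behind \<open>P\<close> differs
  from the stacked one by nonzero scalings of rows and columns.\<close>

lemma poly_P_eq_0_iff_meets_osc_flag:
  assumes ind: "\<And>a i. (\<Sum>j\<in>W.R. a j *s x $ j) = 0 \<Longrightarrow> i \<in> W.R \<Longrightarrow> a i = 0" and t: "t \<noteq> 0"
  shows "poly (W.P x) t = 0 \<longleftrightarrow> W.row_span x \<inter> osc_flag (CARD('n) - k) t \<noteq> {0}"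
proof -
  define A :: "'n cmat" where "A = (\<chi> i b. if i \<in> W.R then x $ i $ b * t ^ dg b else of_real (binom_row k i b))"
  define B where "B i = (if i \<in> W.R then x $ i else osc_row (pos i - k) t)" for i
  \<comment> \<open>For row index a = \<open>pos i - k\<close>, the exponents
    \<open>pos b - a\<close> and \<open>dg b\<close> add up to n - 1 - a, whatever the
    column.\<close>
  define c where "c i = (if i \<in> W.R then 1 else t ^ (CARD('n) - 1 - (pos i - k)))" for i :: 'n
  have c0: "c i \<noteq> 0" for i using t by (simp add: c_def)
  have scale: "B i $ b * t ^ dg b = c i * A $ i $ b" for i b
  proof (cases "i \<in> W.R \<or> pos b < pos i - k")
    case True
    then show ?thesis by (auto simp: A_def B_def c_def osc_row_eq binom_row_def binomial_eq_0)
  next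
    case False
    then have "pos b - (pos i - k) + dg b = CARD('n) - 1 - (pos i - k)" using pos_add_dg[of b] by simp
    then have "t ^ (pos b - (pos i - k)) * t ^ dg b = t ^ (CARD('n) - 1 - (pos i - k))"
      by (simp flip: power_add)
    then show ?thesis using False by (simp add: A_def B_def c_def osc_row_eq binom_row_def algebra_simps)
  qed
  have rel: "(\<Sum>i\<in>UNIV. w i * c i * A $ i $ b) = 0 \<longleftrightarrow> (\<Sum>i\<in>UNIV. w i * B i $ b) = 0" for w b
  proof -
    have "(\<Sum>i\<in>UNIV. w i * c i * A $ i $ b) = (\<Sum>i\<in>UNIV. w i * B i $ b) * t ^ dg b"
      by (simp add: sum_distrib_right mult.assoc scale)
    then show ?thesis using t by simp
  qed
  have split: "(\<Sum>i\<in>UNIV. w i *s B i)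
      = (\<Sum>i\<in>W.R. w i *s x $ i) + (\<Sum>i\<in>- W.R. w i *s osc_row (pos i - k) t)" for w
  proof -
    have "(\<Sum>i\<in>UNIV. w i *s B i) = (\<Sum>i\<in>W.R. w i *s B i) + (\<Sum>i\<in>- W.R. w i *s B i)"
      by (subst sum.union_disjoint[symmetric]) (auto intro: sum.cong)
    also have "(\<Sum>i\<in>W.R. w i *s B i) = (\<Sum>i\<in>W.R. w i *s x $ i)" by (intro sum.cong) (auto simp: B_def)
    also have "(\<Sum>i\<in>- W.R. w i *s B i) = (\<Sum>i\<in>- W.R. w i *s osc_row (pos i - k) t)"
      by (intro sum.cong) (auto simp: B_def)
    finally show ?thesis .
  qed
  have "poly (W.P x) t = 0 \<longleftrightarrow> (\<exists>w. w \<noteq> 0 \<and> (\<forall>b. (\<Sum>i\<in>UNIV. w $ i * A $ i $ b) = 0))"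
    unfolding poly_P_det A_def[symmetric] by (rule det_eq_0_iff_row_relation)
  also have "\<dots> \<longleftrightarrow> (\<exists>w. (\<exists>i. w i \<noteq> 0) \<and> (\<Sum>i\<in>UNIV. w i *s B i) = 0)"
  proof
    assume "\<exists>w. w \<noteq> 0 \<and> (\<forall>b. (\<Sum>i\<in>UNIV. w $ i * A $ i $ b) = 0)"
    then obtain w where w: "w \<noteq> 0" "\<And>b. (\<Sum>i\<in>UNIV. w $ i * A $ i $ b) = 0" by auto
    have "(\<Sum>i\<in>UNIV. (w $ i / c i) * B i $ b) = 0" for b
      using rel[of "\<lambda>i. w $ i / c i" b] w(2)[of b] c0 by simp
    then have "(\<Sum>i\<in>UNIV. (w $ i / c i) *s B i) = 0" by (simp add: vec_eq_iff)
    moreover have "\<exists>i. w $ i / c i \<noteq> 0" using w(1) c0 by (auto simp: vec_eq_iff)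
    ultimately show "\<exists>w. (\<exists>i. w i \<noteq> 0) \<and> (\<Sum>i\<in>UNIV. w i *s B i) = 0"
      by (intro exI[of _ "\<lambda>i. w $ i / c i"]) auto
  next
    assume "\<exists>w. (\<exists>i. w i \<noteq> 0) \<and> (\<Sum>i\<in>UNIV. w i *s B i) = 0"
    then obtain w i where w: "w i \<noteq> 0" "(\<Sum>i\<in>UNIV. w i *s B i) = 0" by auto
    have "(\<Sum>i\<in>UNIV. w i * B i $ b) = 0" for b
      using arg_cong[OF w(2), of "\<lambda>v. v $ b"] by simp
    then have "\<forall>b. (\<Sum>i\<in>UNIV. w i * c i * A $ i $ b) = 0" using rel by simp
    moreover have "(\<chi> i. w i * c i) \<noteq> 0" using w(1) c0[of i] by (auto simp: vec_eq_iff)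
    ultimately show "\<exists>w. w \<noteq> 0 \<and> (\<forall>b. (\<Sum>i\<in>UNIV. w $ i * A $ i $ b) = 0)"
      by (intro exI[of _ "\<chi> i. w i * c i"]) auto
  qed
  also have "\<dots> \<longleftrightarrow> (\<exists>v. v \<in> W.row_span x \<and> v \<in> osc_flag (CARD('n) - k) t \<and> v \<noteq> 0)"
  proof
    assume "\<exists>w. (\<exists>i. w i \<noteq> 0) \<and> (\<Sum>i\<in>UNIV. w i *s B i) = 0"
    then obtain w i where w: "w i \<noteq> 0" "(\<Sum>i\<in>UNIV. w i *s B i) = 0" by auto
    let ?v = "\<Sum>i\<in>W.R. w i *s x $ i"
    let ?u = "\<Sum>i\<in>- W.R. w i *s (osc_row (pos i - k) t :: (complex, 'n) vec)"
    have vu: "?v + ?u = 0" using w(2) split by simp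
    have "?v \<in> W.row_span x" by (intro vec.span_sum vec.span_scale W.row_in_span)
    moreover have "?v \<in> osc_flag (CARD('n) - k) t"
    proof -
      have "- ?u \<in> osc_flag (CARD('n) - k) t"
        unfolding osc_flag_eq by (intro vec.span_neg vec.span_sum vec.span_scale vec.span_base imageI)
      moreover have "?v = - ?u" using vu by (simp add: eq_neg_iff_add_eq_0)
      ultimately show ?thesis by (simp only:)
    qed
    moreover have "?v \<noteq> 0"
    proof
      assume v0: "?v = 0"
      then have "?u = 0" using vu by simp
      then have "w i = 0" using ind[OF v0, of i] osc_rows_independent[of w t i] by (cases "i \<in> W.R") auto
      then show False using w by simp
    qed
    ultimately show "\<exists>v. v \<in> W.row_span x \<and> v \<in> osc_flag (CARD('n) - k) t \<and> v \<noteq> 0" by blast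
  next
    assume "\<exists>v. v \<in> W.row_span x \<and> v \<in> osc_flag (CARD('n) - k) t \<and> v \<noteq> 0"
    then obtain v where v: "v \<in> W.row_span x" "v \<in> osc_flag (CARD('n) - k) t" "v \<noteq> 0" by auto
    obtain a where a: "v = (\<Sum>i\<in>W.R. a i *s x $ i)" by (rule span_imageE[OF finite v(1)])
    obtain u where u: "v = (\<Sum>i\<in>- W.R. u i *s osc_row (pos i - k) t)"
      by (rule span_imageE[OF finite v(2)[unfolded osc_flag_eq]])
    let ?w = "\<lambda>i. if i \<in> W.R then a i else - u i"
    have "(\<Sum>i\<in>W.R. ?w i *s x $ i) = v" unfolding a by (intro sum.cong) auto
    moreover have "(\<Sum>i\<in>- W.R. ?w i *s (osc_row (pos i - k) t :: (complex, 'n) vec)) = - v"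
      unfolding u sum_negf[symmetric] by (intro sum.cong) (auto simp: vec.scale_minus_left)
    ultimately have w_rel: "(\<Sum>i\<in>UNIV. ?w i *s B i) = 0" using split[of ?w] by simp
    have w_ne: "\<exists>i. ?w i \<noteq> 0"
    proof (rule ccontr)
      assume "\<not> (\<exists>i. ?w i \<noteq> 0)"
      then have w0: "?w i = 0" for i by blast
      have "a i = 0" if "i \<in> W.R" for i using w0[of i] that by simp
      then have "v = 0" unfolding a by (intro sum.neutral) auto
      then show False using v(3) by simp
    qed
    show "\<exists>w. (\<exists>i. w i \<noteq> 0) \<and> (\<Sum>i\<in>UNIV. w i *s B i) = 0"
      by (rule exI[of _ ?w], rule conjI[OF w_ne w_rel])
  qed
  also have "\<dots> \<longleftrightarrow> W.row_span x \<inter> osc_flag (CARD('n) - k) t \<noteq> {0}"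
    using vec.span_zero unfolding osc_flag_eq by blast
  finally show ?thesis .
qed

section \<open>From the open cell to the Grassmannian\<close>

lemma cell_rows_independent:
  assumes "W.cell d x" "(\<Sum>j\<in>W.R. a j *s x $ j) = 0" "i \<in> W.R"
  shows "a i = 0"
proof -
  have "0 = (\<Sum>j\<in>W.R. a j * x $ j $ col (d i))" using arg_cong[OF assms(2), of "\<lambda>v. v $ col (d i)"] by simp
  also have "\<dots> = (\<Sum>j\<in>W.R. if j = i then a i else 0)"
    using assms(1,3) by (intro sum.cong) (auto simp: W.chart_def)
  finally show ?thesis using assms(3) by simp
qed

lemma real_row_span:
  fixes x :: "'n cmat"
  assumes "W.cnj_mat x = x"
  shows "real_subspace (W.row_span x)"
  unfolding real_subspace_def
proof
  have re: "x $ i $ b \<in> \<real>" for i b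
  proof -
    have "cnj (x $ i $ b) = x $ i $ b" using arg_cong[OF assms, of "\<lambda>m. m $ i $ b"] by (simp add: W.cnj_mat_def)
    then show ?thesis by (simp add: Reals_cnj_iff)
  qed
  show "vec.span {v \<in> W.row_span x. \<forall>i. v $ i \<in> \<real>} \<subseteq> W.row_span x"
    by (intro vec.span_minimal vec.subspace_span) auto
  show "W.row_span x \<subseteq> vec.span {v \<in> W.row_span x. \<forall>i. v $ i \<in> \<real>}"
    by (rule vec.span_mono) (auto simp: re W.row_in_span)
qed

text \<open>The \<open>k - 1 - pos i\<close> later pivots must fit strictly between
  \<open>d i\<close> and the dimension.\<close>

lemma adm_le_top:
  assumes d: "W.adm d" and i: "i \<in> W.R"
  shows "d i \<le> CARD('n) - k + pos i"
proof -
  have "card {l. l \<le> i} + card {l \<in> W.R. i < l} = card W.R"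
  proof -
    have "W.R = {l. l \<le> i} \<union> {l \<in> W.R. i < l}" using W.R_downward[OF i] by (auto simp: not_le)
    moreover have "{l. l \<le> i} \<inter> {l \<in> W.R. i < l} = {}" by auto
    ultimately show ?thesis using card_Un_disjoint[of "{l. l \<le> i}" "{l \<in> W.R. i < l}"] by simp
  qed
  then have "card {l \<in> W.R. i < l} + pos i + 1 = k" by (simp add: W.card_atMost_pos W.card_R)
  moreover have "card {l \<in> W.R. i < l} \<le> card {d i<..<CARD('n)}"
  proof (rule card_inj_on_le)
    show "inj_on d {l \<in> W.R. i < l}" by (rule inj_on_subset[OF W.adm_inj[OF d]]) auto
    show "d ` {l \<in> W.R. i < l} \<subseteq> {d i<..<CARD('n)}"
      using W.adm_less_iff[OF d i] W.adm_less_card[OF d] by auto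
  qed simp
  ultimately show ?thesis using W.adm_less_card[OF d, of i] k by simp
qed

text \<open>With k(n - k) nonzero roots the degree bound leaves only the open cell, so the solutions
  in the whole Grassmannian are those already counted in that cell.\<close>

lemma schubert_solutions_real:
  "\<exists>t :: nat \<Rightarrow> real. finite (schubert_solutions k t :: (complex, 'n) vec set set)
     \<and> card (schubert_solutions k t :: (complex, 'n) vec set set) = grass_degree k CARD('n)
     \<and> (\<forall>K \<in> (schubert_solutions k t :: (complex, 'n) vec set set). real_subspace K)"
proof -
  let ?m = "k * (CARD('n) - k)"
  obtain T where T: "finite T" "card T = ?m" "\<And>t. t \<in> T \<Longrightarrow> 0 < t"
    and good: "\<And>d. W.adm d \<Longrightarrow> sum d W.R = W.q + ?m \<Longrightarrow> W.good d T"
    using W.ex_good[of ?m] by auto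
  \<comment> \<open>The largest admissible pivots, those of the open cell.\<close>
  define d where "d i = (if i \<in> W.R then CARD('n) - k + pos i else 0)" for i :: 'n
  have "d r < d s" if "r \<in> W.R" "s \<in> W.R" "r < s" for r s
    using that pos_strict_mono[of r s] by (simp add: d_def)
  moreover have "d i < CARD('n)" for i
    using k by (cases "i \<in> W.R") (auto simp: d_def W.R_def)
  ultimately have adm: "W.adm d"
    unfolding W.adm_def strict_mono_on_def by blast
  have sum_d: "sum d W.R = W.q + ?m"
    by (simp add: d_def sum.distrib W.q_def W.card_R)
  note good_d = good[OF adm sum_d]
  obtain t where t: "bij_betw t {1..?m} T" using ex_bij_betw_nat_finite_1[OF T(1)] T(2) by auto
  have meets: "W.vanishes T x \<longleftrightarrow> (\<forall>i\<in>{1..?m}. W.row_span x \<inter> osc_flag (CARD('n) - k) (complex_of_real (t i)) \<noteq> {0})"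
    if x: "W.cell e x" for e x
  proof -
    have "W.vanishes T x \<longleftrightarrow> (\<forall>s\<in>T. W.row_span x \<inter> osc_flag (CARD('n) - k) (complex_of_real s) \<noteq> {0})"
      unfolding W.vanishes_def
    proof (intro ball_cong refl)
      fix s assume "s \<in> T"
      then have "complex_of_real s \<noteq> 0" using T(3)[of s] by simp
      then show "poly (W.P x) (complex_of_real s) = 0 \<longleftrightarrow> W.row_span x \<inter> osc_flag (CARD('n) - k) (complex_of_real s) \<noteq> {0}"
        by (intro poly_P_eq_0_iff_meets_osc_flag cell_rows_independent[OF x])
    qed
    also have "\<dots> \<longleftrightarrow> (\<forall>i\<in>{1..?m}. W.row_span x \<inter> osc_flag (CARD('n) - k) (complex_of_real (t i)) \<noteq> {0})"
      using t by (auto simp: bij_betw_def)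
    finally show ?thesis .
  qed
  have solutions: "schubert_solutions k t = W.row_span ` W.Sol d T"
  proof (intro equalityI subsetI)
    fix K :: "(complex, 'n) vec set" assume "K \<in> schubert_solutions k t"
    then have K: "vec.subspace K" "vec.dim K = k"
      "\<forall>i\<in>{1..?m}. K \<inter> osc_flag (CARD('n) - k) (complex_of_real (t i)) \<noteq> {0}"
      by (auto simp: schubert_solutions_def)
    obtain e x where x: "W.adm e" "W.cell e x" "W.row_span x = K"
      by (rule W.ex_cell_row_span[OF K(1,2)])
    have van: "W.vanishes T x" using meets[OF x(2)] K(3) x(3) by simp
    have "0 \<notin> T" using T(3) by auto
    then have "W.q + ?m \<le> degree (W.P x)"
      using W.degree_P_ge[OF W.P_cell_nonzero[OF x(1,2)] T(1)] van T(2) by (simp add: W.vanishes_def)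
    also have "\<dots> \<le> sum e W.R" using x(2) by (intro W.degree_P_le) (simp add: W.chart_def)
    finally have ge: "sum d W.R \<le> sum e W.R" using sum_d by simp
    \<comment> \<open>Every pivot of \<open>e\<close> is at most that of \<open>d\<close>, so a sum
      that is not smaller forces equality throughout.\<close>
    have ed: "e i = d i" if i: "i \<in> W.R" for i
    proof (rule ccontr)
      assume "e i \<noteq> d i"
      then have "e i < d i" using adm_le_top[OF x(1) i] i by (simp add: d_def)
      then have "sum e W.R < sum d W.R"
        using i adm_le_top[OF x(1)] by (intro sum_strict_mono_ex1) (auto simp: d_def)
      then show False using ge by simp
    qed
    then have "W.cell d x" using x(2) by (simp add: W.chart_def W.le_def)
    then show "K \<in> W.row_span ` W.Sol d T" using van x(3) by (auto simp: W.Sol_def)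
  next
    fix K assume "K \<in> W.row_span ` W.Sol d T"
    then obtain x where x: "W.cell d x" "W.vanishes T x" "K = W.row_span x" by (auto simp: W.Sol_def)
    have "vec.dim K = k" unfolding x(3) by (rule W.dim_row_span) (rule cell_rows_independent[OF x(1)])
    then show "K \<in> schubert_solutions k t"
      using x meets[OF x(1)] by (simp add: schubert_solutions_def vec.subspace_span)
  qed
  have inj: "inj_on W.row_span (W.Sol d T)"
    using W.chart_row_span_inj by (auto simp: inj_on_def W.Sol_def)
  have "card (W.Sol d T) = grass_degree k CARD('n)"
  proof -
    let ?A = "\<Prod>i\<in>{1..<k}. fact i :: nat" and ?B = "\<Prod>i\<in>{CARD('n) - k..<CARD('n)}. fact i :: nat"
    have num: "diff_prod W.R (\<lambda>i. real (d i)) = real ?A"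
    proof -
      have "diff_prod W.R (\<lambda>i. real (d i)) = (\<Prod>j\<in>W.R. fact (pos j))"
        by (rule W.diff_prod_pos[of _ "real (CARD('n) - k)"]) (simp add: d_def)
      also have "\<dots> = (\<Prod>a<k. fact a)" by (rule prod.reindex_bij_betw[OF W.bij_pos_R])
      also have "\<dots> = (\<Prod>a\<in>{1..<k}. fact a)" by (rule prod.mono_neutral_right) (auto simp: not_le)
      finally show ?thesis by simp
    qed
    have den: "(\<Prod>i\<in>W.R. fact (d i)) = real ?B"
    proof -
      have "(\<Prod>i\<in>W.R. fact (d i)) = (\<Prod>i\<in>W.R. (fact (CARD('n) - k + pos i) :: real))"
        by (intro prod.cong) (auto simp: d_def)
      also have "\<dots> = (\<Prod>a<k. fact (CARD('n) - k + a))" by (rule prod.reindex_bij_betw[OF W.bij_pos_R])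
      also have "\<dots> = (\<Prod>i\<in>{CARD('n) - k..<CARD('n)}. fact i)"
        using prod.shift_bounds_nat_ivl[of "fact :: nat \<Rightarrow> real" 0 "CARD('n) - k" k] k
        by (simp add: atLeast0LessThan add.commute)
      finally show ?thesis by simp
    qed
    have "real (card (W.Sol d T)) * real ?B = fact ?m * real ?A"
      using good_d num den T(2) by (simp add: W.good_def)
    then have "real (card (W.Sol d T) * ?B) = real (?A * fact ?m)" by (simp add: mult.commute)
    \<comment> \<open>The identity holds in the natural numbers, so the division in
      \<open>grass_degree\<close> is exact.\<close>
    then have "card (W.Sol d T) * ?B = ?A * fact ?m" by (simp only: of_nat_eq_iff)
    moreover have "?B > 0" by (simp add: prod_pos)
    ultimately show ?thesis unfolding grass_degree_def by (metis nonzero_mult_div_cancel_right less_irrefl)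
  qed
  moreover have "finite (W.Sol d T)" using good_d by (simp add: W.good_def)
  moreover have "real_subspace K" if "K \<in> W.row_span ` W.Sol d T" for K
    using that good_d real_row_span by (auto simp: W.good_def)
  ultimately show ?thesis
    by (intro exI[of _ t]) (simp add: solutions card_image[OF inj])
qed

end

theorem mainTheorem6:
  fixes k :: nat
  assumes "0 < k" and "k < CARD('n::{finite,wellorder})"
  shows "\<exists>t :: nat \<Rightarrow> real.
           finite (schubert_solutions k t :: (complex ^ 'n::{finite,wellorder}) set set) \<and>
           card (schubert_solutions k t :: (complex ^ 'n::{finite,wellorder}) set set) = grass_degree k CARD('n) \<and>
           (\<forall>K \<in> (schubert_solutions k t :: (complex ^ 'n::{finite,wellorder}) set set). real_subspace K)"
  using schubert_solutions_real[OF assms(2)] .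

end
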